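(* Consider the discrete-time LPV plant in LFT form $$\begin{bmatrix} z_{k+1} \\ \varphi_k \\ e_k \\ \hat{y}_k \end{bmatrix} = \begin{bmatrix} A_{ss} & A_{sp} & B_{1s} & B_{2s}\\ A_{ps} & A_{pp} & B_{1p} & B_{2p}\\ C_{1s} & C_{1p} & D_{11} & D_{12} \\ C_{2s} & C_{2p} & D_{21} & 0 \end{bmatrix} \begin{bmatrix} z_k \\ \vartheta_k \\ d_k \\ u_k \end{bmatrix}, \quad \vartheta_k = \Delta(k)\varphi_k,\quad z_0 \in \mathbb{I},$$ with $z_k\in\mathbb{R}^N$, $N=n+\bar N$, $\Delta(k) = \mathrm{diag}(\delta_k^{[1]} I_{m_1}, \dots, \delta_k^{[p]} I_{m_p})$, where the scheduling parameters satisfy $|\delta_k^{[i]}|\le 1$ for all $k$ and $i$ (otherwise arbitrary), and $\mathbb{I} = \{(\bar p,\bar q) : \bar p\in\varepsilon(P),\ \bar q\in\varepsilon(Q)\}$ with $P\in\mathbb{S}^n$, $Q\in\mathbb{S}^{\bar N}$ positive definite and $\varepsilon(P)=\{y: y^TPy\le 1\}$. Suppose the state variables are exactly measurable, i.e., $C_{2s} = I$, $C_{2p} = 0$, and $D_{21} = 0$. Then a static, state-feedback, $(\bar{h},1)$-eventually periodic nonstationary LPV (NSLPV) controller, with $\bar{h} \geq 0$, such that the closed loop is robustly stable and $$\sup \{\lVert e \rVert_{\ell_2} \mid \lVert d \rVert_{\ell_2} \leq 1,\ |\delta^{[i]}_k|\le 1\ \forall i,k,\ z_0 \in \mathbb{I}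 \}< \gamma,$$ exists if there exist positive definite matrices $R_0(k) \in \mathbb{S}^{N}$, $R_i(k) \in \mathbb{S}^{m_i}$, $S_i(k) \in \mathbb{S}^{m_i}$ for $i \in \{1,\dots,p\}$ and $k = 0,1,\dots,\bar{h}$, and positive scalars $b$, $f_{11}$, $f_{12}$, $f_{2}$, $g$, $t$ such that $$b + f_{11} + f_{12} + f_2 < 2\gamma, \quad \begin{bmatrix} F_1 & \Gamma^T \\ \Gamma & R_0(0) \end{bmatrix} \succ 0,$$ $$N_R^T \left\{ H \begin{bmatrix} R_0(k) & 0 & 0 \\ 0 & \bar{R}(k) & 0 \\ 0 & 0 & g I \end{bmatrix} H^T - \begin{bmatrix} R_0(k+1) & 0 & 0 \\ 0 & \bar{R}(k) & 0 \\ 0 & 0 & b I \end{bmatrix} \right\} N_R \prec 0,$$ $$\begin{bmatrix} \begin{bmatrix} \bar{S}(k) & 0 \\ 0 & f_2 I \end{bmatrix} - H_{22}^T\begin{bmatrix} \bar{S}(k) & 0 \\ 0 & tI \end{bmatrix}H_{22} & H_{12}^T \\ H_{12} & R_0(k+1) \end{bmatrix} \succ 0,$$ $$\begin{bmatrix} R_i(k) & I \\ I & S_i(k) \end{bmatrix} \succeq 0, \quad \begin{bmatrix} g & 1 \\ 1 & f_2 \end{bmatrix} \succeq 0, \quad \begin{bmatrix} t & 1 \\ 1 & b \end{bmatrix} \succeq 0,$$ for $i = 1,\dots,p$ and $k = 0,1,\dots,\bar{h}$, where $R_0(\bar{h}+1) = R_0(\bar{h})$, $\Gamma = \mathrm{diag}(P^{-1/2},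 Q^{-1/2})$, $F_1 = \mathrm{diag}(f_{11} I_n, f_{12}I_{\bar{N}})$, $\bar{R}(k) = \mathrm{diag}(R_1(k), \dots, R_p(k))$, $\bar{S}(k) = \mathrm{diag}(S_1(k), \dots, S_p(k))$, $N_R$ satisfies $\mathrm{Im}\, N_R = \mathrm{Ker} \begin{bmatrix} B_{2s}^T & B_{2p}^T & D_{12}^T \end{bmatrix}$ and $N_R^TN_R = I$, and $$H = \begin{bmatrix} H_{11} & H_{12} \\ H_{21} & H_{22} \end{bmatrix} = \left[ \begin{array}{c|cc} A_{ss} & A_{sp} & B_{1s} \\ \hline A_{ps} & A_{pp} & B_{1p} \\ C_{1s} & C_{1p} & D_{11} \end{array} \right].$$
   Context: A matrix sequence $P$ is $(h,q)$-eventually periodic if $P(h+k+iq)=P(h+k)$ for all nonnegative integers $i,k$; a system is $(h,q)$-eventually periodic if all its state-space matrix sequences are. An NSLPV controller has state-space matrices depending explicitly on both the scheduling parameters and time; here the static controller has the form $\varphi^c_k = A^c_{pp}(k)\vartheta^c_k + B^c_p(k)\hat y_k$, $u_k = C^c_p(k)\vartheta^c_k + D^c(k)\hat y_k$, $\vartheta^c_k = \mathrm{diag}(\delta_k^{[1]}I_{m^c_1(k)},\dots,\delta_k^{[p]}I_{m^c_p(k)})\varphi^c_k$. $\mathbb{S}^m$ denotes real symmetric $m\times m$ matrices; $\mathrm{Im}$ and $\mathrm{Ker}$ denote image and kernel. *)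

theory Defs
  imports Complex_Main "HOL-Library.Extended_Real" "Jordan_Normal_Form.Matrix"
begin

definition psd_mat :: "real mat \<Rightarrow> bool" where
  "psd_mat A \<longleftrightarrow> A \<in> carrier_mat (dim_row A) (dim_row A) \<and> transpose_mat A = A \<and>
     (\<forall>v \<in> carrier_vec (dim_row A). 0 \<le> v \<bullet> (A *\<^sub>v v))"

definition pd_mat :: "real mat \<Rightarrow> bool" where
  "pd_mat A \<longleftrightarrow> A \<in> carrier_mat (dim_row A) (dim_row A) \<and> transpose_mat A = A \<and>
     (\<forall>v \<in> carrier_vec (dim_row A). v \<noteq> 0\<^sub>v (dim_row A) \<longrightarrow> 0 < v \<bullet> (A *\<^sub>v v))"

definition nd_mat :: "real mat \<Rightarrow> bool" where
  "nd_mat A \<longleftrightarrow> pd_mat (- A)"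

definition mat_inv_sqrt :: "real mat \<Rightarrow> real mat" where
  "mat_inv_sqrt P = (THE X. X \<in> carrier_mat (dim_row P) (dim_row P) \<and> pd_mat X \<and>
                            X * X * P = 1\<^sub>m (dim_row P))"

definition hcat :: "real mat \<Rightarrow> real mat \<Rightarrow> real mat" where
  "hcat A B = mat (dim_row A) (dim_col A + dim_col B)
     (\<lambda>(i,j). if j < dim_col A then A $$ (i,j) else B $$ (i, j - dim_col A))"

definition vcat :: "real mat \<Rightarrow> real mat \<Rightarrow> real mat" where
  "vcat A B = mat (dim_row A + dim_row B) (dim_col A)
     (\<lambda>(i,j). if i < dim_row A then A $$ (i,j) else B $$ (i - dim_row A, j))"

definition block3 :: "real mat \<Rightarrow> real mat \<Rightarrow> real mat \<Rightarrow> real mat \<Rightarrow> real mat \<Rightarrow> real mat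
   \<Rightarrow> real mat \<Rightarrow> real mat \<Rightarrow> real mat \<Rightarrow> real mat" where
  "block3 A B C D E F G H I = four_block_mat (four_block_mat A B D E) (vcat C F) (hcat G H) I"

definition sc :: "real \<Rightarrow> real mat" where
  "sc a = mat 1 1 (\<lambda>_. a)"

definition Delta :: "nat list \<Rightarrow> (nat \<Rightarrow> nat \<Rightarrow> real) \<Rightarrow> nat \<Rightarrow> real mat" where
  "Delta ms \<delta> k = diag_block_mat (map (\<lambda>i. \<delta> k i \<cdot>\<^sub>m 1\<^sub>m (ms ! i)) [0..<length ms])"

definition admissible :: "nat \<Rightarrow> (nat \<Rightarrow> nat \<Rightarrow> real) \<Rightarrow> bool" where
  "admissible p \<delta> \<longleftrightarrow> (\<forall>k i. i < p \<longrightarrow> \<bar>\<delta> k i\<bar> \<le> 1)"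

definition vnorm :: "real vec \<Rightarrow> real" where
  "vnorm v = sqrt (v \<bullet> v)"

definition l2norm :: "(nat \<Rightarrow> real vec) \<Rightarrow> ereal" where
  "l2norm s = (if summable (\<lambda>k. s k \<bullet> s k) then ereal (sqrt (\<Sum>k. s k \<bullet> s k)) else \<infinity>)"

definition ev_periodic :: "nat \<Rightarrow> nat \<Rightarrow> (nat \<Rightarrow> 'a) \<Rightarrow> bool" where
  "ev_periodic h q P \<longleftrightarrow> (\<forall>i k. P (h + k + i * q) = P (h + k))"

record lpv_plant =
  Ass :: "real mat"  Asp :: "real mat"  B1s :: "real mat"  B2s :: "real mat"
  Aps :: "real mat"  App :: "real mat"  B1p :: "real mat"  B2p :: "real mat"
  C1s :: "real mat"  C1p :: "real mat"  D11 :: "real mat"  D12 :: "real mat"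
  C2s :: "real mat"  C2p :: "real mat"  D21 :: "real mat"

text \<open>State dimension \<open>Nn = n + Nbar\<close>, scheduling block sizes \<open>ms\<close> (p = length ms),
  disturbance dim nd, error dim ne, control dim nu, measurement dim ny.\<close>
definition plant_dims :: "lpv_plant \<Rightarrow> nat \<Rightarrow> nat list \<Rightarrow> nat \<Rightarrow> nat \<Rightarrow> nat \<Rightarrow> nat \<Rightarrow> bool" where
  "plant_dims G Nn ms nd ne nu ny \<longleftrightarrow> (let m = sum_list ms in
     Ass G \<in> carrier_mat Nn Nn \<and> Asp G \<in> carrier_mat Nn m \<and> B1s G \<in> carrier_mat Nn nd \<and> B2s G \<in> carrier_mat Nn nu \<and>
     Aps G \<in> carrier_mat m Nn \<and> App G \<in> carrier_mat m m \<and> B1p G \<in> carrier_mat m nd \<and> B2p G \<in> carrier_mat m nu \<and>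
     C1s G \<in> carrier_mat ne Nn \<and> C1p G \<in> carrier_mat ne m \<and> D11 G \<in> carrier_mat ne nd \<and> D12 G \<in> carrier_mat ne nu \<and>
     C2s G \<in> carrier_mat ny Nn \<and> C2p G \<in> carrier_mat ny m \<and> D21 G \<in> carrier_mat ny nd)"

text \<open>Static NSLPV controller:
  \<open>\<phi>c_k = Acpp(k) \<vartheta>c_k + Bcp(k) y_k,  u_k = Ccp(k) \<vartheta>c_k + Dc(k) y_k,
   \<vartheta>c_k = diag(\<delta>_k^{[i]} I_{mc_i(k)}) \<phi>c_k\<close>.\<close>
record nslpv_ctrl =
  Acpp :: "nat \<Rightarrow> real mat"  Bcp :: "nat \<Rightarrow> real mat"
  Ccp :: "nat \<Rightarrow> real mat"  Dc :: "nat \<Rightarrow> real mat"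
  mcs :: "nat \<Rightarrow> nat list"

definition ctrl_dims :: "nslpv_ctrl \<Rightarrow> nat \<Rightarrow> nat \<Rightarrow> nat \<Rightarrow> bool" where
  "ctrl_dims K p ny nu \<longleftrightarrow> (\<forall>k. let mc = sum_list (mcs K k) in
     length (mcs K k) = p \<and> Acpp K k \<in> carrier_mat mc mc \<and> Bcp K k \<in> carrier_mat mc ny \<and>
     Ccp K k \<in> carrier_mat nu mc \<and> Dc K k \<in> carrier_mat nu ny)"

definition ctrl_ev_periodic :: "nat \<Rightarrow> nat \<Rightarrow> nslpv_ctrl \<Rightarrow> bool" where
  "ctrl_ev_periodic h q K \<longleftrightarrow> ev_periodic h q (Acpp K) \<and> ev_periodic h q (Bcp K) \<and>
     ev_periodic h q (Ccp K) \<and> ev_periodic h q (Dc K) \<and> ev_periodic h q (mcs K)"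

definition cl_step :: "lpv_plant \<Rightarrow> nat list \<Rightarrow> nslpv_ctrl \<Rightarrow> (nat \<Rightarrow> nat \<Rightarrow> real) \<Rightarrow> nat \<Rightarrow>
   real vec \<Rightarrow> real vec \<Rightarrow> real vec \<Rightarrow> real vec \<Rightarrow> real vec \<Rightarrow> real vec \<Rightarrow> real vec \<Rightarrow> real vec
   \<Rightarrow> real vec \<Rightarrow> real vec \<Rightarrow> bool" where
  "cl_step G ms K \<delta> k z d z' th ph e y u thc phc \<longleftrightarrow>
     (let m = sum_list ms; mc = sum_list (mcs K k) in
      z' \<in> carrier_vec (dim_row (Ass G)) \<and> th \<in> carrier_vec m \<and> ph \<in> carrier_vec m \<and>
      e \<in> carrier_vec (dim_row (C1s G)) \<and> y \<in> carrier_vec (dim_row (C2s G)) \<and>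
      u \<in> carrier_vec (dim_col (B2s G)) \<and> thc \<in> carrier_vec mc \<and> phc \<in> carrier_vec mc \<and>
      z' = Ass G *\<^sub>v z + Asp G *\<^sub>v th + B1s G *\<^sub>v d + B2s G *\<^sub>v u \<and>
      ph = Aps G *\<^sub>v z + App G *\<^sub>v th + B1p G *\<^sub>v d + B2p G *\<^sub>v u \<and>
      e  = C1s G *\<^sub>v z + C1p G *\<^sub>v th + D11 G *\<^sub>v d + D12 G *\<^sub>v u \<and>
      y  = C2s G *\<^sub>v z + C2p G *\<^sub>v th + D21 G *\<^sub>v d \<and>
      th = Delta ms \<delta> k *\<^sub>v ph \<and>
      phc = Acpp K k *\<^sub>v thc + Bcp K k *\<^sub>v y \<and>
      u = Ccp K k *\<^sub>v thc + Dc K k *\<^sub>v y \<and>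
      thc = Delta (mcs K k) \<delta> k *\<^sub>v phc)"

definition cl_traj :: "lpv_plant \<Rightarrow> nat list \<Rightarrow> nslpv_ctrl \<Rightarrow> (nat \<Rightarrow> nat \<Rightarrow> real) \<Rightarrow>
   (nat \<Rightarrow> real vec) \<Rightarrow> (nat \<Rightarrow> real vec) \<Rightarrow> (nat \<Rightarrow> real vec) \<Rightarrow> bool" where
  "cl_traj G ms K \<delta> z d e \<longleftrightarrow> z 0 \<in> carrier_vec (dim_row (Ass G)) \<and>
     (\<exists>th ph y u thc phc. \<forall>k. cl_step G ms K \<delta> k (z k) (d k) (z (Suc k)) (th k) (ph k) (e k) (y k) (u k) (thc k) (phc k))"

definition cl_well_posed :: "lpv_plant \<Rightarrow> nat list \<Rightarrow> nslpv_ctrl \<Rightarrow> bool" where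
  "cl_well_posed G ms K \<longleftrightarrow> (\<forall>\<delta> k z d. admissible (length ms) \<delta> \<longrightarrow>
     z \<in> carrier_vec (dim_row (Ass G)) \<longrightarrow> d \<in> carrier_vec (dim_col (B1s G)) \<longrightarrow>
     (\<exists>!(z', th, ph, e, y, u, thc, phc). cl_step G ms K \<delta> k z d z' th ph e y u thc phc))"

definition cl_robustly_stable :: "lpv_plant \<Rightarrow> nat list \<Rightarrow> nslpv_ctrl \<Rightarrow> bool" where
  "cl_robustly_stable G ms K \<longleftrightarrow> cl_well_posed G ms K \<and>
     (\<exists>c \<rho>. 0 \<le> \<rho> \<and> \<rho> < 1 \<and> (\<forall>\<delta> z e. admissible (length ms) \<delta> \<longrightarrow>
        cl_traj G ms K \<delta> z (\<lambda>_. 0\<^sub>v (dim_col (B1s G))) e \<longrightarrow>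
        (\<forall>k. vnorm (z k) \<le> c * \<rho> ^ k * vnorm (z 0))))"

definition init_set :: "nat \<Rightarrow> nat \<Rightarrow> real mat \<Rightarrow> real mat \<Rightarrow> real vec set" where
  "init_set n Nbar P Q = {z0. z0 \<in> carrier_vec (n + Nbar) \<and>
      vec_first z0 n \<bullet> (P *\<^sub>v vec_first z0 n) \<le> 1 \<and>
      vec_last z0 Nbar \<bullet> (Q *\<^sub>v vec_last z0 Nbar) \<le> 1}"

definition cl_perf :: "lpv_plant \<Rightarrow> nat list \<Rightarrow> nslpv_ctrl \<Rightarrow> nat \<Rightarrow> nat \<Rightarrow> real mat \<Rightarrow> real mat \<Rightarrow> ereal" where
  "cl_perf G ms K n Nbar P Q = Sup {l2norm e | e. \<exists>\<delta> z d. admissible (length ms) \<delta> \<and>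
      (\<forall>k. d k \<in> carrier_vec (dim_col (B1s G))) \<and> l2norm d \<le> 1 \<and>
      z 0 \<in> init_set n Nbar P Q \<and> cl_traj G ms K \<delta> z d e}"


definition plant_H :: "lpv_plant \<Rightarrow> real mat" where
  "plant_H G = block3 (Ass G) (Asp G) (B1s G) (Aps G) (App G) (B1p G) (C1s G) (C1p G) (D11 G)"

definition plant_H12 :: "lpv_plant \<Rightarrow> real mat" where
  "plant_H12 G = hcat (Asp G) (B1s G)"

definition plant_H22 :: "lpv_plant \<Rightarrow> real mat" where
  "plant_H22 G = four_block_mat (App G) (B1p G) (C1p G) (D11 G)"

definition plant_W :: "lpv_plant \<Rightarrow> real mat" where
  "plant_W G = hcat (hcat (transpose_mat (B2s G)) (transpose_mat (B2p G))) (transpose_mat (D12 G))"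

end

theory Submission
  imports Defs "Jordan_Normal_Form.Determinant"
begin

text \<open>
  At each time the closed loop is made to satisfy a dissipation inequality with storage function
  \<open>z\<^sup>T R\<^sub>0(k)\<^sup>-\<^sup>1 z\<close>. The controller carries a copy \<open>\<eta>\<close> of the plant's scheduling signal \<open>\<theta>\<close>; with
  \<open>T = diag R\<^sub>i\<^sup>-\<^sup>1\<close> and \<open>M = (1 + \<epsilon>) diag S\<^sub>i - T\<close>, which is positive definite by the coupling condition,
  the pair is scaled by \<open>\<bar>\<theta>\<bar>\<^sup>2\<close> in the norm of \<open>T\<close> plus \<open>\<bar>\<theta> - \<eta>\<bar>\<^sup>2\<close> in the norm of \<open>M\<close>. The controller gains are then a linear
  strategy for a quadratic game: the controller chooses \<open>u\<close> and its copy \<open>\<psi>\<close> of the plant output \<open>\<phi>\<close>, knowing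
  \<open>z\<close> and \<open>\<eta>\<close>, against the unknown \<open>\<theta>\<close> and \<open>d\<close>. The \<open>S\<close>-inequality says that the game is
  strictly concave for the opponent. The \<open>R\<close>-inequality is dual to the statement that a controller who also
  knows \<open>\<theta>\<close> and \<open>d\<close> (and then plays \<open>\<psi> = \<phi>\<close>) wins. The saddle point of the game gives the gains.
  Summing the dissipation inequalities yields \<open>\<bar>e\<bar>\<^sup>2 \<le> b (f\<^sub>1\<^sub>1 + f\<^sub>1\<^sub>2 + f\<^sub>2) \<le> ((b + f\<^sub>1\<^sub>1 + f\<^sub>1\<^sub>2 + f\<^sub>2) / 2)\<^sup>2\<close>.
\<close>

section \<open>Quadratic forms and Finsler's lemma\<close>

text \<open>The weights meet the two inequalities at opposite ends of the game. If the controller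
  does nothing, they add up to \<open>T + M = (1 + \<epsilon>) S\<close>, which the
  \<open>S\<close>-inequality controls. If \<open>\<psi> = \<phi>\<close>, the \<open>M\<close>-term
  of the outputs vanishes and \<open>T\<close>, the inverse of the \<open>R\<close>-scaling, is
  left. For a payoff that is strictly convex for one player and strictly concave for the other the
  order of play does not matter, so the knowledge of \<open>\<theta>\<close> and \<open>d\<close>
  can be given up. Definiteness has to be manufactured twice. The coupling condition only makes
  \<open>S - T\<close> semidefinite; the factor \<open>1 + \<epsilon>\<close>, for which the strict
  \<open>S\<close>-inequality leaves room, makes \<open>M\<close> definite. The input matrices may
  have a common kernel, so the payoff may be flat in \<open>u\<close>; a penalty
  \<open>(u \<bullet> u) / \<tau>\<close> cures this and, being nonnegative, is dropped at the end.
  At \<open>z = 0\<close> and \<open>d = 0\<close> the same inequalities show that the algebraic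
  loops through \<open>\<Delta>\<close> have only the trivial solution, which gives well-posedness.
  After time \<open>hbar\<close> the last gains are repeated; \<open>R0 (Suc hbar) = R0 hbar\<close>
  makes their certificate reusable.\<close>

definition qf :: "real mat \<Rightarrow> real vec \<Rightarrow> real" where
  "qf A v = v \<bullet> (A *\<^sub>v v)"

lemma pd_matD:
  assumes "pd_mat A" "A \<in> carrier_mat n n"
  shows "transpose_mat A = A" "\<And>v. v \<in> carrier_vec n \<Longrightarrow> v \<noteq> 0\<^sub>v n \<Longrightarrow> 0 < qf A v"
    "\<And>v. v \<in> carrier_vec n \<Longrightarrow> 0 \<le> qf A v"
proof -
  show "transpose_mat A = A" using assms by (auto simp: pd_mat_def)
  show *: "\<And>v. v \<in> carrier_vec n \<Longrightarrow> v \<noteq> 0\<^sub>v n \<Longrightarrow> 0 < qf A v"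
    using assms by (auto simp: pd_mat_def qf_def)
  fix v :: "real vec" assume v: "v \<in> carrier_vec n"
  show "0 \<le> qf A v"
  proof (cases "v = 0\<^sub>v n")
    case True
    then show ?thesis using assms(2) by (simp add: qf_def)
  next
    case False
    then show ?thesis using *[OF v] by simp
  qed
qed

lemma pd_matI:
  assumes "A \<in> carrier_mat n n" "transpose_mat A = A"
    "\<And>v. v \<in> carrier_vec n \<Longrightarrow> v \<noteq> 0\<^sub>v n \<Longrightarrow> 0 < qf A v"
  shows "pd_mat A"
  using assms by (auto simp: pd_mat_def qf_def)

lemma psd_matD:
  assumes "psd_mat A" "A \<in> carrier_mat n n" "v \<in> carrier_vec n"
  shows "0 \<le> qf A v"
  using assms by (auto simp: psd_mat_def qf_def)

lemma sym_scalar_prod: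
  fixes A :: "real mat"
  assumes "A \<in> carrier_mat n n" "transpose_mat A = A" "x \<in> carrier_vec n" "y \<in> carrier_vec n"
  shows "x \<bullet> (A *\<^sub>v y) = y \<bullet> (A *\<^sub>v x)"
proof -
  have "x \<bullet> (A *\<^sub>v y) = (transpose_mat A *\<^sub>v x) \<bullet> y"
    using transpose_vec_mult_scalar[OF assms(1,4,3)] by simp
  also have "\<dots> = y \<bullet> (A *\<^sub>v x)"
    unfolding assms(2) by (rule comm_scalar_prod[of _ n]) (use assms in auto)
  finally show ?thesis .
qed

lemma mult_mat_vec_zero: "(A :: real mat) \<in> carrier_mat nr nc \<Longrightarrow> A *\<^sub>v 0\<^sub>v nc = 0\<^sub>v nr"
  by (intro eq_vecI) auto

lemma qf_smult:
  assumes "A \<in> carrier_mat n n" "v \<in> carrier_vec n"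
  shows "qf A (c \<cdot>\<^sub>v v) = c\<^sup>2 * qf A v"
  using assms by (simp add: qf_def mult_mat_vec[OF assms] power2_eq_square)

lemma qf_uminus:
  assumes "A \<in> carrier_mat n n" "v \<in> carrier_vec n"
  shows "qf A (- v) = qf A v"
proof -
  have "- v = (- 1) \<cdot>\<^sub>v v" by (intro eq_vecI) auto
  then show ?thesis using qf_smult[OF assms, of "- 1"] by simp
qed

lemma qf_add:
  assumes A: "A \<in> carrier_mat n n" and s: "transpose_mat A = A"
    and x: "x \<in> carrier_vec n" and y: "y \<in> carrier_vec n"
  shows "qf A (x + y) = qf A x + 2 * (y \<bullet> (A *\<^sub>v x)) + qf A y"
proof -
  have c: "A *\<^sub>v x \<in> carrier_vec n" "A *\<^sub>v y \<in> carrier_vec n" using A x y by auto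
  have "qf A (x + y) = x \<bullet> (A *\<^sub>v x) + x \<bullet> (A *\<^sub>v y) + (y \<bullet> (A *\<^sub>v x) + y \<bullet> (A *\<^sub>v y))"
    unfolding qf_def mult_add_distrib_mat_vec[OF A x y]
    using c x y by (simp add: scalar_prod_add_distrib[of _ n] add_scalar_prod_distrib[of _ n])
  then show ?thesis unfolding sym_scalar_prod[OF A s x y] by (simp add: qf_def)
qed

lemma qf_mat_add:
  assumes "A \<in> carrier_mat n n" "B \<in> carrier_mat n n" "v \<in> carrier_vec n"
  shows "qf (A + B) v = qf A v + qf B v"
  unfolding qf_def add_mult_distrib_mat_vec[OF assms]
  using assms by (subst scalar_prod_add_distrib[of _ n]) auto

lemma qf_mat_minus:
  assumes "A \<in> carrier_mat n n" "B \<in> carrier_mat n n" "v \<in> carrier_vec n"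
  shows "qf (A - B) v = qf A v - qf B v"
  unfolding qf_def minus_mult_distrib_mat_vec[OF assms]
  using assms by (subst scalar_prod_minus_distrib[of _ n]) auto

lemma qf_mat_uminus:
  assumes "A \<in> carrier_mat n n" "v \<in> carrier_vec n"
  shows "qf (- A) v = - qf A v"
  using assms by (simp add: qf_def)

lemma qf_mat_smult:
  assumes "A \<in> carrier_mat n n" "v \<in> carrier_vec n"
  shows "qf (c \<cdot>\<^sub>m A) v = c * qf A v"
proof -
  have "(c \<cdot>\<^sub>m A) *\<^sub>v v = c \<cdot>\<^sub>v (A *\<^sub>v v)" using assms by (intro eq_vecI) auto
  then show ?thesis using assms by (simp add: qf_def)
qed

lemma qf_one: "v \<in> carrier_vec n \<Longrightarrow> qf (1\<^sub>m n) v = v \<bullet> v"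
  by (simp add: qf_def)

lemma qf_smult_one: "v \<in> carrier_vec n \<Longrightarrow> qf (c \<cdot>\<^sub>m 1\<^sub>m n) v = c * (v \<bullet> v)"
  by (simp add: qf_mat_smult[of _ n] qf_one)

lemma qf_congruence:
  assumes A: "A \<in> carrier_mat n n" and C: "C \<in> carrier_mat n m" and v: "v \<in> carrier_vec m"
  shows "qf (transpose_mat C * A * C) v = qf A (C *\<^sub>v v)"
proof -
  have Cv: "C *\<^sub>v v \<in> carrier_vec n" using C v by auto
  have ct: "transpose_mat C \<in> carrier_mat m n" using C by auto
  have "transpose_mat C * A * C *\<^sub>v v = transpose_mat C *\<^sub>v (A *\<^sub>v (C *\<^sub>v v))"
    using A C v ct Cv assoc_mult_mat_vec[OF mult_carrier_mat[OF ct A] C v] assoc_mult_mat_vec[OF ct A Cv]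
    by simp
  moreover have "v \<bullet> (transpose_mat C *\<^sub>v (A *\<^sub>v (C *\<^sub>v v)))
      = (C *\<^sub>v v) \<bullet> (A *\<^sub>v (C *\<^sub>v v))"
    using transpose_vec_mult_scalar[OF ct, of "A *\<^sub>v (C *\<^sub>v v)" v] A C v Cv by auto
  ultimately show ?thesis by (simp add: qf_def)
qed

section \<open>Norms, inverses and compactness of the unit sphere\<close>

lemma scalar_self_nonneg: "0 \<le> (v :: real vec) \<bullet> v"
  by (auto simp: scalar_prod_def intro!: sum_nonneg)

lemma scalar_self_eq_0:
  assumes "(v :: real vec) \<in> carrier_vec n" "v \<bullet> v = 0"
  shows "v = 0\<^sub>v n"
proof (intro eq_vecI)
  fix i assume "i < dim_vec (0\<^sub>v n :: real vec)"
  moreover have "\<forall>i \<in> {0..<dim_vec v}. v $ i * v $ i = 0"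
    using assms(2) unfolding scalar_prod_def by (subst (asm) sum_nonneg_eq_0_iff) auto
  ultimately show "v $ i = 0\<^sub>v n $ i" using assms(1) by auto
qed (use assms in auto)

lemma scalar_self_pos:
  assumes "(v :: real vec) \<in> carrier_vec n" "v \<noteq> 0\<^sub>v n"
  shows "0 < v \<bullet> v"
  using scalar_self_eq_0[OF assms(1)] scalar_self_nonneg[of v] assms(2) by fastforce

text \<open>A nonzero determinant makes the matrix a unit of the matrix ring. Invertibility is
  checked on the kernel below: by definiteness, by uniqueness of a stationary point, or by
  uniqueness of the solution of a loop equation.\<close>

lemma inverse_exists_if_injective:
  fixes A :: "real mat"
  assumes A: "A \<in> carrier_mat n n"
    and inj: "\<And>v. v \<in> carrier_vec n \<Longrightarrow> A *\<^sub>v v = 0\<^sub>v n \<Longrightarrow> v = 0\<^sub>v n"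
  obtains B where "B \<in> carrier_mat n n" "A * B = 1\<^sub>m n" "B * A = 1\<^sub>m n"
proof -
  have "det A \<noteq> 0" using det_0_iff_vec_prod_zero_field[OF A] inj by blast
  from det_non_zero_imp_unit[OF A this, of "()"] show ?thesis
    using that unfolding Units_def ring_mat_def by auto
qed

text \<open>The substitution \<open>v = A w\<close> gives \<open>qf B v = qf A w\<close>, so
  definiteness passes to the inverse. The transpose of \<open>B\<close> is also a left inverse of
  the symmetric matrix \<open>A\<close>, hence equal to \<open>B\<close>.\<close>

lemma pd_mat_inverse:
  assumes A: "A \<in> carrier_mat n n" and pd: "pd_mat A"
  obtains B where "B \<in> carrier_mat n n" "pd_mat B" "A * B = 1\<^sub>m n" "B * A = 1\<^sub>m n"
proof -
  have inj: "v = 0\<^sub>v n" if v: "v \<in> carrier_vec n" and 0: "A *\<^sub>v v = 0\<^sub>v n" for v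
  proof (rule ccontr)
    assume "v \<noteq> 0\<^sub>v n"
    from pd_matD(2)[OF pd A v this] show False using 0 v by (simp add: qf_def)
  qed
  from inverse_exists_if_injective[OF A this]
  obtain B where B: "B \<in> carrier_mat n n" "A * B = 1\<^sub>m n" "B * A = 1\<^sub>m n" by blast
  have "transpose_mat B * A = 1\<^sub>m n"
    using arg_cong[OF B(2), of transpose_mat] transpose_mult[OF A B(1)] pd_matD(1)[OF pd A] by simp
  then have "transpose_mat B = B"
    using assoc_mult_mat[of "transpose_mat B" n n A n B n] A B by simp
  moreover have "0 < qf B v" if v: "v \<in> carrier_vec n" and "v \<noteq> 0\<^sub>v n" for v
  proof -
    have Bv: "B *\<^sub>v v \<in> carrier_vec n" using B v by auto
    have ABv: "A *\<^sub>v (B *\<^sub>v v) = v" using assoc_mult_mat_vec[OF A B(1) v] B v by simp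
    then have "B *\<^sub>v v \<noteq> 0\<^sub>v n" using that mult_mat_vec_zero[OF A] by auto
    from pd_matD(2)[OF pd A Bv this] show ?thesis
      using ABv comm_scalar_prod[OF Bv v] by (simp add: qf_def)
  qed
  ultimately have "pd_mat B" using pd_matI[OF B(1)] by blast
  with B that show ?thesis by blast
qed

lemma inverse_mult_vec:
  assumes "A \<in> carrier_mat n n" "B \<in> carrier_mat n n" "A * B = 1\<^sub>m n" "v \<in> carrier_vec n"
  shows "A *\<^sub>v (B *\<^sub>v v) = (v :: real vec)"
  using assoc_mult_mat_vec[OF assms(1,2,4)] assms by simp

text \<open>Bolzano-Weierstrass with one coordinate per induction step: the new coordinate has a
  monotone subsequence, which converges because it is bounded, and thinning out keeps the limits
  already obtained.\<close>

lemma bounded_coords_convergent_subseq: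
  fixes f :: "nat \<Rightarrow> nat \<Rightarrow> real"
  assumes "\<And>k i. i < n \<Longrightarrow> \<bar>f k i\<bar> \<le> 1"
  shows "\<exists>r l. strict_mono r \<and> (\<forall>i<n. (\<lambda>k. f (r k) i) \<longlonglongrightarrow> l i)"
  using assms
proof (induction n)
  case 0
  show ?case by (intro exI[of _ id]) (auto simp: strict_mono_def)
next
  case (Suc n)
  then obtain r l where r: "strict_mono r" "\<forall>i<n. (\<lambda>k. f (r k) i) \<longlonglongrightarrow> l i"
    using less_Suc_eq by blast
  obtain s where s: "strict_mono s" "monoseq (\<lambda>k. f (r (s k)) n)"
    using seq_monosub[of "\<lambda>k. f (r k) n"] by auto
  have "Bseq (\<lambda>k. f (r (s k)) n)"
    using Suc.prems[of n] by (intro BseqI'[of _ 1]) auto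
  then obtain m where m: "(\<lambda>k. f (r (s k)) n) \<longlonglongrightarrow> m"
    using Bseq_monoseq_convergent[OF _ s(2)] by (auto simp: convergent_def)
  have "(\<lambda>k. f (r (s k)) i) \<longlonglongrightarrow> (l(n := m)) i" if "i < Suc n" for i
    using m r(2) LIMSEQ_subseq_LIMSEQ[OF _ s(1), of "\<lambda>k. f (r k) i"] that
    by (cases "i = n") (auto simp: o_def less_Suc_eq)
  moreover have "strict_mono (r \<circ> s)" using r(1) s(1) by (rule strict_mono_o)
  ultimately show ?case
    by (intro exI[of _ "r \<circ> s"] exI[of _ "l(n := m)"] conjI allI impI) (simp_all add: o_def)
qed

lemma unit_vec_coord_le:
  assumes "(v :: real vec) \<in> carrier_vec n" "v \<bullet> v = 1" "i < n"
  shows "\<bar>v $ i\<bar> \<le> 1"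
proof -
  have "v $ i * v $ i \<le> (\<Sum>i = 0..<n. v $ i * v $ i)"
    using assms by (intro member_le_sum) auto
  then have "(v $ i)\<^sup>2 \<le> 1" using assms by (simp add: scalar_prod_def power2_eq_square)
  then show ?thesis by (simp add: abs_square_le_1)
qed

lemma tendsto_qf:
  fixes A :: "real mat"
  assumes A: "A \<in> carrier_mat n n"
    and v: "\<And>k. v k \<in> carrier_vec n" "w \<in> carrier_vec n"
    and lim: "\<And>i. i < n \<Longrightarrow> (\<lambda>k. v k $ i) \<longlonglongrightarrow> w $ i"
  shows "(\<lambda>k. qf A (v k)) \<longlonglongrightarrow> qf A w"
proof -
  have *: "qf A x = (\<Sum>i = 0..<n. x $ i * (\<Sum>j = 0..<n. A $$ (i, j) * x $ j))"
    if "x \<in> carrier_vec n" for x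
    using A that by (auto simp: qf_def scalar_prod_def intro!: sum.cong)
  show ?thesis unfolding *[OF v(1)] *[OF v(2)]
    by (intro tendsto_intros lim) auto
qed

text \<open>The limit stays on the sphere because \<open>1\<^sub>m n\<close> is itself one of the
  convergent forms. All quadratic forms converge along one and the same subsequence; Finsler's lemma
  compares two of them.\<close>

lemma unit_vec_convergent_subseq:
  fixes v :: "nat \<Rightarrow> real vec"
  assumes "\<And>k. v k \<in> carrier_vec n" "\<And>k. v k \<bullet> v k = 1"
  obtains r w where "strict_mono r" "w \<in> carrier_vec n" "w \<bullet> w = 1"
    "\<forall>i<n. (\<lambda>k. v (r k) $ i) \<longlonglongrightarrow> w $ i"
    "\<forall>A \<in> carrier_mat n n. (\<lambda>k. qf A (v (r k))) \<longlonglongrightarrow> qf A w"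
proof -
  obtain r l where r: "strict_mono r" "\<forall>i<n. (\<lambda>k. v (r k) $ i) \<longlonglongrightarrow> l i"
    using bounded_coords_convergent_subseq[of n "\<lambda>k i. v k $ i", OF unit_vec_coord_le[OF assms]] by blast
  define w where "w = vec n l"
  have w: "w \<in> carrier_vec n" by (simp add: w_def)
  have lim: "(\<lambda>k. v (r k) $ i) \<longlonglongrightarrow> w $ i" if "i < n" for i
    using r(2) that by (simp add: w_def)
  have q: "(\<lambda>k. qf A (v (r k))) \<longlonglongrightarrow> qf A w" if "A \<in> carrier_mat n n" for A
    by (rule tendsto_qf[OF that assms(1) w lim])
  have "(\<lambda>k. (1 :: real)) \<longlonglongrightarrow> w \<bullet> w"
    using q[of "1\<^sub>m n"] by (simp add: qf_one w assms)
  then have "w \<bullet> w = 1" by (simp add: LIMSEQ_const_iff)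
  then show ?thesis using that r(1) w lim q by blast
qed

lemma normalize_vec:
  assumes "(v :: real vec) \<in> carrier_vec n" "v \<noteq> 0\<^sub>v n"
  obtains c where "c > 0" "c \<cdot>\<^sub>v v \<in> carrier_vec n" "(c \<cdot>\<^sub>v v) \<bullet> (c \<cdot>\<^sub>v v) = 1"
proof -
  have p: "0 < v \<bullet> v" by (rule scalar_self_pos[OF assms])
  have "(1 / sqrt (v \<bullet> v)) * ((1 / sqrt (v \<bullet> v)) * (v \<bullet> v)) = 1"
    using p by (simp add: field_simps)
  with p assms that[of "1 / sqrt (v \<bullet> v)"] show ?thesis by simp
qed

text \<open>If no weight works, then every weight \<open>k + 1\<close> has a unit vector
  \<open>v k\<close> with a nonpositive value. At a limit point \<open>w\<close> the form
  \<open>A\<close> is still nonpositive, while the growing weight forces \<open>qf B w = 0\<close>;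
  this contradicts \<open>pos\<close>.\<close>

lemma finsler:
  assumes A: "A \<in> carrier_mat n n" and B: "B \<in> carrier_mat n n"
    and B_nonneg: "\<And>v. v \<in> carrier_vec n \<Longrightarrow> 0 \<le> qf B v"
    and pos: "\<And>v. v \<in> carrier_vec n \<Longrightarrow> v \<noteq> 0\<^sub>v n \<Longrightarrow> qf B v = 0 \<Longrightarrow> 0 < qf A v"
  obtains \<tau> where "\<tau> > 0" "\<forall>v \<in> carrier_vec n. v \<noteq> 0\<^sub>v n \<longrightarrow> 0 < qf A v + \<tau> * qf B v"
proof (rule ccontr)
  note result = that
  assume "\<not> thesis"
  have neg: "\<exists>v \<in> carrier_vec n. v \<noteq> 0\<^sub>v n \<and> qf A v + \<tau> * qf B v \<le> 0" if "\<tau> > 0" for \<tau>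
  proof (rule ccontr)
    assume "\<not> ?thesis"
    then have "\<forall>v \<in> carrier_vec n. v \<noteq> 0\<^sub>v n \<longrightarrow> 0 < qf A v + \<tau> * qf B v"
      by (auto simp: not_le)
    from result[OF \<open>\<tau> > 0\<close> this] \<open>\<not> thesis\<close> show False by blast
  qed
  have "\<exists>v. v \<in> carrier_vec n \<and> v \<bullet> v = 1 \<and> qf A v + real (Suc k) * qf B v \<le> 0" for k
  proof -
    obtain v where v: "v \<in> carrier_vec n" "v \<noteq> 0\<^sub>v n" "qf A v + real (Suc k) * qf B v \<le> 0"
      using neg[of "real (Suc k)"] by auto
    obtain c where c: "c > 0" "c \<cdot>\<^sub>v v \<in> carrier_vec n" "(c \<cdot>\<^sub>v v) \<bullet> (c \<cdot>\<^sub>v v) = 1"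
      using normalize_vec[OF v(1,2)] by blast
    have "qf A (c \<cdot>\<^sub>v v) + real (Suc k) * qf B (c \<cdot>\<^sub>v v) = c\<^sup>2 * (qf A v + real (Suc k) * qf B v)"
      using A B v by (simp add: qf_smult algebra_simps)
    also have "\<dots> \<le> 0" using v(3) by (intro mult_nonneg_nonpos) auto
    finally show ?thesis using c by blast
  qed
  then have "\<exists>v. \<forall>k. v k \<in> carrier_vec n \<and> v k \<bullet> v k = 1 \<and> qf A (v k) + real (Suc k) * qf B (v k) \<le> 0"
    by (intro choice) blast
  then obtain v where v: "\<And>k. v k \<in> carrier_vec n" "\<And>k. v k \<bullet> v k = 1"
    "\<And>k. qf A (v k) + real (Suc k) * qf B (v k) \<le> 0" by blast
  obtain r w where r: "strict_mono r" and w: "w \<in> carrier_vec n" "w \<bullet> w = 1"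
    and "\<forall>i<n. (\<lambda>k. v (r k) $ i) \<longlonglongrightarrow> w $ i"
    and lim: "\<forall>A \<in> carrier_mat n n. (\<lambda>k. qf A (v (r k))) \<longlonglongrightarrow> qf A w"
    by (rule unit_vec_convergent_subseq[of v n, OF v(1,2)])
  have w0: "w \<noteq> 0\<^sub>v n" using w by auto
  have "qf A w \<le> 0"
  proof (rule LIMSEQ_le_const2[OF lim[rule_format, OF A]], intro exI[of _ 0] allI impI)
    fix k
    have "0 \<le> real (Suc (r k)) * qf B (v (r k))" using B_nonneg v(1) by simp
    with v(3)[of "r k"] show "qf A (v (r k)) \<le> 0" by linarith
  qed
  moreover have "qf B w \<le> 0"
  proof -
    have 1: "(\<lambda>k. - qf A (v (r k)) * inverse (real (Suc k))) \<longlonglongrightarrow> - qf A w * 0"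
      by (intro tendsto_intros lim[rule_format] A LIMSEQ_inverse_real_of_nat)
    have "qf B (v (r k)) \<le> - qf A (v (r k)) * inverse (real (Suc k))" for k
    proof -
      \<comment> \<open>Since \<open>k \<le> r k\<close>, the weight of the subsequence may be
        lowered to \<open>k + 1\<close>, which turns the bound on \<open>qf B\<close> into an
        explicit null sequence.\<close>
      have "real (Suc k) * qf B (v (r k)) \<le> real (Suc (r k)) * qf B (v (r k))"
        using seq_suble[OF r, of k] B_nonneg v(1) by (intro mult_right_mono) auto
      then have "real (Suc k) * qf B (v (r k)) \<le> - qf A (v (r k))" using v(3)[of "r k"] by linarith
      then show ?thesis by (simp add: field_simps)
    qed
    then show ?thesis using LIMSEQ_le[OF lim[rule_format, OF B] 1] by auto
  qed
  ultimately show False using pos[OF w(1) w0] B_nonneg[OF w(1)] by force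
qed

text \<open>Finsler's lemma for \<open>- B\<close> under the constraint \<open>qf A v = 0\<close>,
  which holds only at the origin. Every quantitative slack below is extracted from a strict
  inequality in this way.\<close>

lemma pd_form_dominates:
  assumes A: "A \<in> carrier_mat n n" and B: "B \<in> carrier_mat n n"
    and pos: "\<And>v. v \<in> carrier_vec n \<Longrightarrow> v \<noteq> 0\<^sub>v n \<Longrightarrow> 0 < qf A v"
  obtains \<tau> where "\<tau> > 0" "\<forall>v \<in> carrier_vec n. qf B v \<le> \<tau> * qf A v"
    "\<forall>v \<in> carrier_vec n. v \<noteq> 0\<^sub>v n \<longrightarrow> qf B v < \<tau> * qf A v"
proof -
  have z: "qf C (0\<^sub>v n) = 0" if "C \<in> carrier_mat n n" for C using that by (simp add: qf_def)
  obtain \<tau> where \<tau>: "\<tau> > 0"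
    "\<forall>v \<in> carrier_vec n. v \<noteq> 0\<^sub>v n \<longrightarrow> 0 < qf (- B) v + \<tau> * qf A v"
  proof (rule finsler[of "- B" n A])
    show "0 \<le> qf A v" if "v \<in> carrier_vec n" for v
      using pos[OF that] z[OF A] by (cases "v = 0\<^sub>v n") auto
    show "0 < qf (- B) v" if "v \<in> carrier_vec n" "v \<noteq> 0\<^sub>v n" "qf A v = 0" for v
      using pos[OF that(1,2)] that(3) by simp
  qed (use A B in auto)
  have *: "qf B v < \<tau> * qf A v" if "v \<in> carrier_vec n" "v \<noteq> 0\<^sub>v n" for v
    using \<tau>(2) B that by (auto simp: qf_mat_uminus)
  moreover have "qf B v \<le> \<tau> * qf A v" if "v \<in> carrier_vec n" for v
    using *[OF that] z[OF A] z[OF B] by (cases "v = 0\<^sub>v n") auto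
  ultimately show ?thesis using that \<tau>(1) by blast
qed

section \<open>Inverse square roots\<close>

text \<open>The given vectors fill the first rows of a square matrix whose row \<open>j\<close> is
  zero. Its determinant vanishes, and any nonzero kernel vector is orthogonal to all of
  them.\<close>

lemma nonzero_orthogonal_vec:
  fixes v :: "nat \<Rightarrow> real vec"
  assumes "j < n" and v: "\<And>i. i < j \<Longrightarrow> v i \<in> carrier_vec n"
  obtains x where "x \<in> carrier_vec n" "x \<noteq> 0\<^sub>v n" "\<forall>i<j. v i \<bullet> x = 0"
proof -
  define c where "c = (\<lambda>i. if i < j then v i else 0\<^sub>v n)"
  define W where "W = mat\<^sub>r n n (\<lambda>i. if i = j then 0\<^sub>v n else c i)"
  have W: "W \<in> carrier_mat n n" by (simp add: W_def)
  have "det W = 0" unfolding W_def by (rule det_row_0) (use assms in \<open>auto simp: c_def\<close>)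
  then obtain x where x: "x \<in> carrier_vec n" "x \<noteq> 0\<^sub>v n" "W *\<^sub>v x = 0\<^sub>v n"
    using det_0_iff_vec_prod_zero_field[OF W] by blast
  have "v i \<bullet> x = 0" if i: "i < j" for i
  proof -
    have "row W i = v i"
      using i assms(1) v[OF i] by (intro eq_vecI) (auto simp: W_def c_def)
    moreover have "(W *\<^sub>v x) $ i = row W i \<bullet> x" using W i assms(1) by simp
    ultimately show ?thesis using x i assms(1) by simp
  qed
  with x that show ?thesis by blast
qed

lemma tendsto_scalar_prod_const:
  fixes a :: "real vec"
  assumes "a \<in> carrier_vec n" "\<And>k. v k \<in> carrier_vec n" "w \<in> carrier_vec n"
    and "\<And>i. i < n \<Longrightarrow> (\<lambda>k. v k $ i) \<longlonglongrightarrow> w $ i"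
  shows "(\<lambda>k. a \<bullet> v k) \<longlonglongrightarrow> a \<bullet> w"
proof -
  have "a \<bullet> x = (\<Sum>i = 0..<n. a $ i * x $ i)" if "x \<in> carrier_vec n" for x
    using that by (simp add: scalar_prod_def)
  then show ?thesis using assms(2,3) by (simp) (intro tendsto_intros assms(4), simp)
qed

text \<open>The unit vectors orthogonal to the given ones form a nonempty compact set, so the form
  attains its supremum there; homogeneity extends the bound to all orthogonal vectors. With
  eigenvectors for \<open>v\<close>, the maximiser \<open>w\<close> will be the next
  eigenvector.\<close>

lemma rayleigh_maximum:
  fixes v :: "nat \<Rightarrow> real vec"
  assumes A: "A \<in> carrier_mat n n" and "j < n" and v: "\<And>i. i < j \<Longrightarrow> v i \<in> carrier_vec n"
  obtains w where "w \<in> carrier_vec n" "w \<bullet> w = 1" "\<forall>i<j. v i \<bullet> w = 0"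
    "\<forall>x \<in> carrier_vec n. (\<forall>i<j. v i \<bullet> x = 0) \<longrightarrow> qf A x \<le> qf A w * (x \<bullet> x)"
proof -
  define C where "C = {x \<in> carrier_vec n. x \<bullet> x = 1 \<and> (\<forall>i<j. v i \<bullet> x = 0)}"
  have norm: "\<exists>c>0. c \<cdot>\<^sub>v x \<in> C" if x: "x \<in> carrier_vec n" "x \<noteq> 0\<^sub>v n" "\<forall>i<j. v i \<bullet> x = 0" for x
  proof -
    obtain c where c: "c > 0" "c \<cdot>\<^sub>v x \<in> carrier_vec n" "(c \<cdot>\<^sub>v x) \<bullet> (c \<cdot>\<^sub>v x) = 1"
      using normalize_vec[OF x(1,2)] by blast
    moreover have "v i \<bullet> (c \<cdot>\<^sub>v x) = 0" if "i < j" for i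
      using v[OF that] x(1,3) that by simp
    ultimately show ?thesis by (auto simp: C_def)
  qed
  have ne: "C \<noteq> {}"
  proof -
    obtain x where "x \<in> carrier_vec n" "x \<noteq> 0\<^sub>v n" "\<forall>i<j. v i \<bullet> x = 0"
      by (rule nonzero_orthogonal_vec[OF assms(2) v])
    from norm[OF this] show ?thesis by blast
  qed
  have one_pos: "0 < qf (1\<^sub>m n) x" if "x \<in> carrier_vec n" "x \<noteq> 0\<^sub>v n" for x
    using scalar_self_pos[OF that] that by (simp add: qf_one)
  obtain \<tau> where "\<tau> > 0" and \<tau>: "\<forall>x \<in> carrier_vec n. qf A x \<le> \<tau> * qf (1\<^sub>m n) x"
    and "\<forall>x \<in> carrier_vec n. x \<noteq> 0\<^sub>v n \<longrightarrow> qf A x < \<tau> * qf (1\<^sub>m n) x"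
    by (rule pd_form_dominates[OF one_carrier_mat A one_pos])
  have bdd: "bdd_above (qf A ` C)"
    using \<tau> by (intro bdd_aboveI2[of _ _ \<tau>]) (auto simp: C_def qf_one)
  define s where "s = Sup (qf A ` C)"
  have "\<exists>x. x \<in> C \<and> s - inverse (real (Suc k)) < qf A x" for k
    using less_cSup_iff[OF _ bdd, of "s - inverse (real (Suc k))"] ne by (auto simp: s_def)
  then obtain x where x: "\<And>k. x k \<in> C" "\<And>k. s - inverse (real (Suc k)) < qf A (x k)" by metis
  have xc: "\<And>k. x k \<in> carrier_vec n" "\<And>k. x k \<bullet> x k = 1" using x(1) by (auto simp: C_def)
  obtain r w where r: "strict_mono r" and w: "w \<in> carrier_vec n" "w \<bullet> w = 1"
    and lim: "\<forall>i<n. (\<lambda>k. x (r k) $ i) \<longlonglongrightarrow> w $ i"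
    and limA: "\<forall>A \<in> carrier_mat n n. (\<lambda>k. qf A (x (r k))) \<longlonglongrightarrow> qf A w"
    by (rule unit_vec_convergent_subseq[of x n, OF xc])
  have orth: "v i \<bullet> w = 0" if "i < j" for i
  proof -
    have "(\<lambda>k. v i \<bullet> x (r k)) \<longlonglongrightarrow> v i \<bullet> w"
      using lim by (intro tendsto_scalar_prod_const[OF v[OF that] xc(1) w(1)]) auto
    moreover have "v i \<bullet> x (r k) = 0" for k using x(1)[of "r k"] that by (auto simp: C_def)
    ultimately show ?thesis by (simp add: LIMSEQ_const_iff)
  qed
  have "s \<le> qf A w"
  proof (rule LIMSEQ_le[OF _ limA[rule_format, OF A]])
    have "(\<lambda>k. s - inverse (real (Suc k))) \<longlonglongrightarrow> s - 0"
      by (intro tendsto_intros LIMSEQ_inverse_real_of_nat)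
    then show "((\<lambda>k. s - inverse (real (Suc k))) \<circ> r) \<longlonglongrightarrow> s"
      using LIMSEQ_subseq_LIMSEQ[OF _ r] by simp
    show "\<exists>N. \<forall>k\<ge>N. ((\<lambda>k. s - inverse (real (Suc k))) \<circ> r) k \<le> qf A (x (r k))"
      using less_imp_le[OF x(2)] by auto
  qed
  then have max: "qf A y \<le> qf A w" if "y \<in> C" for y
    using cSup_upper[OF _ bdd, of "qf A y"] that by (auto simp: s_def)
  have "qf A y \<le> qf A w * (y \<bullet> y)" if y: "y \<in> carrier_vec n" "\<forall>i<j. v i \<bullet> y = 0" for y
  proof (cases "y = 0\<^sub>v n")
    case True
    then show ?thesis using A by (simp add: qf_def)
  next
    case False
    from norm[OF y(1) False y(2)] obtain c where c: "c > 0" "c \<cdot>\<^sub>v y \<in> C" by auto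
    have n: "c\<^sup>2 * (y \<bullet> y) = 1" using c(2) y(1) by (simp add: C_def power2_eq_square)
    have "c\<^sup>2 * (qf A w * (y \<bullet> y)) = qf A w * (c\<^sup>2 * (y \<bullet> y))" by (rule mult.left_commute)
    also have "\<dots> = qf A w" using n by simp
    finally have eq: "c\<^sup>2 * (qf A w * (y \<bullet> y)) = qf A w" .
    have "c\<^sup>2 * qf A y \<le> c\<^sup>2 * (qf A w * (y \<bullet> y))"
      unfolding eq using max[OF c(2)] unfolding qf_smult[OF A y(1)] .
    then show ?thesis using c(1) by simp
  qed
  then show ?thesis using that w orth by blast
qed

text \<open>The maximiser \<open>w\<close> of the Rayleigh quotient on the orthogonal complement of
  the earlier eigenvectors is an eigenvector. Its residual \<open>y = A w - \<mu> w\<close> is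
  orthogonal to the earlier eigenvectors and to \<open>w\<close>, so each \<open>w + t y\<close>
  competes with \<open>w\<close>, and comparison to first order in \<open>t\<close> forces
  \<open>y = 0\<close>.\<close>

lemma orthonormal_eigenvectors:
  assumes A: "A \<in> carrier_mat n n" and sym: "transpose_mat A = A" and "j \<le> n"
  shows "\<exists>v lam. (\<forall>i<j. v i \<in> carrier_vec n \<and> A *\<^sub>v v i = lam i \<cdot>\<^sub>v v i) \<and>
    (\<forall>i<j. \<forall>l<j. v i \<bullet> v l = (if i = l then 1 else 0 :: real))"
  using assms(3)
proof (induction j)
  case 0
  then show ?case by auto
next
  case (Suc j)
  then obtain v lam where IH: "\<forall>i<j. v i \<in> carrier_vec n \<and> A *\<^sub>v v i = lam i \<cdot>\<^sub>v v i"
    "\<forall>i<j. \<forall>l<j. v i \<bullet> v l = (if i = l then 1 else 0)" by auto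
  then have vc: "\<And>i. i < j \<Longrightarrow> v i \<in> carrier_vec n" by blast
  have "j < n" using Suc by simp
  obtain w where w: "w \<in> carrier_vec n" "w \<bullet> w = 1" "\<forall>i<j. v i \<bullet> w = 0"
    "\<forall>x \<in> carrier_vec n. (\<forall>i<j. v i \<bullet> x = 0) \<longrightarrow> qf A x \<le> qf A w * (x \<bullet> x)"
    by (rule rayleigh_maximum[OF A \<open>j < n\<close> vc])
  define \<mu> where "\<mu> = qf A w"
  define y where "y = A *\<^sub>v w - \<mu> \<cdot>\<^sub>v w"
  have Aw: "A *\<^sub>v w \<in> carrier_vec n" and y: "y \<in> carrier_vec n" using A w by (auto simp: y_def)
  have Aw_y: "A *\<^sub>v w = y + \<mu> \<cdot>\<^sub>v w" using A w by (intro eq_vecI) (auto simp: y_def)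
  have orth_y: "v i \<bullet> y = 0" if "i < j" for i
  proof -
    have "v i \<bullet> (A *\<^sub>v w) = w \<bullet> (A *\<^sub>v v i)" by (rule sym_scalar_prod[OF A sym vc[OF that] w(1)])
    also have "\<dots> = lam i * (w \<bullet> v i)" using IH(1) that w(1) by simp
    also have "w \<bullet> v i = 0" using w(3) that comm_scalar_prod[OF w(1) vc[OF that]] by simp
    finally show ?thesis using Aw w(1,3) vc[OF that] that
      by (simp add: y_def scalar_prod_minus_distrib[of _ n])
  qed
  have wy: "w \<bullet> y = 0"
    using Aw w by (simp add: y_def scalar_prod_minus_distrib[of _ n] \<mu>_def qf_def)
  have yAw: "y \<bullet> (A *\<^sub>v w) = y \<bullet> y"
    using Aw_y y w wy comm_scalar_prod[OF w(1) y] by (simp add: scalar_prod_add_distrib[of _ n])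
  define a c where "a = y \<bullet> y" and "c = \<mu> * (y \<bullet> y) - qf A y"
  \<comment> \<open>Maximality of \<open>w\<close> against \<open>w + t y\<close>, after cancelling
    the constant \<open>\<mu>\<close>. The left side is linear in \<open>t\<close> and the right
    side quadratic, so a small positive \<open>t\<close> decides.\<close>
  have *: "2 * t * a \<le> t\<^sup>2 * c" for t :: real
  proof -
    have ty: "t \<cdot>\<^sub>v y \<in> carrier_vec n" using y by simp
    have "v i \<bullet> (w + t \<cdot>\<^sub>v y) = 0" if "i < j" for i
      using orth_y[OF that] w(1,3) y that vc[OF that] by (simp add: scalar_prod_add_distrib[of _ n])
    then have "qf A (w + t \<cdot>\<^sub>v y) \<le> \<mu> * ((w + t \<cdot>\<^sub>v y) \<bullet> (w + t \<cdot>\<^sub>v y))"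
      using w(1,4) y by (auto simp: \<mu>_def)
    moreover have "qf A (w + t \<cdot>\<^sub>v y) = \<mu> + 2 * t * a + t\<^sup>2 * qf A y"
      using qf_add[OF A sym w(1) ty] yAw y Aw by (simp add: \<mu>_def a_def qf_smult[OF A y])
    moreover have "(w + t \<cdot>\<^sub>v y) \<bullet> (w + t \<cdot>\<^sub>v y) = 1 + t\<^sup>2 * a"
      using w(1,2) y wy comm_scalar_prod[OF w(1) y]
      by (simp add: scalar_prod_add_distrib[of _ n] add_scalar_prod_distrib[of _ n] a_def power2_eq_square)
    ultimately show ?thesis by (simp add: c_def a_def algebra_simps)
  qed
  have "a = 0"
  proof (rule ccontr)
    assume "a \<noteq> 0"
    then have a: "a > 0" using scalar_self_nonneg[of y] by (simp add: a_def)
    \<comment> \<open>This choice makes \<open>t * c\<close> at most \<open>a\<close>, whereas the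
      inequality above requires at least \<open>2 * a\<close>.\<close>
    define t where "t = a / (\<bar>c\<bar> + 1)"
    have t: "t > 0" using a by (simp add: t_def)
    have "t * (2 * a) \<le> t * (t * c)" using *[of t] by (simp add: power2_eq_square algebra_simps)
    then have "2 * a \<le> t * c" using t by simp
    also have "\<dots> \<le> t * (\<bar>c\<bar> + 1)" using t by (intro mult_left_mono) auto
    also have "\<dots> = a" by (simp add: t_def)
    finally show False using a by simp
  qed
  then have "y = 0\<^sub>v n" using scalar_self_eq_0[OF y] by (simp add: a_def)
  then have eig: "A *\<^sub>v w = \<mu> \<cdot>\<^sub>v w" using Aw_y w(1) by simp
  have "w \<bullet> v i = 0" if "i < j" for i using w(3) that comm_scalar_prod[OF w(1) vc[OF that]] by simp
  then show ?case
    using IH w eig by (intro exI[of _ "v(j := w)"] exI[of _ "lam(j := \<mu>)"]) (auto simp: less_Suc_eq)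
qed

lemma spectral_theorem:
  assumes A: "A \<in> carrier_mat n n" and sym: "transpose_mat A = (A :: real mat)"
  obtains V lam where "V \<in> carrier_mat n n" "transpose_mat V * V = 1\<^sub>m n" "V * transpose_mat V = 1\<^sub>m n"
    "A * V = V * mat_diag n lam"
proof -
  obtain v lam where v: "\<forall>i<n. v i \<in> carrier_vec n \<and> A *\<^sub>v v i = lam i \<cdot>\<^sub>v v i"
    "\<forall>i<n. \<forall>l<n. v i \<bullet> v l = (if i = l then 1 else 0)"
    using orthonormal_eigenvectors[OF A sym order.refl] by blast
  define V where "V = mat n n (\<lambda>(i, l). v l $ i)"
  have V: "V \<in> carrier_mat n n" by (simp add: V_def)
  have col: "col V l = v l" if "l < n" for l
    using that v(1) by (intro eq_vecI) (auto simp: V_def)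
  have 1: "transpose_mat V * V = 1\<^sub>m n"
    using V v(2) by (intro eq_matI) (auto simp: col)
  have "A * V = V * mat_diag n lam"
  proof (rule mat_col_eqI)
    fix l assume "l < dim_col (V * mat_diag n lam)"
    then have l: "l < n" using V by (simp add: mat_diag_def)
    have "col (A * V) l = lam l \<cdot>\<^sub>v v l" using v(1) l col[OF l] col_mult2[OF A V l] by simp
    moreover have "col (V * mat_diag n lam) l = lam l \<cdot>\<^sub>v v l"
      unfolding mat_diag_mult_right[OF V] using l v(1)
      by (intro eq_vecI) (auto simp: V_def)
    ultimately show "col (A * V) l = col (V * mat_diag n lam) l" by simp
  qed (use A V in \<open>auto simp: mat_diag_def\<close>)
  then show ?thesis using that V 1 mat_mult_left_right_inverse[OF _ V 1] by auto
qed

text \<open>Diagonalising \<open>P\<close> by an orthogonal \<open>V\<close> with eigenvalues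
  \<open>lam\<close>, which are positive, the matrix is \<open>V\<close> times the diagonal of
  \<open>1 / sqrt (lam i)\<close> times the transpose of \<open>V\<close>.\<close>

lemma pd_inverse_sqrt_exists:
  assumes P: "P \<in> carrier_mat n n" and pd: "pd_mat P"
  obtains X where "X \<in> carrier_mat n n" "pd_mat X" "X * X * P = 1\<^sub>m n"
proof -
  note sym = pd_matD(1)[OF pd P]
  obtain V lam where V: "V \<in> carrier_mat n n" "transpose_mat V * V = 1\<^sub>m n" "V * transpose_mat V = 1\<^sub>m n"
    and PV: "P * V = V * mat_diag n lam" by (rule spectral_theorem[OF P sym])
  let ?D = "mat_diag n lam" and ?W = "transpose_mat V"
  define E where "E = mat_diag n (\<lambda>i. 1 / sqrt (lam i))"
  have E: "E \<in> carrier_mat n n" and W: "?W \<in> carrier_mat n n" using V by (auto simp: E_def)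
  have lam: "lam i > 0" if i: "i < n" for i
  proof -
    have vi: "col V i \<in> carrier_vec n" using V i by auto
    have vv: "col V i \<bullet> col V i = 1"
      using arg_cong[OF V(2), of "\<lambda>M. M $$ (i, i)"] V(1) i by simp
    then have "col V i \<noteq> 0\<^sub>v n" using V(1) by auto
    moreover have "P *\<^sub>v col V i = lam i \<cdot>\<^sub>v col V i"
    proof -
      have "P *\<^sub>v col V i = col (V * ?D) i" using col_mult2[OF P V(1) i] PV by simp
      also have "\<dots> = lam i \<cdot>\<^sub>v col V i"
        unfolding mat_diag_mult_right[OF V(1)] using i V(1) by (intro eq_vecI) auto
      finally show ?thesis .
    qed
    ultimately show ?thesis using pd_matD(2)[OF pd P vi] vv vi by (simp add: qf_def)
  qed
  have Et: "transpose_mat E = E" by (intro eq_matI) (auto simp: E_def mat_diag_def)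
  have "1 / sqrt (lam i) * (1 / sqrt (lam i)) * lam i = 1" if "i < n" for i
    using lam[OF that] by simp
  then have EED: "E * E * ?D = 1\<^sub>m n"
    unfolding E_def mat_diag_diag by (intro eq_matI) (simp_all add: mat_diag_def)
  define X where "X = V * E * ?W"
  have X: "X \<in> carrier_mat n n" using V E by (simp add: X_def)
  have WP: "?W * P = ?D * ?W"
  proof -
    have "transpose_mat (P * V) = transpose_mat (V * ?D)" using PV by simp
    moreover have "transpose_mat ?D = ?D" by (intro eq_matI) (auto simp: mat_diag_def)
    ultimately show ?thesis
      using transpose_mult[OF P V(1)] transpose_mult[OF V(1), of ?D n] sym by simp
  qed
  have VE: "V * E \<in> carrier_mat n n" and EW: "E * ?W \<in> carrier_mat n n" using V E by auto
  have D: "?D \<in> carrier_mat n n" by simp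
  have EE: "E * E \<in> carrier_mat n n" using E by auto
  have "X * X = V * E * (?W * (V * (E * ?W)))"
    unfolding X_def using V E W VE EW by (simp add: assoc_mult_mat[of _ n n _ n _ n])
  also have "?W * (V * (E * ?W)) = E * ?W"
    using assoc_mult_mat[OF W V(1) EW] V(2) left_mult_one_mat[OF EW] by simp
  also have "V * E * (E * ?W) = V * (E * E) * ?W"
    using V E W by (simp add: assoc_mult_mat[of _ n n _ n _ n])
  finally have "X * X * P = V * (E * E) * (?W * P)"
    using V EE W P by (simp add: assoc_mult_mat[of _ n n _ n _ n])
  also have "\<dots> = V * (E * E * ?D) * ?W"
    unfolding WP using assoc_mult_mat[OF V(1) EE mult_carrier_mat[OF D W]] assoc_mult_mat[OF EE D W]
      assoc_mult_mat[OF V(1) mult_carrier_mat[OF EE D] W] by simp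
  also have "\<dots> = 1\<^sub>m n" unfolding EED using V by simp
  finally have XXP: "X * X * P = 1\<^sub>m n" .
  have Xt: "transpose_mat X = X"
    unfolding X_def using V E W VE Et
    by (simp add: transpose_mult[of _ n n _ n] assoc_mult_mat[of _ n n _ n _ n])
  have "pd_mat X"
  proof (rule pd_matI[OF X Xt])
    fix x :: "real vec" assume x: "x \<in> carrier_vec n" "x \<noteq> 0\<^sub>v n"
    define y where "y = ?W *\<^sub>v x"
    have y: "y \<in> carrier_vec n" using W x by (simp add: y_def)
    have "V *\<^sub>v y = x" unfolding y_def by (rule inverse_mult_vec[OF V(1) W V(3) x(1)])
    then have "y \<noteq> 0\<^sub>v n" using x(2) mult_mat_vec_zero[OF V(1)] by auto
    then have ne: "\<exists>i<n. y $ i \<noteq> 0" using y by (metis carrier_vecD eq_vecI index_zero_vec(1,2))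
    have "qf X x = qf E y"
      using qf_congruence[OF E W x(1)] by (simp add: X_def y_def)
    also have "\<dots> = (\<Sum>i = 0..<n. y $ i * (1 / sqrt (lam i) * y $ i))"
    proof -
      have "(E *\<^sub>v y) $ i = 1 / sqrt (lam i) * y $ i" if "i < n" for i
      proof -
        have "(E *\<^sub>v y) $ i = (\<Sum>l = 0..<n. (if i = l then 1 / sqrt (lam l) else 0) * y $ l)"
          using that y by (simp add: E_def mat_diag_def scalar_prod_def)
        also have "\<dots> = (\<Sum>l = 0..<n. if i = l then 1 / sqrt (lam l) * y $ l else 0)"
          by (intro sum.cong) auto
        also have "\<dots> = 1 / sqrt (lam i) * y $ i" using that by simp
        finally show ?thesis .
      qed
      then show ?thesis using carrier_matD[OF E] by (simp add: qf_def scalar_prod_def del: index_mult_mat_vec)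
    qed
    also have "\<dots> > 0"
    proof -
      obtain i where i: "i < n" "y $ i \<noteq> 0" using ne by blast
      have eq: "y $ l * (1 / sqrt (lam l) * y $ l) = (y $ l)\<^sup>2 / sqrt (lam l)" for l
        by (simp add: power2_eq_square)
      have "0 < (y $ i)\<^sup>2 / sqrt (lam i)" using i lam by simp
      moreover have "0 \<le> (y $ l)\<^sup>2 / sqrt (lam l)" if "l \<in> {0..<n}" for l using lam[of l] that by simp
      ultimately show ?thesis unfolding eq using i(1)
        by (intro sum_pos2[where i = i]) auto
    qed
    finally show "0 < qf X x" .
  qed
  with X XXP that show ?thesis by blast
qed

text \<open>Since \<open>X X - Y Y = X D + D Y\<close> for \<open>D = X - Y\<close>, an eigenvector
  \<open>v\<close> of \<open>D\<close> with eigenvalue \<open>l\<close> satisfies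
  \<open>0 = l * (qf X v + qf Y v)\<close>. The bracket is positive, so all eigenvalues of the
  symmetric matrix \<open>D\<close> vanish.\<close>

lemma pd_sqrt_unique:
  assumes X: "X \<in> carrier_mat n n" "pd_mat X" and Y: "Y \<in> carrier_mat n n" "pd_mat Y"
    and eq: "X * X = Y * Y"
  shows "X = Y"
proof -
  note sX = pd_matD(1)[OF X(2,1)] and sY = pd_matD(1)[OF Y(2,1)]
  define D where "D = X - Y"
  have D: "D \<in> carrier_mat n n" using X Y by (simp add: D_def minus_carrier_mat)
  have sD: "transpose_mat D = D" using X(1) Y(1) sX sY by (simp add: D_def transpose_minus)
  obtain V lam where V: "V \<in> carrier_mat n n" "transpose_mat V * V = 1\<^sub>m n" "V * transpose_mat V = 1\<^sub>m n"
    and DV: "D * V = V * mat_diag n lam" by (rule spectral_theorem[OF D sD])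
  have "lam i = 0" if i: "i < n" for i
  proof -
    define v where "v = col V i"
    have v: "v \<in> carrier_vec n" using V i by (auto simp: v_def)
    have "v \<bullet> v = 1"
      using arg_cong[OF V(2), of "\<lambda>M. M $$ (i, i)"] V(1) i by (simp add: v_def)
    then have v0: "v \<noteq> 0\<^sub>v n" using v by auto
    have Dv: "D *\<^sub>v v = lam i \<cdot>\<^sub>v v"
    proof -
      have "D *\<^sub>v v = col (V * mat_diag n lam) i" using col_mult2[OF D V(1) i] DV by (simp add: v_def)
      also have "\<dots> = lam i \<cdot>\<^sub>v v"
        unfolding mat_diag_mult_right[OF V(1)] v_def using i V(1) by (intro eq_vecI) auto
      finally show ?thesis .
    qed
    have Xv: "X *\<^sub>v v \<in> carrier_vec n" and Yv: "Y *\<^sub>v v \<in> carrier_vec n" using X Y v by auto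
    have "v \<bullet> (X *\<^sub>v (X *\<^sub>v v)) = v \<bullet> (Y *\<^sub>v (Y *\<^sub>v v))"
      using assoc_mult_mat_vec[OF X(1) X(1) v] assoc_mult_mat_vec[OF Y(1) Y(1) v] eq by simp
    moreover have "X *\<^sub>v v = Y *\<^sub>v v + D *\<^sub>v v"
      using X(1) Y(1) v by (intro eq_vecI) (auto simp: D_def minus_mult_distrib_mat_vec[of _ n n])
    then have "v \<bullet> (X *\<^sub>v (X *\<^sub>v v)) = v \<bullet> (X *\<^sub>v (Y *\<^sub>v v)) + lam i * qf X v"
      using X(1) Y(1) v Yv Dv
      by (simp add: mult_add_distrib_mat_vec[of _ n n] scalar_prod_add_distrib[of _ n] mult_mat_vec[of _ n n] qf_def)
    moreover have "v \<bullet> (X *\<^sub>v (Y *\<^sub>v v)) = v \<bullet> (Y *\<^sub>v (Y *\<^sub>v v)) + lam i * qf Y v"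
    proof -
      have "X *\<^sub>v (Y *\<^sub>v v) = Y *\<^sub>v (Y *\<^sub>v v) + D *\<^sub>v (Y *\<^sub>v v)"
        using X(1) Y(1) Yv by (intro eq_vecI) (auto simp: D_def minus_mult_distrib_mat_vec[of _ n n])
      moreover have "v \<bullet> (D *\<^sub>v (Y *\<^sub>v v)) = lam i * qf Y v"
        using sym_scalar_prod[OF D sD v Yv] Dv v Yv comm_scalar_prod[OF v Yv] by (simp add: qf_def)
      ultimately show ?thesis
        using X(1) Y(1) v Yv D by (simp add: scalar_prod_add_distrib[of _ n])
    qed
    ultimately have "lam i * (qf X v + qf Y v) = 0" by (simp add: algebra_simps)
    then show ?thesis using pd_matD(2)[OF X(2,1) v v0] pd_matD(2)[OF Y(2,1) v v0] by auto
  qed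
  then have "mat_diag n lam = 0\<^sub>m n n" by (intro eq_matI) (auto simp: mat_diag_def)
  then have "D * V = 0\<^sub>m n n" using DV V by simp
  then have "D * (V * transpose_mat V) = 0\<^sub>m n n"
    using assoc_mult_mat[OF D V(1), of "transpose_mat V" n] V(1) by simp
  then have "D = 0\<^sub>m n n" using V(3) D by simp
  show ?thesis
  proof (rule eq_matI)
    fix i j assume ij: "i < dim_row Y" "j < dim_col Y"
    have "D $$ (i, j) = 0" using \<open>D = 0\<^sub>m n n\<close> ij Y by auto
    then show "X $$ (i, j) = Y $$ (i, j)" using ij by (simp add: D_def)
  qed (use X Y in auto)
qed

text \<open>The definite description in the definition yields nothing before existence and
  uniqueness are known. For uniqueness, \<open>X X\<close> must be the inverse of \<open>P\<close>,
  and a positive definite matrix is determined by its square.\<close>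

lemma mat_inv_sqrt:
  assumes P: "P \<in> carrier_mat n n" and pd: "pd_mat P"
  shows "mat_inv_sqrt P \<in> carrier_mat n n" "mat_inv_sqrt P * mat_inv_sqrt P * P = 1\<^sub>m n"
    "transpose_mat (mat_inv_sqrt P) = mat_inv_sqrt P"
proof -
  let ?Q = "\<lambda>X. X \<in> carrier_mat (dim_row P) (dim_row P) \<and> pd_mat X \<and> X * X * P = 1\<^sub>m (dim_row P)"
  have dim: "dim_row P = n" using P by auto
  obtain X where X: "X \<in> carrier_mat n n" "pd_mat X" "X * X * P = 1\<^sub>m n"
    by (rule pd_inverse_sqrt_exists[OF P pd])
  have uniq: "Y = X" if Y: "?Q Y" for Y
  proof (rule pd_sqrt_unique[of _ n])
    have YY: "Y * Y \<in> carrier_mat n n" and XX: "X * X \<in> carrier_mat n n" using Y X dim by auto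
    have "P * (X * X) = 1\<^sub>m n" by (rule mat_mult_left_right_inverse[OF XX P X(3)])
    then have "Y * Y * P * (X * X) = Y * Y" using assoc_mult_mat[OF YY P XX] right_mult_one_mat[OF YY] by simp
    moreover have "Y * Y * P = 1\<^sub>m n" using Y dim by simp
    ultimately show "Y * Y = X * X" using left_mult_one_mat[OF XX] by (simp only:)
  qed (use X Y dim in auto)
  have "?Q X" using X dim by simp
  from theI[of ?Q, OF this uniq] have "?Q (mat_inv_sqrt P)" unfolding mat_inv_sqrt_def .
  then show "mat_inv_sqrt P \<in> carrier_mat n n" "mat_inv_sqrt P * mat_inv_sqrt P * P = 1\<^sub>m n"
    "transpose_mat (mat_inv_sqrt P) = mat_inv_sqrt P"
    using dim pd_matD(1)[of "mat_inv_sqrt P" n] by auto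
qed

section \<open>Saddle points of quadratic forms\<close>

lemma hcat_carrier [simp]:
  "A \<in> carrier_mat nr n1 \<Longrightarrow> B \<in> carrier_mat nr n2 \<Longrightarrow> hcat A B \<in> carrier_mat nr (n1 + n2)"
  by (auto simp: hcat_def)

lemma vcat_carrier [simp]:
  "A \<in> carrier_mat n1 nc \<Longrightarrow> B \<in> carrier_mat n2 nc \<Longrightarrow> vcat A B \<in> carrier_mat (n1 + n2) nc"
  by (auto simp: vcat_def)

lemma hcat_mult_vec:
  assumes "A \<in> carrier_mat nr n1" "B \<in> carrier_mat nr n2" "x \<in> carrier_vec n1" "y \<in> carrier_vec n2"
  shows "hcat A B *\<^sub>v (x @\<^sub>v y) = A *\<^sub>v x + B *\<^sub>v y"
proof (rule eq_vecI)
  fix i assume i: "i < dim_vec (A *\<^sub>v x + B *\<^sub>v y)"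
  have "row (hcat A B) i = row A i @\<^sub>v row B i"
    using assms i by (intro eq_vecI) (auto simp: hcat_def)
  moreover have "(row A i @\<^sub>v row B i) \<bullet> (x @\<^sub>v y) = row A i \<bullet> x + row B i \<bullet> y"
    by (rule scalar_prod_append[of _ n1 _ n2]) (use assms i in auto)
  ultimately show "(hcat A B *\<^sub>v (x @\<^sub>v y)) $ i = (A *\<^sub>v x + B *\<^sub>v y) $ i"
    using i assms by (simp add: hcat_def)
qed (use assms in \<open>auto simp: hcat_def\<close>)

lemma vcat_mult_vec:
  assumes "A \<in> carrier_mat n1 nc" "B \<in> carrier_mat n2 nc" "x \<in> carrier_vec nc"
  shows "vcat A B *\<^sub>v x = (A *\<^sub>v x) @\<^sub>v (B *\<^sub>v x)"
proof (rule eq_vecI)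
  fix i assume i: "i < dim_vec ((A *\<^sub>v x) @\<^sub>v (B *\<^sub>v x))"
  have "row (vcat A B) i = (if i < n1 then row A i else row B (i - n1))"
    using assms i by (intro eq_vecI) (auto simp: vcat_def)
  then show "(vcat A B *\<^sub>v x) $ i = ((A *\<^sub>v x) @\<^sub>v (B *\<^sub>v x)) $ i"
    using i assms by (auto simp: vcat_def)
qed (use assms in \<open>auto simp: vcat_def\<close>)

text \<open>Being quadratic is a predicate on functions, so that a sum of many \<open>qf\<close>
  terms of linear images is recognised by introduction rules and its block matrices are never
  written out. Symmetry of \<open>Qyy\<close> makes \<open>Qyx x + Qyy y\<close> half the gradient
  in \<open>y\<close>.\<close>

definition quad2 :: "nat \<Rightarrow> nat \<Rightarrow> (real vec \<Rightarrow> real vec \<Rightarrow> real) \<Rightarrow> bool" where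
  "quad2 a c q \<longleftrightarrow> (\<exists>Qxx Qyx Qyy. Qxx \<in> carrier_mat a a \<and> Qyx \<in> carrier_mat c a \<and>
     Qyy \<in> carrier_mat c c \<and> transpose_mat Qyy = Qyy \<and>
     (\<forall>x \<in> carrier_vec a. \<forall>y \<in> carrier_vec c.
        q x y = qf Qxx x + 2 * (y \<bullet> (Qyx *\<^sub>v x)) + qf Qyy y))"

lemma quad2_add:
  assumes "quad2 a c q" "quad2 a c q'"
  shows "quad2 a c (\<lambda>x y. q x y + q' x y)"
proof -
  from assms(1) obtain A B C where 1: "A \<in> carrier_mat a a" "B \<in> carrier_mat c a" "C \<in> carrier_mat c c"
    "transpose_mat C = C" "\<forall>x \<in> carrier_vec a. \<forall>y \<in> carrier_vec c.
      q x y = qf A x + 2 * (y \<bullet> (B *\<^sub>v x)) + qf C y" unfolding quad2_def by blast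
  from assms(2) obtain A' B' C' where 2: "A' \<in> carrier_mat a a" "B' \<in> carrier_mat c a" "C' \<in> carrier_mat c c"
    "transpose_mat C' = C'" "\<forall>x \<in> carrier_vec a. \<forall>y \<in> carrier_vec c.
      q' x y = qf A' x + 2 * (y \<bullet> (B' *\<^sub>v x)) + qf C' y" unfolding quad2_def by blast
  have "q x y + q' x y = qf (A + A') x + 2 * (y \<bullet> ((B + B') *\<^sub>v x)) + qf (C + C') y"
    if x: "x \<in> carrier_vec a" and y: "y \<in> carrier_vec c" for x y
  proof -
    have "y \<bullet> ((B + B') *\<^sub>v x) = y \<bullet> (B *\<^sub>v x) + y \<bullet> (B' *\<^sub>v x)"
      using 1(2) 2(2) x y
      by (simp add: add_mult_distrib_mat_vec[of _ c a] scalar_prod_add_distrib[of _ c])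
    then show ?thesis using 1 2 x y by (simp add: qf_mat_add)
  qed
  moreover have "transpose_mat (C + C') = C + C'" using 1 2 transpose_add[OF 1(3) 2(3)] by simp
  ultimately show ?thesis unfolding quad2_def using 1 2
    by (intro exI[of _ "A + A'"] exI[of _ "B + B'"] exI[of _ "C + C'"]) auto
qed

lemma quad2_uminus:
  assumes "quad2 a c q"
  shows "quad2 a c (\<lambda>x y. - q x y)"
proof -
  from assms(1) obtain A B C where 1: "A \<in> carrier_mat a a" "B \<in> carrier_mat c a" "C \<in> carrier_mat c c"
    "transpose_mat C = C" "\<forall>x \<in> carrier_vec a. \<forall>y \<in> carrier_vec c.
      q x y = qf A x + 2 * (y \<bullet> (B *\<^sub>v x)) + qf C y" unfolding quad2_def by blast
  have "transpose_mat (- C) = - C" using 1 by (simp add: transpose_uminus)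
  then show ?thesis unfolding quad2_def using 1
    by (intro exI[of _ "- A"] exI[of _ "- B"] exI[of _ "- C"]) (auto simp: qf_mat_uminus)
qed

lemma quad2_diff:
  assumes "quad2 a c q" "quad2 a c q'"
  shows "quad2 a c (\<lambda>x y. q x y - q' x y)"
  using quad2_add[OF assms(1) quad2_uminus[OF assms(2)]] by simp

lemma quad2_qf:
  assumes K: "K \<in> carrier_mat l l" "transpose_mat K = K"
    and A: "A \<in> carrier_mat l a" and B: "B \<in> carrier_mat l c"
  shows "quad2 a c (\<lambda>x y. qf K (A *\<^sub>v x + B *\<^sub>v y))"
proof -
  have Bt: "transpose_mat B \<in> carrier_mat c l" using B by simp
  have "qf K (A *\<^sub>v x + B *\<^sub>v y) = qf (transpose_mat A * K * A) x
      + 2 * (y \<bullet> (transpose_mat B * K * A *\<^sub>v x)) + qf (transpose_mat B * K * B) y"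
    if x: "x \<in> carrier_vec a" and y: "y \<in> carrier_vec c" for x y
  proof -
    have Ax: "A *\<^sub>v x \<in> carrier_vec l" and By: "B *\<^sub>v y \<in> carrier_vec l" using A B x y by auto
    have KAx: "K *\<^sub>v (A *\<^sub>v x) \<in> carrier_vec l" using K Ax by auto
    have "transpose_mat B * K * A *\<^sub>v x = transpose_mat B *\<^sub>v (K *\<^sub>v (A *\<^sub>v x))"
      using assoc_mult_mat_vec[OF mult_carrier_mat[OF Bt K(1)] A x] assoc_mult_mat_vec[OF Bt K(1) Ax] by simp
    moreover have "y \<bullet> (transpose_mat B *\<^sub>v (K *\<^sub>v (A *\<^sub>v x))) = (B *\<^sub>v y) \<bullet> (K *\<^sub>v (A *\<^sub>v x))"
      using transpose_vec_mult_scalar[OF Bt KAx y] by simp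
    ultimately show ?thesis
      using qf_add[OF K Ax By] qf_congruence[OF K(1) A x] qf_congruence[OF K(1) B y] by simp
  qed
  moreover have "transpose_mat (transpose_mat B * K * B) = transpose_mat B * K * B"
    using transpose_mult[OF mult_carrier_mat[OF Bt K(1)] B] transpose_mult[OF Bt K(1)] K(2)
      assoc_mult_mat[OF Bt K(1) B] by simp
  ultimately show ?thesis unfolding quad2_def using A B K
    by (intro exI[of _ "transpose_mat A * K * A"] exI[of _ "transpose_mat B * K * A"]
        exI[of _ "transpose_mat B * K * B"]) auto
qed

text \<open>A linear policy \<open>v = L x\<close> is read off from the saddle point of \<open>q x\<close>, i.e. from the unique
  stationary point in \<open>(v, w)\<close>: it minimises over \<open>v\<close> for its own \<open>w\<close>, so the value there is
  negative, and moving \<open>w\<close> away from it only decreases \<open>q\<close>.\<close>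
lemma saddle_point_policy:
  assumes q: "quad2 a (b + c) q"
    and pos: "\<And>v. v \<in> carrier_vec b \<Longrightarrow> v \<noteq> 0\<^sub>v b \<Longrightarrow> 0 < q (0\<^sub>v a) (v @\<^sub>v 0\<^sub>v c)"
    and neg: "\<And>w. w \<in> carrier_vec c \<Longrightarrow> w \<noteq> 0\<^sub>v c \<Longrightarrow> q (0\<^sub>v a) (0\<^sub>v b @\<^sub>v w) < 0"
    and ex: "\<And>x w. x \<in> carrier_vec a \<Longrightarrow> w \<in> carrier_vec c \<Longrightarrow> x \<noteq> 0\<^sub>v a \<or> w \<noteq> 0\<^sub>v c \<Longrightarrow>
      \<exists>v \<in> carrier_vec b. q x (v @\<^sub>v w) < 0"
  obtains L where "L \<in> carrier_mat b a"
    "\<forall>x \<in> carrier_vec a. \<forall>w \<in> carrier_vec c. x \<noteq> 0\<^sub>v a \<or> w \<noteq> 0\<^sub>v c \<longrightarrow> q x ((L *\<^sub>v x) @\<^sub>v w) < 0"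
proof -
  from q obtain A B C where A: "A \<in> carrier_mat a a" and B: "B \<in> carrier_mat (b + c) a"
    and C: "C \<in> carrier_mat (b + c) (b + c)" and sym: "transpose_mat C = C"
    and q_eq: "\<forall>x \<in> carrier_vec a. \<forall>y \<in> carrier_vec (b + c).
      q x y = qf A x + 2 * (y \<bullet> (B *\<^sub>v x)) + qf C y" unfolding quad2_def by blast
  \<comment> \<open>Exact second-order expansion in \<open>y\<close>. At a stationary point the
    linear term vanishes, and only \<open>qf C\<close> of the displacement remains.\<close>
  have shift: "q x (y + y') = q x y + 2 * (y' \<bullet> (B *\<^sub>v x + C *\<^sub>v y)) + qf C y'"
    if "x \<in> carrier_vec a" "y \<in> carrier_vec (b + c)" "y' \<in> carrier_vec (b + c)" for x y y'
  proof -
    have c: "B *\<^sub>v x \<in> carrier_vec (b + c)" "C *\<^sub>v y \<in> carrier_vec (b + c)" using B C that by auto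
    have "q x (y + y') = qf A x + 2 * ((y + y') \<bullet> (B *\<^sub>v x)) + qf C (y + y')"
      using that q_eq by simp
    also have "\<dots> = q x y + 2 * (y' \<bullet> (B *\<^sub>v x)) + 2 * (y' \<bullet> (C *\<^sub>v y)) + qf C y'"
      using q_eq that c qf_add[OF C sym that(2,3)] by (simp add: add_scalar_prod_distrib[of _ "b + c"])
    finally show ?thesis using that c by (simp add: scalar_prod_add_distrib[of _ "b + c"])
  qed
  have q0: "q (0\<^sub>v a) y = qf C y" if "y \<in> carrier_vec (b + c)" for y
  proof -
    have "qf A (0\<^sub>v a) = 0" using A by (simp add: qf_def)
    then show ?thesis using q_eq that mult_mat_vec_zero[OF B] by simp
  qed
  have split: "\<exists>v w. v \<in> carrier_vec b \<and> w \<in> carrier_vec c \<and> y = v @\<^sub>v w"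
    if "y \<in> carrier_vec (b + c)" for y :: "real vec"
    using vec_first_last_append[OF that] by (metis vec_first_carrier vec_last_carrier)
  have Cv: "0 \<le> qf C (v @\<^sub>v 0\<^sub>v c)" if "v \<in> carrier_vec b" for v
  proof (cases "v = 0\<^sub>v b")
    case True
    then have "v @\<^sub>v 0\<^sub>v c = 0\<^sub>v (b + c)" by (intro eq_vecI) auto
    then show ?thesis using C by (simp add: qf_def)
  next
    case False
    then show ?thesis using pos[OF that False] q0[of "v @\<^sub>v 0\<^sub>v c"] that by simp
  qed
  have stationary_neg: "q x (v @\<^sub>v w) < 0"
    if x: "x \<in> carrier_vec a" and v: "v \<in> carrier_vec b" and w: "w \<in> carrier_vec c"
      and st: "B *\<^sub>v x + C *\<^sub>v (v @\<^sub>v w) = 0\<^sub>v (b + c)" and nz: "x \<noteq> 0\<^sub>v a \<or> w \<noteq> 0\<^sub>v c" for x v w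
  proof -
    obtain v' where v': "v' \<in> carrier_vec b" "q x (v' @\<^sub>v w) < 0" using ex[OF x w nz] by blast
    have d: "v' - v \<in> carrier_vec b" using v v' by simp
    have "v' @\<^sub>v w = (v @\<^sub>v w) + ((v' - v) @\<^sub>v 0\<^sub>v c)"
      using v v' w by (intro eq_vecI) auto
    then have "q x (v' @\<^sub>v w) = q x (v @\<^sub>v w) + qf C ((v' - v) @\<^sub>v 0\<^sub>v c)"
      using shift[OF x, of "v @\<^sub>v w" "(v' - v) @\<^sub>v 0\<^sub>v c"] st v w d by simp
    with Cv[OF d] v'(2) show ?thesis by linarith
  qed
  \<comment> \<open>A kernel vector of \<open>C\<close> is a stationary point for
    \<open>x = 0\<close> with value 0. A nonzero \<open>w\<close>-part would make that value
    negative, and then a nonzero \<open>v\<close>-part would make it positive. So the stationary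
    point is unique and linear in \<open>x\<close>.\<close>
  have inj: "y = 0\<^sub>v (b + c)" if y: "y \<in> carrier_vec (b + c)" and Cy: "C *\<^sub>v y = 0\<^sub>v (b + c)" for y
  proof -
    obtain v w where vw: "v \<in> carrier_vec b" "w \<in> carrier_vec c" "y = v @\<^sub>v w" using split[OF y] by blast
    have qy: "q (0\<^sub>v a) y = 0" using q0[OF y] Cy y by (simp add: qf_def)
    have "B *\<^sub>v 0\<^sub>v a + C *\<^sub>v (v @\<^sub>v w) = 0\<^sub>v (b + c)"
      using mult_mat_vec_zero[OF B] Cy vw by simp
    from stationary_neg[OF _ vw(1,2) this] have w: "w = 0\<^sub>v c" using qy vw by auto
    then have "v = 0\<^sub>v b" using pos[OF vw(1)] qy vw by auto
    then show ?thesis using w vw by (intro eq_vecI) auto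
  qed
  obtain D where D: "D \<in> carrier_mat (b + c) (b + c)" "C * D = 1\<^sub>m (b + c)"
    using inverse_exists_if_injective[OF C inj] by blast
  \<comment> \<open>\<open>Y x\<close> solves the stationarity equation
    \<open>B x + C y = 0\<close>. Its first \<open>b\<close> entries are the policy
    \<open>L x\<close>, the last \<open>c\<close> entries the opponent's answer
    \<open>w0\<close>.\<close>
  define Y where "Y = - (D * B)"
  have Y: "Y \<in> carrier_mat (b + c) a" using D B by (simp add: Y_def)
  define L where "L = mat b a (\<lambda>(i, j). Y $$ (i, j))"
  have L: "L \<in> carrier_mat b a" by (simp add: L_def)
  have Lx: "Y *\<^sub>v x = (L *\<^sub>v x) @\<^sub>v vec_last (Y *\<^sub>v x) c" if "x \<in> carrier_vec a" for x
  proof -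
    have "vec_first (Y *\<^sub>v x) b = L *\<^sub>v x"
    proof (rule eq_vecI)
      fix i assume i: "i < dim_vec (L *\<^sub>v x)"
      then have "row L i = row Y i" using L Y by (intro eq_vecI) (auto simp: L_def)
      then show "vec_first (Y *\<^sub>v x) b $ i = (L *\<^sub>v x) $ i"
        using i L Y by (simp add: vec_first_def)
    qed (use L in auto)
    moreover have "Y *\<^sub>v x \<in> carrier_vec (b + c)" using Y that by auto
    ultimately show ?thesis using vec_first_last_append[of "Y *\<^sub>v x" b c] by simp
  qed
  have "q x ((L *\<^sub>v x) @\<^sub>v w) < 0"
    if x: "x \<in> carrier_vec a" and w: "w \<in> carrier_vec c" and nz: "x \<noteq> 0\<^sub>v a \<or> w \<noteq> 0\<^sub>v c" for x w
  proof -
    define w0 where "w0 = vec_last (Y *\<^sub>v x) c"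
    have w0: "w0 \<in> carrier_vec c" and Lxc: "L *\<^sub>v x \<in> carrier_vec b" using L x by (auto simp: w0_def)
    have Bx: "B *\<^sub>v x \<in> carrier_vec (b + c)" using B x by auto
    have "Y *\<^sub>v x = - (D *\<^sub>v (B *\<^sub>v x))"
      unfolding Y_def using D B x by simp
    moreover have "C *\<^sub>v (D *\<^sub>v (B *\<^sub>v x)) = B *\<^sub>v x" by (rule inverse_mult_vec[OF C D Bx])
    moreover have "C *\<^sub>v (- (D *\<^sub>v (B *\<^sub>v x))) = - (C *\<^sub>v (D *\<^sub>v (B *\<^sub>v x)))"
      using C D Bx by (intro eq_vecI) auto
    ultimately have "C *\<^sub>v (Y *\<^sub>v x) = - (B *\<^sub>v x)" by simp
    then have st: "B *\<^sub>v x + C *\<^sub>v ((L *\<^sub>v x) @\<^sub>v w0) = 0\<^sub>v (b + c)"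
      using Lx[OF x] Bx by (simp add: w0_def)
    have y0: "(L *\<^sub>v x) @\<^sub>v w0 \<in> carrier_vec (b + c)" using Lxc w0 by auto
    have d: "w - w0 \<in> carrier_vec c" using w w0 by simp
    have "(L *\<^sub>v x) @\<^sub>v w = ((L *\<^sub>v x) @\<^sub>v w0) + (0\<^sub>v b @\<^sub>v (w - w0))"
      using L Lxc w w0 by (intro eq_vecI) auto
    then have eq: "q x ((L *\<^sub>v x) @\<^sub>v w) = q x ((L *\<^sub>v x) @\<^sub>v w0) + qf C (0\<^sub>v b @\<^sub>v (w - w0))"
      using shift[OF x y0, of "0\<^sub>v b @\<^sub>v (w - w0)"] st d by simp
    have Cd: "qf C (0\<^sub>v b @\<^sub>v (w - w0)) < 0" if "w - w0 \<noteq> 0\<^sub>v c"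
      using neg[OF d that] q0[of "0\<^sub>v b @\<^sub>v (w - w0)"] d by simp
    have Cd0: "qf C (0\<^sub>v b @\<^sub>v (w - w0)) = 0" if "w - w0 = 0\<^sub>v c"
    proof -
      have "0\<^sub>v b @\<^sub>v (w - w0) = 0\<^sub>v (b + c)" using that by (intro eq_vecI) auto
      then show ?thesis using C by (simp add: qf_def)
    qed
    show ?thesis
    \<comment> \<open>If \<open>x\<close> and \<open>w0\<close> vanish, the stationary point is the
      origin with value 0, and strictness has to come from \<open>w\<close> itself.\<close>
    proof (cases "x \<noteq> 0\<^sub>v a \<or> w0 \<noteq> 0\<^sub>v c")
      case True
      from stationary_neg[OF x Lxc w0 st True] eq Cd Cd0 show ?thesis by fastforce
    next
      case False
      then have "L *\<^sub>v x = 0\<^sub>v b" and w_nz: "w \<noteq> 0\<^sub>v c" using nz mult_mat_vec_zero[OF L] by auto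
      then show ?thesis using neg[OF w w_nz] False by simp
    qed
  qed
  with L that show ?thesis by blast
qed

section \<open>Block-diagonal scalings\<close>

definition blk :: "nat list \<Rightarrow> real vec \<Rightarrow> nat \<Rightarrow> real vec" where
  "blk ms v i = vec (ms ! i) (\<lambda>j. v $ (sum_list (take i ms) + j))"

text \<open>The matrix that occurs in \<open>Delta\<close> and in the inequalities of the theorem.
  With the blocks given as a function of the index, induction over \<open>ms\<close> amounts to
  shifting that function.\<close>

definition bdiag :: "nat list \<Rightarrow> (nat \<Rightarrow> real mat) \<Rightarrow> real mat" where
  "bdiag ms A = diag_block_mat (map A [0..<length ms])"

lemma blk_carrier [simp]: "blk ms v i \<in> carrier_vec (ms ! i)"
  by (simp add: blk_def)

lemma append_vec_cases:
  assumes "(v :: real vec) \<in> carrier_vec (n + m)"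
  obtains v1 v2 where "v1 \<in> carrier_vec n" "v2 \<in> carrier_vec m" "v = v1 @\<^sub>v v2"
  using vec_first_last_append[OF assms] by (metis vec_first_carrier vec_last_carrier)

lemma blk_index_less:
  fixes ms :: "nat list"
  assumes i: "i < length ms" and "j < ms ! i"
  shows "sum_list (take i ms) + j < sum_list ms"
proof -
  have "sum_list ms = sum_list (take i ms) + ms ! i + sum_list (drop (Suc i) ms)"
    using id_take_nth_drop[OF i] by (metis add.assoc sum_list.Cons sum_list_append)
  with assms(2) show ?thesis by linarith
qed

lemma blk_Cons:
  assumes "v1 \<in> carrier_vec m" "v2 \<in> carrier_vec (sum_list ms)"
  shows "blk (m # ms) (v1 @\<^sub>v v2) 0 = v1"
    and "i < length ms \<Longrightarrow> blk (m # ms) (v1 @\<^sub>v v2) (Suc i) = blk ms v2 i"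
proof -
  show "blk (m # ms) (v1 @\<^sub>v v2) 0 = v1" using assms by (intro eq_vecI) (auto simp: blk_def)
  assume i: "i < length ms"
  then show "blk (m # ms) (v1 @\<^sub>v v2) (Suc i) = blk ms v2 i"
    using assms blk_index_less[OF i] by (intro eq_vecI) (auto simp: blk_def add.assoc)
qed

lemma bdiag_Cons:
  "bdiag (m # ms) A = four_block_mat (A 0) (0\<^sub>m (dim_row (A 0)) (dim_col (bdiag ms (\<lambda>i. A (Suc i)))))
     (0\<^sub>m (dim_row (bdiag ms (\<lambda>i. A (Suc i)))) (dim_col (A 0))) (bdiag ms (\<lambda>i. A (Suc i)))"
proof -
  have "map A [0..<length (m # ms)] = A 0 # map (\<lambda>i. A (Suc i)) [0..<length ms]"
    by (simp add: upt_conv_Cons map_Suc_upt[symmetric] del: upt_Suc)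
  then show ?thesis by (simp add: bdiag_def Let_def del: upt_Suc)
qed

lemma bdiag_carrier:
  assumes "\<forall>i<length ms. A i \<in> carrier_mat (ms ! i) (ms ! i)"
  shows "bdiag ms A \<in> carrier_mat (sum_list ms) (sum_list ms)"
  using assms
proof (induction ms arbitrary: A)
  case Nil
  then show ?case by (simp add: bdiag_def)
next
  case (Cons m ms)
  have "bdiag ms (\<lambda>i. A (Suc i)) \<in> carrier_mat (sum_list ms) (sum_list ms)"
    using Cons.prems by (intro Cons.IH) force
  moreover have "A 0 \<in> carrier_mat m m" using Cons.prems by force
  ultimately show ?case by (auto simp: bdiag_Cons)
qed

lemma bdiag_transpose:
  assumes "\<forall>i<length ms. A i \<in> carrier_mat (ms ! i) (ms ! i) \<and> transpose_mat (A i) = A i"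
  shows "transpose_mat (bdiag ms A) = bdiag ms A"
  using assms
proof (induction ms arbitrary: A)
  case Nil
  then show ?case by (simp add: bdiag_def)
next
  case (Cons m ms)
  have IH: "transpose_mat (bdiag ms (\<lambda>i. A (Suc i))) = bdiag ms (\<lambda>i. A (Suc i))"
    using Cons.prems by (intro Cons.IH) force
  have c: "bdiag ms (\<lambda>i. A (Suc i)) \<in> carrier_mat (sum_list ms) (sum_list ms)"
    using Cons.prems by (intro bdiag_carrier) force
  have A0: "A 0 \<in> carrier_mat m m" "transpose_mat (A 0) = A 0" using Cons.prems by force+
  show ?case unfolding bdiag_Cons
    using transpose_four_block_mat[OF A0(1) zero_carrier_mat zero_carrier_mat c] IH A0 c by auto
qed

lemma blk_bdiag_mult:
  assumes "\<forall>i<length ms. A i \<in> carrier_mat (ms ! i) (ms ! i)"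
    and "v \<in> carrier_vec (sum_list ms)" "i < length ms"
  shows "blk ms (bdiag ms A *\<^sub>v v) i = A i *\<^sub>v blk ms v i"
  using assms
proof (induction ms arbitrary: A v i)
  case Nil
  then show ?case by simp
next
  case (Cons m ms)
  let ?B = "bdiag ms (\<lambda>i. A (Suc i))"
  have B: "?B \<in> carrier_mat (sum_list ms) (sum_list ms)"
    using Cons.prems by (intro bdiag_carrier) force
  have A0: "A 0 \<in> carrier_mat m m" using Cons.prems(1) by force
  obtain v1 v2 where v: "v1 \<in> carrier_vec m" "v2 \<in> carrier_vec (sum_list ms)" "v = v1 @\<^sub>v v2"
    using Cons.prems(2) by (auto elim: append_vec_cases)
  have dims: "dim_row (A 0) = m" "dim_col (A 0) = m" "dim_row ?B = sum_list ms" "dim_col ?B = sum_list ms"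
    using A0 B by auto
  have mult: "bdiag (m # ms) A *\<^sub>v v = (A 0 *\<^sub>v v1) @\<^sub>v (?B *\<^sub>v v2)"
    unfolding bdiag_Cons v dims by (rule mult_mat_vec_split[OF A0 B v(1,2)])
  have c: "A 0 *\<^sub>v v1 \<in> carrier_vec m" "?B *\<^sub>v v2 \<in> carrier_vec (sum_list ms)" using A0 B v by auto
  show ?case
  proof (cases i)
    case 0
    then show ?thesis using mult c v blk_Cons(1)[OF c] blk_Cons(1)[OF v(1,2)] by simp
  next
    case (Suc j)
    then have j: "j < length ms" using Cons.prems by simp
    have "blk ms (?B *\<^sub>v v2) j = A (Suc j) *\<^sub>v blk ms v2 j"
      using Cons.prems(1) by (intro Cons.IH v(2) j) force
    then show ?thesis using Suc mult v blk_Cons(2)[OF c j] blk_Cons(2)[OF v(1,2) j] by simp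
  qed
qed

lemma scalar_prod_blk:
  assumes "v \<in> carrier_vec (sum_list ms)" "w \<in> carrier_vec (sum_list ms)"
  shows "v \<bullet> w = (\<Sum>i<length ms. blk ms v i \<bullet> blk ms w i)"
  using assms
proof (induction ms arbitrary: v w)
  case Nil
  then show ?case by (simp add: scalar_prod_def)
next
  case (Cons m ms)
  obtain v1 v2 where v: "v1 \<in> carrier_vec m" "v2 \<in> carrier_vec (sum_list ms)" "v = v1 @\<^sub>v v2"
    using Cons.prems(1) by (auto elim: append_vec_cases)
  obtain w1 w2 where w: "w1 \<in> carrier_vec m" "w2 \<in> carrier_vec (sum_list ms)" "w = w1 @\<^sub>v w2"
    using Cons.prems(2) by (auto elim: append_vec_cases)
  have "v \<bullet> w = v1 \<bullet> w1 + v2 \<bullet> w2" unfolding v w by (rule scalar_prod_append[OF v(1,2) w(1,2)])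
  also have "v2 \<bullet> w2 = (\<Sum>i<length ms. blk ms v2 i \<bullet> blk ms w2 i)" by (rule Cons.IH[OF v(2) w(2)])
  finally show ?case
    using v w by (simp add: sum.lessThan_Suc_shift blk_Cons del: sum.lessThan_Suc)
qed

lemma blk_minus:
  assumes "v \<in> carrier_vec (sum_list ms)" "w \<in> carrier_vec (sum_list ms)" "i < length ms"
  shows "blk ms (v - w) i = blk ms v i - blk ms w i"
  using assms blk_index_less[OF assms(3)] by (intro eq_vecI) (auto simp: blk_def)

text \<open>All blocks of \<open>v - w\<close> vanish, and its squared norm is the sum of the
  squared norms of its blocks.\<close>

lemma eq_if_blk_eq:
  assumes v: "v \<in> carrier_vec (sum_list ms)" and w: "w \<in> carrier_vec (sum_list ms)"
    and "\<And>i. i < length ms \<Longrightarrow> blk ms v i = blk ms w i"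
  shows "v = w"
proof -
  have c: "v - w \<in> carrier_vec (sum_list ms)" using v w by simp
  have "(v - w) \<bullet> (v - w) = (\<Sum>i<length ms. blk ms (v - w) i \<bullet> blk ms (v - w) i)"
    by (rule scalar_prod_blk[OF c c])
  also have "\<dots> = 0"
  proof (intro sum.neutral ballI)
    fix i assume "i \<in> {..<length ms}"
    then have "blk ms (v - w) i = 0\<^sub>v (ms ! i)"
      using assms(3)[of i] by (simp add: blk_minus[OF v w])
    then show "blk ms (v - w) i \<bullet> blk ms (v - w) i = 0" by simp
  qed
  finally have "v - w = 0\<^sub>v (sum_list ms)" by (rule scalar_self_eq_0[OF c])
  then have "(v - w) $ i = 0" if "i < sum_list ms" for i using that by simp
  then show ?thesis using v w by (intro eq_vecI) auto
qed

lemma qf_bdiag: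
  assumes "\<forall>i<length ms. A i \<in> carrier_mat (ms ! i) (ms ! i)"
    and "v \<in> carrier_vec (sum_list ms)"
  shows "qf (bdiag ms A) v = (\<Sum>i<length ms. qf (A i) (blk ms v i))"
proof -
  have "bdiag ms A *\<^sub>v v \<in> carrier_vec (sum_list ms)" using bdiag_carrier[OF assms(1)] assms(2) by auto
  from scalar_prod_blk[OF assms(2) this] show ?thesis
    by (simp add: qf_def blk_bdiag_mult[OF assms])
qed

lemma bdiag_pd:
  assumes "\<forall>i<length ms. A i \<in> carrier_mat (ms ! i) (ms ! i) \<and> pd_mat (A i)"
  shows "pd_mat (bdiag ms A)"
proof (rule pd_matI)
  have c: "\<forall>i<length ms. A i \<in> carrier_mat (ms ! i) (ms ! i)" using assms by blast
  show "bdiag ms A \<in> carrier_mat (sum_list ms) (sum_list ms)" by (rule bdiag_carrier[OF c])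
  show "transpose_mat (bdiag ms A) = bdiag ms A"
    using assms pd_matD(1) by (intro bdiag_transpose) blast
  fix v :: "real vec" assume v: "v \<in> carrier_vec (sum_list ms)" "v \<noteq> 0\<^sub>v (sum_list ms)"
  have "blk ms (0\<^sub>v (sum_list ms)) i = 0\<^sub>v (ms ! i)" if "i < length ms" for i
    using blk_index_less[OF that] by (intro eq_vecI) (auto simp: blk_def)
  then obtain i where i: "i < length ms" "blk ms v i \<noteq> 0\<^sub>v (ms ! i)"
    using eq_if_blk_eq[OF v(1) zero_carrier_vec] v(2) by metis
  have "0 < (\<Sum>i<length ms. qf (A i) (blk ms v i))"
  proof (rule sum_pos2[where i = i])
    show "0 < qf (A i) (blk ms v i)" using assms i by (intro pd_matD(2)) auto
    show "0 \<le> qf (A l) (blk ms v l)" if "l \<in> {..<length ms}" for l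
      using assms that by (intro pd_matD(3)[of "A l" "ms ! l"]) auto
  qed (use i in auto)
  then show "0 < qf (bdiag ms A) v" using qf_bdiag[OF c v(1)] by simp
qed

lemma bdiag_inverse:
  assumes A: "\<forall>i<length ms. A i \<in> carrier_mat (ms ! i) (ms ! i)"
    and B: "\<forall>i<length ms. B i \<in> carrier_mat (ms ! i) (ms ! i)"
    and AB: "\<forall>i<length ms. A i * B i = 1\<^sub>m (ms ! i)"
    and v: "v \<in> carrier_vec (sum_list ms)"
  shows "bdiag ms A *\<^sub>v (bdiag ms B *\<^sub>v v) = v"
proof (rule eq_if_blk_eq[of _ ms])
  have Bv: "bdiag ms B *\<^sub>v v \<in> carrier_vec (sum_list ms)" using bdiag_carrier[OF B] v by auto
  then show "bdiag ms A *\<^sub>v (bdiag ms B *\<^sub>v v) \<in> carrier_vec (sum_list ms)"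
    using bdiag_carrier[OF A] by auto
  fix i assume i: "i < length ms"
  show "blk ms (bdiag ms A *\<^sub>v (bdiag ms B *\<^sub>v v)) i = blk ms v i"
    unfolding blk_bdiag_mult[OF A Bv i] blk_bdiag_mult[OF B v i]
    using inverse_mult_vec[of "A i" "ms ! i" "B i" "blk ms v i"] A B AB i by simp
qed (rule v)

lemma Delta_eq_bdiag: "Delta ms \<delta> k = bdiag ms (\<lambda>i. \<delta> k i \<cdot>\<^sub>m 1\<^sub>m (ms ! i))"
  by (simp add: Delta_def bdiag_def)

lemma Delta_carrier [simp]: "Delta ms \<delta> k \<in> carrier_mat (sum_list ms) (sum_list ms)"
  unfolding Delta_eq_bdiag by (intro bdiag_carrier) auto

text \<open>The scalings commute with \<open>\<Delta>\<close> because they share its block structure.\<close>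
lemma Delta_contraction:
  assumes "admissible (length ms) \<delta>" "v \<in> carrier_vec (sum_list ms)"
    and A: "\<forall>i<length ms. A i \<in> carrier_mat (ms ! i) (ms ! i) \<and> pd_mat (A i)"
  shows "qf (bdiag ms A) (Delta ms \<delta> k *\<^sub>v v) \<le> qf (bdiag ms A) v"
proof -
  have c: "\<forall>i<length ms. A i \<in> carrier_mat (ms ! i) (ms ! i)" using A by blast
  have Dv: "Delta ms \<delta> k *\<^sub>v v \<in> carrier_vec (sum_list ms)" using assms(2) by (metis Delta_carrier mult_mat_vec_carrier)
  have "qf (A i) (blk ms (Delta ms \<delta> k *\<^sub>v v) i) \<le> qf (A i) (blk ms v i)" if i: "i < length ms" for i
  proof -
    have "blk ms (Delta ms \<delta> k *\<^sub>v v) i = (\<delta> k i \<cdot>\<^sub>m 1\<^sub>m (ms ! i)) *\<^sub>v blk ms v i"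
      unfolding Delta_eq_bdiag by (rule blk_bdiag_mult) (use assms i in auto)
    also have "\<dots> = \<delta> k i \<cdot>\<^sub>v blk ms v i"
      by (intro eq_vecI) (auto simp: blk_def)
    finally have "qf (A i) (blk ms (Delta ms \<delta> k *\<^sub>v v) i) = (\<delta> k i)\<^sup>2 * qf (A i) (blk ms v i)"
      using c i by (simp add: qf_smult[of _ "ms ! i"])
    moreover have "(\<delta> k i)\<^sup>2 \<le> 1" using assms(1) i by (simp add: admissible_def abs_square_le_1)
    ultimately show ?thesis
      using pd_matD(3)[of "A i" "ms ! i" "blk ms v i"] A i mult_right_mono[of "(\<delta> k i)\<^sup>2" 1] by fastforce
  qed
  then show ?thesis unfolding qf_bdiag[OF c Dv] qf_bdiag[OF c assms(2)] by (intro sum_mono) auto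
qed

section \<open>Matrices of two or three blocks, and the Schur complement\<close>

lemma diag2_mat:
  assumes "A \<in> carrier_mat n n" "B \<in> carrier_mat m m"
  shows "diag_block_mat [A, B] = four_block_mat A (0\<^sub>m n m) (0\<^sub>m m n) B"
  using assms diag_block_mat_append[of "[A]" "[B]"] unfolding append.simps diag_block_mat_singleton
  by (simp add: Let_def del: diag_block_mat.simps)

lemma diag2_carrier:
  assumes "A \<in> carrier_mat n n" "B \<in> carrier_mat m m"
  shows "diag_block_mat [A, B] \<in> carrier_mat (n + m) (n + m)"
  using assms unfolding diag2_mat[OF assms] by auto

lemma diag2_transpose:
  assumes "A \<in> carrier_mat n n" "B \<in> carrier_mat m m" "transpose_mat A = A" "transpose_mat B = B"
  shows "transpose_mat (diag_block_mat [A, B]) = diag_block_mat [A, B]"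
  unfolding diag2_mat[OF assms(1,2)]
  using transpose_four_block_mat[OF assms(1) zero_carrier_mat zero_carrier_mat assms(2)] assms by simp

lemma diag2_mult_vec:
  assumes "A \<in> carrier_mat n n" "B \<in> carrier_mat m m" "a \<in> carrier_vec n" "b \<in> carrier_vec m"
  shows "diag_block_mat [A, B] *\<^sub>v (a @\<^sub>v b) = (A *\<^sub>v a) @\<^sub>v (B *\<^sub>v b)"
  unfolding diag2_mat[OF assms(1,2)] by (rule mult_mat_vec_split[OF assms])

lemma qf_diag2:
  assumes "A \<in> carrier_mat n n" "B \<in> carrier_mat m m" "a \<in> carrier_vec n" "b \<in> carrier_vec m"
  shows "qf (diag_block_mat [A, B]) (a @\<^sub>v b) = qf A a + qf B b"
  unfolding qf_def diag2_mult_vec[OF assms] using assms by (intro scalar_prod_append) auto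

text \<open>Nesting to the left agrees with the bracketing of the stacked vectors and with the
  layout of \<open>block3\<close>, so the facts on three blocks follow from those on two.\<close>

lemma diag3_mat:
  "diag_block_mat [A, B, C] = diag_block_mat [diag_block_mat [A, B], C]"
  using diag_block_mat_append[of "[A, B]" "[C]"] diag_block_mat_append[of "[diag_block_mat [A, B]]" "[C]"]
  unfolding append.simps diag_block_mat_singleton by (simp add: Let_def del: diag_block_mat.simps)

lemma diag3_carrier:
  assumes "A \<in> carrier_mat n n" "B \<in> carrier_mat m m" "C \<in> carrier_mat l l"
  shows "diag_block_mat [A, B, C] \<in> carrier_mat (n + m + l) (n + m + l)"
  unfolding diag3_mat by (intro diag2_carrier assms)

lemma diag3_transpose:
  assumes "A \<in> carrier_mat n n" "B \<in> carrier_mat m m" "C \<in> carrier_mat l l"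
    "transpose_mat A = A" "transpose_mat B = B" "transpose_mat C = C"
  shows "transpose_mat (diag_block_mat [A, B, C]) = diag_block_mat [A, B, C]"
  unfolding diag3_mat
  by (rule diag2_transpose[OF diag2_carrier[OF assms(1,2)] assms(3) diag2_transpose[OF assms(1,2,4,5)] assms(6)])

lemma diag3_mult_vec:
  assumes "A \<in> carrier_mat n n" "B \<in> carrier_mat m m" "C \<in> carrier_mat l l"
    "a \<in> carrier_vec n" "b \<in> carrier_vec m" "c \<in> carrier_vec l"
  shows "diag_block_mat [A, B, C] *\<^sub>v ((a @\<^sub>v b) @\<^sub>v c) = ((A *\<^sub>v a) @\<^sub>v (B *\<^sub>v b)) @\<^sub>v (C *\<^sub>v c)"
  unfolding diag3_mat
  using diag2_mult_vec[OF diag2_carrier[OF assms(1,2)] assms(3) append_carrier_vec[OF assms(4,5)] assms(6)]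
    diag2_mult_vec[OF assms(1,2,4,5)] by simp

lemma qf_diag3:
  assumes "A \<in> carrier_mat n n" "B \<in> carrier_mat m m" "C \<in> carrier_mat l l"
    "a \<in> carrier_vec n" "b \<in> carrier_vec m" "c \<in> carrier_vec l"
  shows "qf (diag_block_mat [A, B, C]) ((a @\<^sub>v b) @\<^sub>v c) = qf A a + qf B b + qf C c"
  unfolding diag3_mat
  using qf_diag2[OF diag2_carrier[OF assms(1,2)] assms(3) append_carrier_vec[OF assms(4,5)] assms(6)]
    qf_diag2[OF assms(1,2,4,5)] by simp

lemma block3_carrier:
  assumes "A \<in> carrier_mat r1 c1" "B \<in> carrier_mat r1 c2" "C \<in> carrier_mat r1 c3"
    "D \<in> carrier_mat r2 c1" "E \<in> carrier_mat r2 c2" "F \<in> carrier_mat r2 c3"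
    "G \<in> carrier_mat r3 c1" "H \<in> carrier_mat r3 c2" "I \<in> carrier_mat r3 c3"
  shows "block3 A B C D E F G H I \<in> carrier_mat (r1 + r2 + r3) (c1 + c2 + c3)"
  unfolding block3_def using assms by auto

lemma block3_mult_vec:
  assumes "A \<in> carrier_mat r1 c1" "B \<in> carrier_mat r1 c2" "C \<in> carrier_mat r1 c3"
    "D \<in> carrier_mat r2 c1" "E \<in> carrier_mat r2 c2" "F \<in> carrier_mat r2 c3"
    "G \<in> carrier_mat r3 c1" "H \<in> carrier_mat r3 c2" "I \<in> carrier_mat r3 c3"
    "x \<in> carrier_vec c1" "y \<in> carrier_vec c2" "z \<in> carrier_vec c3"
  shows "block3 A B C D E F G H I *\<^sub>v ((x @\<^sub>v y) @\<^sub>v z) =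
    ((A *\<^sub>v x + B *\<^sub>v y + C *\<^sub>v z) @\<^sub>v (D *\<^sub>v x + E *\<^sub>v y + F *\<^sub>v z)) @\<^sub>v (G *\<^sub>v x + H *\<^sub>v y + I *\<^sub>v z)"
proof -
  have 1: "four_block_mat A B D E \<in> carrier_mat (r1 + r2) (c1 + c2)" using assms by auto
  have "block3 A B C D E F G H I *\<^sub>v ((x @\<^sub>v y) @\<^sub>v z) =
    (four_block_mat A B D E *\<^sub>v (x @\<^sub>v y) + vcat C F *\<^sub>v z) @\<^sub>v (hcat G H *\<^sub>v (x @\<^sub>v y) + I *\<^sub>v z)"
    unfolding block3_def
    by (rule four_block_mat_mult_vec[OF 1 vcat_carrier[OF assms(3,6)] hcat_carrier[OF assms(7,8)] assms(9)])
      (use assms in auto)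
  also have "four_block_mat A B D E *\<^sub>v (x @\<^sub>v y) = (A *\<^sub>v x + B *\<^sub>v y) @\<^sub>v (D *\<^sub>v x + E *\<^sub>v y)"
    by (rule four_block_mat_mult_vec[OF assms(1,2,4,5,10,11)])
  also have "vcat C F *\<^sub>v z = (C *\<^sub>v z) @\<^sub>v (F *\<^sub>v z)" by (rule vcat_mult_vec[OF assms(3,6,12)])
  also have "((A *\<^sub>v x + B *\<^sub>v y) @\<^sub>v (D *\<^sub>v x + E *\<^sub>v y)) + ((C *\<^sub>v z) @\<^sub>v (F *\<^sub>v z))
      = (A *\<^sub>v x + B *\<^sub>v y + C *\<^sub>v z) @\<^sub>v (D *\<^sub>v x + E *\<^sub>v y + F *\<^sub>v z)"
    by (rule append_vec_add[of _ r1 _ _ r2]) (use assms in auto)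
  also have "hcat G H *\<^sub>v (x @\<^sub>v y) = G *\<^sub>v x + H *\<^sub>v y" by (rule hcat_mult_vec[OF assms(7,8,10,11)])
  finally show ?thesis .
qed

lemma append_vec_neq_zero:
  assumes "x \<in> carrier_vec n" "y \<in> carrier_vec m"
  shows "x @\<^sub>v y \<noteq> 0\<^sub>v (n + m) \<longleftrightarrow> x \<noteq> 0\<^sub>v n \<or> y \<noteq> (0\<^sub>v m :: real vec)"
proof -
  have "0\<^sub>v (n + m) = 0\<^sub>v n @\<^sub>v (0\<^sub>v m :: real vec)" by (intro eq_vecI) auto
  then show ?thesis using append_vec_eq[OF assms(1) zero_carrier_vec, of y "0\<^sub>v m"] by simp
qed

text \<open>Testing the block matrix with \<open>(x, - Y C x)\<close>, \<open>Y = D\<^sup>-\<^sup>1\<close>, yields its Schur complement.\<close>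
lemma schur_test:
  assumes A: "A \<in> carrier_mat n n" and C: "C \<in> carrier_mat m n" and D: "D \<in> carrier_mat m m"
    and Y: "Y \<in> carrier_mat m m" "D * Y = 1\<^sub>m m" and x: "x \<in> carrier_vec n"
  shows "qf (four_block_mat A (transpose_mat C) C D) (x @\<^sub>v - (Y *\<^sub>v (C *\<^sub>v x))) = qf A x - qf Y (C *\<^sub>v x)"
proof -
  define c where "c = C *\<^sub>v x"
  define y where "y = Y *\<^sub>v c"
  have c: "c \<in> carrier_vec m" and y: "y \<in> carrier_vec m" using C Y x by (auto simp: c_def y_def)
  have Dy: "D *\<^sub>v y = c" unfolding y_def by (rule inverse_mult_vec[OF D Y c])
  have Dmy: "D *\<^sub>v (- y) = - c" unfolding Dy[symmetric] using D y by (intro eq_vecI) auto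
  have Ct: "transpose_mat C \<in> carrier_mat n m" using C by simp
  have Ctm: "transpose_mat C *\<^sub>v (- y) = - (transpose_mat C *\<^sub>v y)" using Ct y by (intro eq_vecI) auto
  have Cty: "x \<bullet> (transpose_mat C *\<^sub>v y) = c \<bullet> y"
    using transpose_vec_mult_scalar[OF Ct y x] by (simp add: c_def)
  have my: "- y \<in> carrier_vec m" using y by simp
  have "four_block_mat A (transpose_mat C) C D *\<^sub>v (x @\<^sub>v - y) = (A *\<^sub>v x - transpose_mat C *\<^sub>v y) @\<^sub>v (c - c)"
    using four_block_mat_mult_vec[OF A Ct C D x my] Dmy Ctm c A Ct x y
    by (simp add: c_def[symmetric] minus_add_uminus_vec[of _ m] minus_add_uminus_vec[of _ n])
  then have "qf (four_block_mat A (transpose_mat C) C D) (x @\<^sub>v - y)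
      = x \<bullet> (A *\<^sub>v x - transpose_mat C *\<^sub>v y) + (- y) \<bullet> (c - c)"
    unfolding qf_def using A Ct x y c by (simp add: scalar_prod_append[of _ n _ m])
  also have "\<dots> = qf A x - c \<bullet> y"
    using A Ct x y c Cty by (simp add: scalar_prod_minus_distrib[of _ n] qf_def)
  finally show ?thesis by (simp add: c_def y_def qf_def)
qed

section \<open>Synthesis of the gains at one time instant\<close>

text \<open>The weight \<open>\<tau>\<close> from Finsler's lemma replaces the constraint \<open>B\<^sup>T l = 0\<close> by a penalty; its dual is
  the penalty \<open>u \<bullet> u / \<tau>\<close>, which makes the minimisation over \<open>u\<close> strictly convex even if \<open>B\<close> is
  not injective.\<close>
lemma dual_control:
  assumes H: "H \<in> carrier_mat p s" and B: "B \<in> carrier_mat p n"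
    and Ro: "Ro \<in> carrier_mat p p" and Ri: "Ri \<in> carrier_mat s s"
    and Po: "Po \<in> carrier_mat p p" "transpose_mat Po = Po"
    and Po_nonneg: "\<And>v. v \<in> carrier_vec p \<Longrightarrow> 0 \<le> qf Po v"
    and RoPo: "\<And>v. v \<in> carrier_vec p \<Longrightarrow> Ro *\<^sub>v (Po *\<^sub>v v) = v"
    and fenchel: "\<And>a x. a \<in> carrier_vec s \<Longrightarrow> x \<in> carrier_vec s \<Longrightarrow> 2 * (a \<bullet> x) \<le> qf Ri a + qf Xi x"
    and neg: "\<And>l. l \<in> carrier_vec p \<Longrightarrow> l \<noteq> 0\<^sub>v p \<Longrightarrow> transpose_mat B *\<^sub>v l = 0\<^sub>v n \<Longrightarrow>
      qf Ri (transpose_mat H *\<^sub>v l) < qf Ro l"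
  obtains \<tau> \<kappa> where "\<tau> > 0" "0 < \<kappa>" "\<kappa> < 1"
    "\<forall>x \<in> carrier_vec s. \<exists>u \<in> carrier_vec n. qf Po (H *\<^sub>v x + B *\<^sub>v u) + (u \<bullet> u) / \<tau> \<le> \<kappa> * qf Xi x"
proof -
  let ?Ht = "transpose_mat H" and ?Bt = "transpose_mat B"
  have Ht: "?Ht \<in> carrier_mat s p" and Bt: "?Bt \<in> carrier_mat n p" using H B by auto
  define HH where "HH = transpose_mat ?Ht * Ri * ?Ht"
  define BB where "BB = transpose_mat ?Bt * 1\<^sub>m n * ?Bt"
  have HH: "HH \<in> carrier_mat p p" and BB: "BB \<in> carrier_mat p p"
    using H B Ri by (auto simp: HH_def BB_def)
  have qHH: "qf HH l = qf Ri (?Ht *\<^sub>v l)" if "l \<in> carrier_vec p" for l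
    unfolding HH_def by (rule qf_congruence[OF Ri Ht that])
  have qBB: "qf BB l = (?Bt *\<^sub>v l) \<bullet> (?Bt *\<^sub>v l)" if "l \<in> carrier_vec p" for l
  proof -
    have "?Bt *\<^sub>v l \<in> carrier_vec n" using Bt that by auto
    then show ?thesis unfolding BB_def using qf_congruence[OF one_carrier_mat Bt that] by (simp add: qf_one)
  qed
  have D: "Ro - HH \<in> carrier_mat p p" using HH by (simp add: minus_carrier_mat)
  obtain \<tau> where \<tau>: "\<tau> > 0" "\<forall>v \<in> carrier_vec p. v \<noteq> 0\<^sub>v p \<longrightarrow> 0 < qf (Ro - HH) v + \<tau> * qf BB v"
  proof (rule finsler[OF D BB])
    show "0 \<le> qf BB v" if "v \<in> carrier_vec p" for v
      by (simp add: qBB[OF that] scalar_self_nonneg)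
    fix v :: "real vec" assume v: "v \<in> carrier_vec p" "v \<noteq> 0\<^sub>v p" "qf BB v = 0"
    have "?Bt *\<^sub>v v \<in> carrier_vec n" using Bt v by auto
    then have "?Bt *\<^sub>v v = 0\<^sub>v n" using scalar_self_eq_0 qBB[OF v(1)] v(3) by simp
    from neg[OF v(1,2) this] show "0 < qf (Ro - HH) v"
      using qHH[OF v(1)] qf_mat_minus[OF Ro HH v(1)] by simp
  qed
  define E where "E = Ro - HH + \<tau> \<cdot>\<^sub>m BB"
  have E: "E \<in> carrier_mat p p" using D BB by (simp add: E_def)
  have tBB: "\<tau> \<cdot>\<^sub>m BB \<in> carrier_mat p p" using BB by simp
  have qE: "qf E v = qf Ro v - qf HH v + \<tau> * qf BB v" if "v \<in> carrier_vec p" for v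
    unfolding E_def qf_mat_add[OF D tBB that] qf_mat_smult[OF BB that] qf_mat_minus[OF Ro HH that] by simp
  have Epos: "0 < qf E v" if "v \<in> carrier_vec p" "v \<noteq> 0\<^sub>v p" for v
    using bspec[OF \<tau>(2) that(1)] that(2) qE[OF that(1)] qf_mat_minus[OF Ro HH that(1)] by simp
  obtain \<sigma> where \<sigma>: "\<sigma> > 0" "\<forall>v \<in> carrier_vec p. qf HH v \<le> \<sigma> * qf E v"
    and "\<forall>v \<in> carrier_vec p. v \<noteq> 0\<^sub>v p \<longrightarrow> qf HH v < \<sigma> * qf E v"
    by (rule pd_form_dominates[OF E HH Epos])
  \<comment> \<open>\<open>HH \<le> \<sigma> E\<close> with \<open>E = Ro - HH + \<tau> BB\<close>
    rearranges to \<open>(\<sigma> + 1) HH \<le> \<sigma> (Ro + \<tau> BB)\<close>. The quotient is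
    below 1 and becomes the decay factor of the step.\<close>
  define \<kappa> where "\<kappa> = \<sigma> / (\<sigma> + 1)"
  have \<kappa>: "0 < \<kappa>" "\<kappa> < 1" using \<sigma>(1) by (auto simp: \<kappa>_def)
  have slack: "qf HH v \<le> \<kappa> * (qf Ro v + \<tau> * qf BB v)" if "v \<in> carrier_vec p" for v
  proof -
    have "qf HH v \<le> \<sigma> * (qf Ro v - qf HH v + \<tau> * qf BB v)"
      using \<sigma>(2) qE[OF that] that by auto
    then have "(\<sigma> + 1) * qf HH v \<le> \<sigma> * (qf Ro v + \<tau> * qf BB v)" by (simp add: algebra_simps)
    then show ?thesis using \<sigma>(1) by (simp add: \<kappa>_def field_simps)
  qed
  \<comment> \<open>The part of \<open>qf Po (h + B u) + (u \<bullet> u) / \<tau>\<close> that is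
    quadratic in \<open>u\<close>. The penalty makes it definite, so the equation for the minimiser,
    \<open>Q u = - g\<close>, can be solved.\<close>
  define Q where "Q = ?Bt * Po * B + (1 / \<tau>) \<cdot>\<^sub>m 1\<^sub>m n"
  have BPB: "?Bt * Po * B \<in> carrier_mat n n" and tI: "(1 / \<tau>) \<cdot>\<^sub>m 1\<^sub>m n \<in> carrier_mat n n" using B Bt Po by auto
  have Q: "Q \<in> carrier_mat n n" using BPB tI by (simp add: Q_def)
  have qQ: "qf Q u = qf Po (B *\<^sub>v u) + (u \<bullet> u) / \<tau>" if "u \<in> carrier_vec n" for u
    unfolding Q_def qf_mat_add[OF BPB tI that] qf_congruence[OF Po(1) B that] qf_smult_one[OF that] by simp
  have Qinj: "u = 0\<^sub>v n" if u: "u \<in> carrier_vec n" and Qu: "Q *\<^sub>v u = 0\<^sub>v n" for u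
  proof (rule scalar_self_eq_0[OF u])
    have "qf Q u = 0" using Qu u by (simp add: qf_def)
    moreover have "0 \<le> qf Po (B *\<^sub>v u)" using B u by (intro Po_nonneg) auto
    ultimately have "(u \<bullet> u) / \<tau> \<le> 0" using qQ[OF u] by simp
    then show "u \<bullet> u = 0" using \<tau>(1) scalar_self_nonneg[of u] by (simp add: divide_le_0_iff)
  qed
  obtain Qi where Qi: "Qi \<in> carrier_mat n n" "Q * Qi = 1\<^sub>m n"
    using inverse_exists_if_injective[OF Q Qinj] by blast
  have "\<exists>u \<in> carrier_vec n. qf Po (H *\<^sub>v x + B *\<^sub>v u) + (u \<bullet> u) / \<tau> \<le> \<kappa> * qf Xi x"
    if x: "x \<in> carrier_vec s" for x
  proof -
    define h where "h = H *\<^sub>v x"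
    define g where "g = ?Bt *\<^sub>v (Po *\<^sub>v h)"
    have h: "h \<in> carrier_vec p" and g: "g \<in> carrier_vec n" using H x Bt Po by (auto simp: h_def g_def)
    define u where "u = - (Qi *\<^sub>v g)"
    have u: "u \<in> carrier_vec n" using Qi g by (simp add: u_def)
    have Bu: "B *\<^sub>v u \<in> carrier_vec p" using B u by auto
    define y where "y = h + B *\<^sub>v u"
    \<comment> \<open>The dual variable of the minimisation. Stationarity in \<open>u\<close> reads
      \<open>?Bt l = - u / \<tau>\<close>, hence \<open>qf Ro l + \<tau> * qf BB l\<close> is
      exactly the optimal value, and so is \<open>l \<bullet> h\<close>.\<close>
    define l where "l = Po *\<^sub>v y"
    have y: "y \<in> carrier_vec p" and l: "l \<in> carrier_vec p" using h Bu Po by (auto simp: y_def l_def)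
    have "Q *\<^sub>v u = - (Q *\<^sub>v (Qi *\<^sub>v g))" unfolding u_def using Q Qi g by (intro eq_vecI) auto
    then have Qu: "Q *\<^sub>v u = - g" using inverse_mult_vec[OF Q Qi g] by simp
    have "Q *\<^sub>v u = ?Bt *\<^sub>v (Po *\<^sub>v (B *\<^sub>v u)) + (1 / \<tau>) \<cdot>\<^sub>v u"
    proof -
      have "?Bt * Po * B *\<^sub>v u = ?Bt *\<^sub>v (Po *\<^sub>v (B *\<^sub>v u))"
        using assoc_mult_mat_vec[OF mult_carrier_mat[OF Bt Po(1)] B u] assoc_mult_mat_vec[OF Bt Po(1) Bu] by simp
      moreover have "((1 / \<tau>) \<cdot>\<^sub>m 1\<^sub>m n) *\<^sub>v u = (1 / \<tau>) \<cdot>\<^sub>v u" using u by (intro eq_vecI) auto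
      ultimately show ?thesis unfolding Q_def add_mult_distrib_mat_vec[OF BPB tI u] by simp
    qed
    then have *: "?Bt *\<^sub>v (Po *\<^sub>v (B *\<^sub>v u)) + (1 / \<tau>) \<cdot>\<^sub>v u = - g" using Qu by simp
    have c1: "?Bt *\<^sub>v (Po *\<^sub>v (B *\<^sub>v u)) \<in> carrier_vec n" using Bt Po Bu by auto
    have "?Bt *\<^sub>v l = g + ?Bt *\<^sub>v (Po *\<^sub>v (B *\<^sub>v u))"
      unfolding l_def y_def g_def mult_add_distrib_mat_vec[OF Po(1) h Bu]
      using Po h Bu by (intro mult_add_distrib_mat_vec[OF Bt]) auto
    also have "\<dots> = - ((1 / \<tau>) \<cdot>\<^sub>v u)"
    proof (rule eq_vecI)
      fix i assume "i < dim_vec (- ((1 / \<tau>) \<cdot>\<^sub>v u))"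
      then have i: "i < n" using u by simp
      have "(?Bt *\<^sub>v (Po *\<^sub>v (B *\<^sub>v u)) + (1 / \<tau>) \<cdot>\<^sub>v u) $ i = (- g) $ i" using * by simp
      then have "(?Bt *\<^sub>v (Po *\<^sub>v (B *\<^sub>v u))) $ i + ((1 / \<tau>) \<cdot>\<^sub>v u) $ i = - (g $ i)"
        using i u g c1 by simp
      then show "(g + ?Bt *\<^sub>v (Po *\<^sub>v (B *\<^sub>v u))) $ i = (- ((1 / \<tau>) \<cdot>\<^sub>v u)) $ i"
        using i u g carrier_matD[OF B] by simp
    qed (use u B in auto)
    finally have Btl: "?Bt *\<^sub>v l = - ((1 / \<tau>) \<cdot>\<^sub>v u)" .
    define val where "val = qf Po y + (u \<bullet> u) / \<tau>"
    define a where "a = ?Ht *\<^sub>v l"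
    have a: "a \<in> carrier_vec s" using Ht l by (auto simp: a_def)
    have lBu: "l \<bullet> (B *\<^sub>v u) = - ((u \<bullet> u) / \<tau>)"
      using transpose_vec_mult_scalar[OF B u l] Btl u by simp
    have "qf Po y = l \<bullet> h + l \<bullet> (B *\<^sub>v u)"
      unfolding qf_def l_def[symmetric] using comm_scalar_prod[OF y l]
      scalar_prod_add_distrib[OF l h Bu] by (simp add: y_def)
    then have "val = l \<bullet> h" using lBu by (simp add: val_def)
    also have "\<dots> = a \<bullet> x" using transpose_vec_mult_scalar[OF H x l] by (simp add: a_def h_def)
    finally have val_a: "val = a \<bullet> x" .
    have "qf Ro l = qf Po y"
      using RoPo[OF y] comm_scalar_prod[OF l y] by (simp add: qf_def l_def)
    moreover have "qf BB l = (1 / \<tau>) * ((1 / \<tau>) * (u \<bullet> u))" unfolding qBB[OF l] Btl using u by simp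
    ultimately have "qf Ri a \<le> \<kappa> * val"
      using slack[OF l] qHH[OF l] \<tau>(1) by (simp add: val_def a_def)
    \<comment> \<open>Fenchel's inequality is applied to \<open>a / \<kappa>\<close> instead of
      \<open>a\<close>: together with \<open>qf Ri a \<le> \<kappa> * val\<close> and
      \<open>a \<bullet> x = val\<close> it becomes
      \<open>2 * val / \<kappa> \<le> val / \<kappa> + qf Xi x\<close>, which keeps the factor
      \<open>\<kappa>\<close>.\<close>
    then have "(1 / \<kappa>)\<^sup>2 * qf Ri a \<le> (1 / \<kappa>)\<^sup>2 * (\<kappa> * val)" by (intro mult_left_mono) auto
    moreover have "2 * (((1 / \<kappa>) \<cdot>\<^sub>v a) \<bullet> x) \<le> qf Ri ((1 / \<kappa>) \<cdot>\<^sub>v a) + qf Xi x"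
      by (rule fenchel) (use a x in auto)
    then have "2 / \<kappa> * val \<le> (1 / \<kappa>)\<^sup>2 * qf Ri a + qf Xi x"
      using a x by (simp add: val_a qf_smult[OF Ri a])
    ultimately have "2 / \<kappa> * val \<le> (1 / \<kappa>)\<^sup>2 * (\<kappa> * val) + qf Xi x" by linarith
    then have "val \<le> \<kappa> * qf Xi x" using \<kappa> by (simp add: field_simps power2_eq_square)
    then show ?thesis using u by (auto simp: val_def y_def h_def)
  qed
  then show ?thesis by (intro that[OF \<tau>(1) \<kappa>]) blast
qed

section \<open>The plant with state measurement, and the game at one time instant\<close>

locale lft_plant =
  fixes G :: lpv_plant and N nd ne nu :: nat and ms :: "nat list"
  assumes dims: "plant_dims G N ms nd ne nu N"
begin

abbreviation m where "m \<equiv> sum_list ms"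

lemma plant_carrier [simp]:
  "Ass G \<in> carrier_mat N N" "Asp G \<in> carrier_mat N m" "B1s G \<in> carrier_mat N nd" "B2s G \<in> carrier_mat N nu"
  "Aps G \<in> carrier_mat m N" "App G \<in> carrier_mat m m" "B1p G \<in> carrier_mat m nd" "B2p G \<in> carrier_mat m nu"
  "C1s G \<in> carrier_mat ne N" "C1p G \<in> carrier_mat ne m" "D11 G \<in> carrier_mat ne nd" "D12 G \<in> carrier_mat ne nu"
  using dims by (auto simp: plant_dims_def Let_def)

lemma plant_dim [simp]:
  "dim_row (Ass G) = N" "dim_row (Asp G) = N" "dim_row (B1s G) = N" "dim_row (B2s G) = N"
  "dim_row (Aps G) = m" "dim_row (App G) = m" "dim_row (B1p G) = m" "dim_row (B2p G) = m"
  "dim_row (C1s G) = ne" "dim_row (C1p G) = ne" "dim_row (D11 G) = ne" "dim_row (D12 G) = ne"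
  "dim_col (B1s G) = nd" "dim_col (B2s G) = nu"
  using plant_carrier unfolding carrier_mat_def by blast+

lemmas plant_zero [simp] = plant_carrier [THEN mult_mat_vec_zero]

text \<open>The plant with its scheduling loop cut open: \<open>th\<close> is a free argument, which
  allows it to be treated as a move of the opponent. The loop is closed again through
  \<open>Delta\<close> later.\<close>

definition zout where "zout z th d u = Ass G *\<^sub>v z + Asp G *\<^sub>v th + B1s G *\<^sub>v d + B2s G *\<^sub>v u"
definition pout where "pout z th d u = Aps G *\<^sub>v z + App G *\<^sub>v th + B1p G *\<^sub>v d + B2p G *\<^sub>v u"
definition eout where "eout z th d u = C1s G *\<^sub>v z + C1p G *\<^sub>v th + D11 G *\<^sub>v d + D12 G *\<^sub>v u"

lemma out_carrier [simp]:
  "zout z th d u \<in> carrier_vec N" "pout z th d u \<in> carrier_vec m" "eout z th d u \<in> carrier_vec ne"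
  by (rule carrier_vecI, simp add: zout_def pout_def eout_def)+

lemma stacked_carrier:
  "u \<in> carrier_vec nu \<Longrightarrow> ps \<in> carrier_vec m \<Longrightarrow> u @\<^sub>v ps \<in> carrier_vec (nu + m)"
  "th \<in> carrier_vec m \<Longrightarrow> d \<in> carrier_vec nd \<Longrightarrow> th @\<^sub>v d \<in> carrier_vec (m + nd)"
  by auto

text \<open>An instance of the saddle-point policy with data \<open>(z, et)\<close>, controller
  moves \<open>(u, ps)\<close> and opponent moves \<open>(th, d)\<close>. Hypothesis
  \<open>open_loop\<close> is strict concavity for the opponent; \<open>full_info\<close> provides a
  winning answer once \<open>ps\<close> is chosen equal to \<open>pout\<close>, which removes the
  \<open>M\<close>-term of the outputs.\<close>

lemma estimating_policy:
  assumes X: "X \<in> carrier_mat N N" "transpose_mat X = X"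
    and X': "X' \<in> carrier_mat N N" "pd_mat X'"
    and T: "T \<in> carrier_mat m m" "pd_mat T"
    and M: "M \<in> carrier_mat m m" "pd_mat M"
    and pos: "\<beta> > 0" "\<tau> > 0"
    and open_loop: "\<And>th d. th \<in> carrier_vec m \<Longrightarrow> d \<in> carrier_vec nd \<Longrightarrow> th \<noteq> 0\<^sub>v m \<or> d \<noteq> 0\<^sub>v nd \<Longrightarrow>
      qf X' (zout (0\<^sub>v N) th d (0\<^sub>v nu)) + qf T (pout (0\<^sub>v N) th d (0\<^sub>v nu)) + qf M (pout (0\<^sub>v N) th d (0\<^sub>v nu))
        + \<beta> * (eout (0\<^sub>v N) th d (0\<^sub>v nu) \<bullet> eout (0\<^sub>v N) th d (0\<^sub>v nu)) < qf T th + qf M th + f * (d \<bullet> d)"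
    and full_info: "\<And>z th d. z \<in> carrier_vec N \<Longrightarrow> th \<in> carrier_vec m \<Longrightarrow> d \<in> carrier_vec nd \<Longrightarrow>
      z \<noteq> 0\<^sub>v N \<or> th \<noteq> 0\<^sub>v m \<or> d \<noteq> 0\<^sub>v nd \<Longrightarrow> \<exists>u \<in> carrier_vec nu.
        qf X' (zout z th d u) + qf T (pout z th d u) + \<beta> * (eout z th d u \<bullet> eout z th d u) + (u \<bullet> u) / \<tau>
          < qf X z + qf T th + f * (d \<bullet> d)"
  obtains Ac Bc Cc Dd where "Ac \<in> carrier_mat m m" "Bc \<in> carrier_mat m N"
    "Cc \<in> carrier_mat nu m" "Dd \<in> carrier_mat nu N"
    "\<forall>z \<in> carrier_vec N. \<forall>et \<in> carrier_vec m. \<forall>th \<in> carrier_vec m. \<forall>d \<in> carrier_vec nd.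
      (z \<noteq> 0\<^sub>v N \<or> et \<noteq> 0\<^sub>v m \<or> th \<noteq> 0\<^sub>v m \<or> d \<noteq> 0\<^sub>v nd) \<longrightarrow>
      qf X' (zout z th d (Cc *\<^sub>v et + Dd *\<^sub>v z)) + qf T (pout z th d (Cc *\<^sub>v et + Dd *\<^sub>v z))
        + qf M (pout z th d (Cc *\<^sub>v et + Dd *\<^sub>v z) - (Ac *\<^sub>v et + Bc *\<^sub>v z))
        + \<beta> * (eout z th d (Cc *\<^sub>v et + Dd *\<^sub>v z) \<bullet> eout z th d (Cc *\<^sub>v et + Dd *\<^sub>v z))
        < qf X z + qf T th + qf M (th - et) + f * (d \<bullet> d)"
proof -
  note sX' = pd_matD(1)[OF X'(2,1)] and sT = pd_matD(1)[OF T(2,1)] and sM = pd_matD(1)[OF M(2,1)]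
  have sI: "transpose_mat (c \<cdot>\<^sub>m 1\<^sub>m n) = c \<cdot>\<^sub>m (1\<^sub>m n :: real mat)" for c n by (intro eq_matI) auto
  \<comment> \<open>The payoff, left side minus right side plus the penalty, with every term a
    \<open>qf\<close> of a linear image of the stacked vectors. In this form the rules for
    \<open>quad2\<close> apply; \<open>q_eq\<close> translates back.\<close>
  define q where "q x y =
      qf X' (hcat (Ass G) (0\<^sub>m N m) *\<^sub>v x + hcat (hcat (B2s G) (0\<^sub>m N m)) (hcat (Asp G) (B1s G)) *\<^sub>v y)
    + qf T (hcat (Aps G) (0\<^sub>m m m) *\<^sub>v x + hcat (hcat (B2p G) (0\<^sub>m m m)) (hcat (App G) (B1p G)) *\<^sub>v y)
    + qf M (hcat (Aps G) (0\<^sub>m m m) *\<^sub>v x + hcat (hcat (B2p G) (- 1\<^sub>m m)) (hcat (App G) (B1p G)) *\<^sub>v y)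
    + qf (\<beta> \<cdot>\<^sub>m 1\<^sub>m ne) (hcat (C1s G) (0\<^sub>m ne m) *\<^sub>v x + hcat (hcat (D12 G) (0\<^sub>m ne m)) (hcat (C1p G) (D11 G)) *\<^sub>v y)
    + qf ((1 / \<tau>) \<cdot>\<^sub>m 1\<^sub>m nu) (0\<^sub>m nu (N + m) *\<^sub>v x + hcat (hcat (1\<^sub>m nu) (0\<^sub>m nu m)) (0\<^sub>m nu (m + nd)) *\<^sub>v y)
    - qf X (hcat (1\<^sub>m N) (0\<^sub>m N m) *\<^sub>v x + 0\<^sub>m N (nu + m + (m + nd)) *\<^sub>v y)
    - qf T (0\<^sub>m m (N + m) *\<^sub>v x + hcat (0\<^sub>m m (nu + m)) (hcat (1\<^sub>m m) (0\<^sub>m m nd)) *\<^sub>v y)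
    - qf M (hcat (0\<^sub>m m N) (- 1\<^sub>m m) *\<^sub>v x + hcat (0\<^sub>m m (nu + m)) (hcat (1\<^sub>m m) (0\<^sub>m m nd)) *\<^sub>v y)
    - qf (f \<cdot>\<^sub>m 1\<^sub>m nd) (0\<^sub>m nd (N + m) *\<^sub>v x + hcat (0\<^sub>m nd (nu + m)) (hcat (0\<^sub>m nd m) (1\<^sub>m nd)) *\<^sub>v y)" for x y
  have quad: "quad2 (N + m) (nu + m + (m + nd)) q"
    unfolding q_def
    by (intro quad2_add quad2_diff quad2_qf) (use X X' T M sX' sT sM sI in auto)
  have q_eq: "q (z @\<^sub>v et) ((u @\<^sub>v ps) @\<^sub>v (th @\<^sub>v d)) =
      qf X' (zout z th d u) + qf T (pout z th d u) + qf M (pout z th d u - ps)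
      + \<beta> * (eout z th d u \<bullet> eout z th d u) + (u \<bullet> u) / \<tau>
      - qf X z - qf T th - qf M (th - et) - f * (d \<bullet> d)"
    if c: "z \<in> carrier_vec N" "et \<in> carrier_vec m" "u \<in> carrier_vec nu" "ps \<in> carrier_vec m"
      "th \<in> carrier_vec m" "d \<in> carrier_vec nd" for z et u ps th d
  proof -
    note st = stacked_carrier(1)[OF c(3,4)] stacked_carrier(2)[OF c(5,6)]
    have x: "z @\<^sub>v et \<in> carrier_vec (N + m)" using c by simp
    have y: "(u @\<^sub>v ps) @\<^sub>v (th @\<^sub>v d) \<in> carrier_vec (nu + m + (m + nd))" using st by simp
    have h4: "hcat (hcat P1 P2) (hcat P3 P4) *\<^sub>v ((u @\<^sub>v ps) @\<^sub>v (th @\<^sub>v d))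
        = (P1 *\<^sub>v u + P2 *\<^sub>v ps) + (P3 *\<^sub>v th + P4 *\<^sub>v d)"
      if "P1 \<in> carrier_mat r nu" "P2 \<in> carrier_mat r m" "P3 \<in> carrier_mat r m" "P4 \<in> carrier_mat r nd" for P1 P2 P3 P4 r
      using hcat_mult_vec[OF hcat_carrier[OF that(1,2)] hcat_carrier[OF that(3,4)] st]
        hcat_mult_vec[OF that(1,2) c(3,4)] hcat_mult_vec[OF that(3,4) c(5,6)] by simp
    have h2: "hcat P1 P2 *\<^sub>v (z @\<^sub>v et) = P1 *\<^sub>v z + P2 *\<^sub>v et"
      if "P1 \<in> carrier_mat r N" "P2 \<in> carrier_mat r m" for P1 P2 r
      by (rule hcat_mult_vec[OF that c(1,2)])
    have z0: "0\<^sub>m r n *\<^sub>v v = 0\<^sub>v r" if "v \<in> carrier_vec n" for r n and v :: "real vec"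
      using that by (intro eq_vecI) auto
    have mone: "(- 1\<^sub>m m) *\<^sub>v v = - v" if "v \<in> carrier_vec m" for v :: "real vec"
      using that by simp
    have 1: "hcat (Ass G) (0\<^sub>m N m) *\<^sub>v (z @\<^sub>v et) + hcat (hcat (B2s G) (0\<^sub>m N m)) (hcat (Asp G) (B1s G)) *\<^sub>v ((u @\<^sub>v ps) @\<^sub>v (th @\<^sub>v d))
        = zout z th d u"
      by (subst h4[where r = N], simp_all, subst h2[where r = N], simp_all,
          intro eq_vecI) (use c in \<open>auto simp: zout_def z0\<close>)
    have 2: "hcat (Aps G) (0\<^sub>m m m) *\<^sub>v (z @\<^sub>v et) + hcat (hcat (B2p G) (0\<^sub>m m m)) (hcat (App G) (B1p G)) *\<^sub>v ((u @\<^sub>v ps) @\<^sub>v (th @\<^sub>v d))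
        = pout z th d u"
      by (subst h4[where r = m], simp_all, subst h2[where r = m], simp_all,
          intro eq_vecI) (use c in \<open>auto simp: pout_def z0\<close>)
    have 3: "hcat (Aps G) (0\<^sub>m m m) *\<^sub>v (z @\<^sub>v et) + hcat (hcat (B2p G) (- 1\<^sub>m m)) (hcat (App G) (B1p G)) *\<^sub>v ((u @\<^sub>v ps) @\<^sub>v (th @\<^sub>v d))
        = pout z th d u - ps"
      by (subst h4[where r = m], simp_all, subst h2[where r = m], simp_all,
          intro eq_vecI) (use c in \<open>auto simp: pout_def z0\<close>)
    have 4: "hcat (C1s G) (0\<^sub>m ne m) *\<^sub>v (z @\<^sub>v et) + hcat (hcat (D12 G) (0\<^sub>m ne m)) (hcat (C1p G) (D11 G)) *\<^sub>v ((u @\<^sub>v ps) @\<^sub>v (th @\<^sub>v d))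
        = eout z th d u"
      by (subst h4[where r = ne], simp_all, subst h2[where r = ne], simp_all,
          intro eq_vecI) (use c in \<open>auto simp: eout_def z0\<close>)
    have 5: "0\<^sub>m nu (N + m) *\<^sub>v (z @\<^sub>v et) + hcat (hcat (1\<^sub>m nu) (0\<^sub>m nu m)) (0\<^sub>m nu (m + nd)) *\<^sub>v ((u @\<^sub>v ps) @\<^sub>v (th @\<^sub>v d)) = u"
    proof -
      have "hcat (hcat (1\<^sub>m nu) (0\<^sub>m nu m)) (0\<^sub>m nu (m + nd)) *\<^sub>v ((u @\<^sub>v ps) @\<^sub>v (th @\<^sub>v d)) = (1\<^sub>m nu *\<^sub>v u + 0\<^sub>m nu m *\<^sub>v ps) + 0\<^sub>m nu (m + nd) *\<^sub>v (th @\<^sub>v d)"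
        using hcat_mult_vec[OF hcat_carrier[OF one_carrier_mat zero_carrier_mat] zero_carrier_mat st]
          hcat_mult_vec[OF one_carrier_mat zero_carrier_mat c(3,4)] by simp
      then show ?thesis using z0[OF x] z0[OF st(2)] z0[OF c(4)] c by simp
    qed
    have 6: "hcat (1\<^sub>m N) (0\<^sub>m N m) *\<^sub>v (z @\<^sub>v et) + 0\<^sub>m N (nu + m + (m + nd)) *\<^sub>v ((u @\<^sub>v ps) @\<^sub>v (th @\<^sub>v d)) = z"
      using h2[OF one_carrier_mat zero_carrier_mat] z0[OF y] z0[OF c(2)] c by simp
    have g2: "hcat (0\<^sub>m r (nu + m)) (hcat P3 P4) *\<^sub>v ((u @\<^sub>v ps) @\<^sub>v (th @\<^sub>v d)) = 0\<^sub>v r + (P3 *\<^sub>v th + P4 *\<^sub>v d)"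
      if "P3 \<in> carrier_mat r m" "P4 \<in> carrier_mat r nd" for P3 P4 r
      using hcat_mult_vec[OF zero_carrier_mat hcat_carrier[OF that] st]
        hcat_mult_vec[OF that c(5,6)] z0[OF st(1)] by simp
    have 7: "0\<^sub>m m (N + m) *\<^sub>v (z @\<^sub>v et) + hcat (0\<^sub>m m (nu + m)) (hcat (1\<^sub>m m) (0\<^sub>m m nd)) *\<^sub>v ((u @\<^sub>v ps) @\<^sub>v (th @\<^sub>v d)) = th"
      using g2[OF one_carrier_mat zero_carrier_mat] z0[OF x] z0[OF c(6)] c by simp
    have 8: "hcat (0\<^sub>m m N) (- 1\<^sub>m m) *\<^sub>v (z @\<^sub>v et) + hcat (0\<^sub>m m (nu + m)) (hcat (1\<^sub>m m) (0\<^sub>m m nd)) *\<^sub>v ((u @\<^sub>v ps) @\<^sub>v (th @\<^sub>v d)) = th - et"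
    proof -
      have "hcat (0\<^sub>m m N) (- 1\<^sub>m m) *\<^sub>v (z @\<^sub>v et) = - et"
        using h2[of "0\<^sub>m m N" m "- 1\<^sub>m m"] z0[OF c(1)] mone[OF c(2)] c by simp
      moreover have "hcat (0\<^sub>m m (nu + m)) (hcat (1\<^sub>m m) (0\<^sub>m m nd)) *\<^sub>v ((u @\<^sub>v ps) @\<^sub>v (th @\<^sub>v d)) = th"
        using g2[OF one_carrier_mat zero_carrier_mat] z0[OF c(6)] c by simp
      ultimately show ?thesis using c by (simp) (intro eq_vecI, auto)
    qed
    have 9: "0\<^sub>m nd (N + m) *\<^sub>v (z @\<^sub>v et) + hcat (0\<^sub>m nd (nu + m)) (hcat (0\<^sub>m nd m) (1\<^sub>m nd)) *\<^sub>v ((u @\<^sub>v ps) @\<^sub>v (th @\<^sub>v d)) = d"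
      using g2[OF zero_carrier_mat one_carrier_mat] z0[OF x] z0[OF c(5)] c by simp
    show ?thesis unfolding q_def 1 2 3 4 5 6 7 8 9 using c by (simp add: qf_smult_one)
  qed
  have xz: "0\<^sub>v (N + m) = 0\<^sub>v N @\<^sub>v (0\<^sub>v m :: real vec)" and vz: "0\<^sub>v (nu + m) = 0\<^sub>v nu @\<^sub>v (0\<^sub>v m :: real vec)"
    and wz: "0\<^sub>v (m + nd) = 0\<^sub>v m @\<^sub>v (0\<^sub>v nd :: real vec)" by (auto intro!: eq_vecI)
  have q0: "qf K (0\<^sub>v n) = 0" if "K \<in> carrier_mat n n" for K n using that by (simp add: qf_def)
  have m0: "v - 0\<^sub>v m = v" if "v \<in> carrier_vec m" for v :: "real vec" using that by auto
  obtain L where L: "L \<in> carrier_mat (nu + m) (N + m)"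
    and Lneg: "\<forall>x \<in> carrier_vec (N + m). \<forall>w \<in> carrier_vec (m + nd).
      x \<noteq> 0\<^sub>v (N + m) \<or> w \<noteq> 0\<^sub>v (m + nd) \<longrightarrow> q x ((L *\<^sub>v x) @\<^sub>v w) < 0"
  proof (rule saddle_point_policy[OF quad])
    fix v :: "real vec" assume v: "v \<in> carrier_vec (nu + m)" "v \<noteq> 0\<^sub>v (nu + m)"
    obtain u ps where c: "u \<in> carrier_vec nu" "ps \<in> carrier_vec m" and v_eq: "v = u @\<^sub>v ps"
      using v(1) by (rule append_vec_cases)
    have nz: "u \<noteq> 0\<^sub>v nu \<or> ps \<noteq> 0\<^sub>v m" using v(2) append_vec_neq_zero[OF c] v_eq by blast
    have eq: "q (0\<^sub>v (N + m)) (v @\<^sub>v 0\<^sub>v (m + nd)) =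
      qf X' (zout (0\<^sub>v N) (0\<^sub>v m) (0\<^sub>v nd) u) + qf T (pout (0\<^sub>v N) (0\<^sub>v m) (0\<^sub>v nd) u)
      + qf M (pout (0\<^sub>v N) (0\<^sub>v m) (0\<^sub>v nd) u - ps)
      + \<beta> * (eout (0\<^sub>v N) (0\<^sub>v m) (0\<^sub>v nd) u \<bullet> eout (0\<^sub>v N) (0\<^sub>v m) (0\<^sub>v nd) u) + (u \<bullet> u) / \<tau>"
      unfolding xz wz v_eq using q_eq[OF _ _ c(1,2), of "0\<^sub>v N" "0\<^sub>v m" "0\<^sub>v m" "0\<^sub>v nd"] X T M
      by (simp add: q0)
    have pc: "pout (0\<^sub>v N) (0\<^sub>v m) (0\<^sub>v nd) u - ps \<in> carrier_vec m" using c by simp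
    have n1: "0 \<le> qf X' (zout (0\<^sub>v N) (0\<^sub>v m) (0\<^sub>v nd) u)" "0 \<le> qf T (pout (0\<^sub>v N) (0\<^sub>v m) (0\<^sub>v nd) u)"
      "0 \<le> qf M (pout (0\<^sub>v N) (0\<^sub>v m) (0\<^sub>v nd) u - ps)"
      using pd_matD(3)[OF X'(2,1)] pd_matD(3)[OF T(2,1)] pd_matD(3)[OF M(2,1) pc] by auto
    have n2: "0 \<le> \<beta> * (eout (0\<^sub>v N) (0\<^sub>v m) (0\<^sub>v nd) u \<bullet> eout (0\<^sub>v N) (0\<^sub>v m) (0\<^sub>v nd) u)"
      using pos(1) scalar_self_nonneg by simp
    show "0 < q (0\<^sub>v (N + m)) (v @\<^sub>v 0\<^sub>v (m + nd))"
    \<comment> \<open>The \<open>M\<close>-term can vanish for \<open>ps = pout\<close>, but for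
      \<open>u = 0\<close> this means \<open>ps = 0\<close>. For nonzero \<open>u\<close> the
      penalty alone is positive.\<close>
    proof (cases "u = 0\<^sub>v nu")
      case True
      then have ps: "ps \<noteq> 0\<^sub>v m" using nz by blast
      have "pout (0\<^sub>v N) (0\<^sub>v m) (0\<^sub>v nd) u = 0\<^sub>v m"
        unfolding pout_def True by simp
      then have "pout (0\<^sub>v N) (0\<^sub>v m) (0\<^sub>v nd) u - ps = - ps" using c by simp
      moreover have "qf M (- ps) = qf M ps" by (rule qf_uminus[OF M(1) c(2)])
      ultimately have "0 < qf M (pout (0\<^sub>v N) (0\<^sub>v m) (0\<^sub>v nd) u - ps)"
        using pd_matD(2)[OF M(2,1) c(2) ps] by simp
      moreover have "0 \<le> (u \<bullet> u) / \<tau>" using pos(2) scalar_self_nonneg by simp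
      ultimately show ?thesis unfolding eq using n1 n2 by linarith
    next
      case False
      then have "0 < (u \<bullet> u) / \<tau>" using scalar_self_pos[OF c(1)] pos(2) by simp
      then show ?thesis unfolding eq using n1 n2 by linarith
    qed
  next
    fix w :: "real vec" assume w: "w \<in> carrier_vec (m + nd)" "w \<noteq> 0\<^sub>v (m + nd)"
    obtain th d where c: "th \<in> carrier_vec m" "d \<in> carrier_vec nd" and w_eq: "w = th @\<^sub>v d"
      using w(1) by (rule append_vec_cases)
    have nz: "th \<noteq> 0\<^sub>v m \<or> d \<noteq> 0\<^sub>v nd" using w(2) append_vec_neq_zero[OF c] w_eq by blast
    show "q (0\<^sub>v (N + m)) (0\<^sub>v (nu + m) @\<^sub>v w) < 0"
      unfolding xz vz w_eq using q_eq[OF _ _ _ _ c, of "0\<^sub>v N" "0\<^sub>v m" "0\<^sub>v nu" "0\<^sub>v m"] X c open_loop[OF c nz]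
      by (simp add: q0 m0)
  next
    fix x w :: "real vec" assume x: "x \<in> carrier_vec (N + m)" and w: "w \<in> carrier_vec (m + nd)"
      and nz: "x \<noteq> 0\<^sub>v (N + m) \<or> w \<noteq> 0\<^sub>v (m + nd)"
    obtain z et where cx: "z \<in> carrier_vec N" "et \<in> carrier_vec m" and x_eq: "x = z @\<^sub>v et"
      using x by (rule append_vec_cases)
    obtain th d where c: "th \<in> carrier_vec m" "d \<in> carrier_vec nd" and w_eq: "w = th @\<^sub>v d"
      using w by (rule append_vec_cases)
    have nz': "(z \<noteq> 0\<^sub>v N \<or> et \<noteq> 0\<^sub>v m) \<or> (th \<noteq> 0\<^sub>v m \<or> d \<noteq> 0\<^sub>v nd)"
      using nz append_vec_neq_zero[OF c] append_vec_neq_zero[OF cx] x_eq w_eq by blast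
    have diff: "th - et \<in> carrier_vec m" using c cx by simp
    show "\<exists>v \<in> carrier_vec (nu + m). q x (v @\<^sub>v w) < 0"
    proof (cases "z \<noteq> 0\<^sub>v N \<or> th \<noteq> 0\<^sub>v m \<or> d \<noteq> 0\<^sub>v nd")
      case True
      obtain u where u: "u \<in> carrier_vec nu"
        "qf X' (zout z th d u) + qf T (pout z th d u) + \<beta> * (eout z th d u \<bullet> eout z th d u) + (u \<bullet> u) / \<tau>
          < qf X z + qf T th + f * (d \<bullet> d)" using full_info[OF cx(1) c True] by blast
      have "pout z th d u - pout z th d u = 0\<^sub>v m" by (intro minus_cancel_vec) simp
      then have "qf M (pout z th d u - pout z th d u) = 0" using q0[OF M(1)] by (simp only:)
      then have "q x ((u @\<^sub>v pout z th d u) @\<^sub>v w) < 0"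
        unfolding x_eq w_eq using q_eq[OF cx u(1) _ c, of "pout z th d u"] u(2) pd_matD(3)[OF M(2,1) diff]
        by simp
      then show ?thesis using u(1) by (intro bexI[of _ "u @\<^sub>v pout z th d u"]) auto
    next
      \<comment> \<open>Only \<open>et\<close> is nonzero here. Playing zero makes all outputs
        vanish and leaves the value \<open>- qf M et\<close>.\<close>
      case False
      then have et: "et \<noteq> 0\<^sub>v m" and z: "z = 0\<^sub>v N" "th = 0\<^sub>v m" "d = 0\<^sub>v nd" using nz' by auto
      have outs: "zout z th d (0\<^sub>v nu) = 0\<^sub>v N" "pout z th d (0\<^sub>v nu) = 0\<^sub>v m" "eout z th d (0\<^sub>v nu) = 0\<^sub>v ne"
        unfolding zout_def pout_def eout_def z by simp_all
      have "qf M (th - et) = qf M et" using qf_uminus[OF M(1) cx(2)] cx(2) z by simp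
      then have "0 < qf M (th - et)" using pd_matD(2)[OF M(2,1) cx(2) et] by simp
      moreover have "qf X z = 0" "qf T th = 0" "d \<bullet> d = 0" using X T q0 z by auto
      ultimately have "q x ((0\<^sub>v nu @\<^sub>v 0\<^sub>v m) @\<^sub>v w) < 0"
        unfolding x_eq w_eq using q_eq[OF cx _ _ c, of "0\<^sub>v nu" "0\<^sub>v m"] X' T M by (simp add: outs q0 m0)
      then show ?thesis by (intro bexI[of _ "0\<^sub>v nu @\<^sub>v 0\<^sub>v m"]) auto
    qed
  qed
  \<comment> \<open>\<open>L\<close> maps \<open>(z, et)\<close> to \<open>(u, ps)\<close>: its
    upper rows give the control and its lower rows the internal signal, each split into a part for
    \<open>z\<close> and a part for \<open>et\<close>.\<close>
  obtain Dd Cc Bc Ac where spl: "split_block L nu N = (Dd, Cc, Bc, Ac)" by (metis surj_pair)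
  have dimL: "dim_row L = nu + m" "dim_col L = N + m" using L by auto
  note sb = split_block[OF spl dimL]
  have "qf X' (zout z th d (Cc *\<^sub>v et + Dd *\<^sub>v z)) + qf T (pout z th d (Cc *\<^sub>v et + Dd *\<^sub>v z))
        + qf M (pout z th d (Cc *\<^sub>v et + Dd *\<^sub>v z) - (Ac *\<^sub>v et + Bc *\<^sub>v z))
        + \<beta> * (eout z th d (Cc *\<^sub>v et + Dd *\<^sub>v z) \<bullet> eout z th d (Cc *\<^sub>v et + Dd *\<^sub>v z))
        < qf X z + qf T th + qf M (th - et) + f * (d \<bullet> d)"
    if c: "z \<in> carrier_vec N" "et \<in> carrier_vec m" "th \<in> carrier_vec m" "d \<in> carrier_vec nd"
      and nz: "z \<noteq> 0\<^sub>v N \<or> et \<noteq> 0\<^sub>v m \<or> th \<noteq> 0\<^sub>v m \<or> d \<noteq> 0\<^sub>v nd" for z et th d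
  proof -
    define u where "u = Cc *\<^sub>v et + Dd *\<^sub>v z"
    define ps where "ps = Ac *\<^sub>v et + Bc *\<^sub>v z"
    have uc: "u \<in> carrier_vec nu" "ps \<in> carrier_vec m" using sb c by (auto simp: u_def ps_def)
    have "L *\<^sub>v (z @\<^sub>v et) = u @\<^sub>v ps"
      unfolding sb(5) four_block_mat_mult_vec[OF sb(1-4) c(1,2)] u_def ps_def
      using sb c by (simp add: comm_add_vec[of _ nu] comm_add_vec[of _ m])
    moreover have "z @\<^sub>v et \<noteq> 0\<^sub>v (N + m) \<or> th @\<^sub>v d \<noteq> 0\<^sub>v (m + nd)"
      using nz append_vec_neq_zero[OF c(1,2)] append_vec_neq_zero[OF c(3,4)] by blast
    moreover have "z @\<^sub>v et \<in> carrier_vec (N + m)" "th @\<^sub>v d \<in> carrier_vec (m + nd)" using c by auto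
    ultimately have "q (z @\<^sub>v et) ((u @\<^sub>v ps) @\<^sub>v (th @\<^sub>v d)) < 0" using Lneg by fastforce
    \<comment> \<open>The penalty has served its purpose and is dropped.\<close>
    moreover have "0 \<le> (u \<bullet> u) / \<tau>" using pos(2) scalar_self_nonneg by simp
    ultimately show ?thesis using q_eq[OF c(1,2) uc c(3,4)] unfolding u_def ps_def by linarith
  qed
  then show ?thesis by (intro that[OF sb(4,3,2,1)]) blast
qed

end

text \<open>This is \<open>0 \<le> qf A (a - Y x)\<close> expanded, where \<open>Y\<close> acts as
  the inverse of \<open>A\<close>.\<close>

lemma fenchel_pd:
  assumes A: "A \<in> carrier_mat n n" "pd_mat A" and Y: "Y \<in> carrier_mat n n"
    and AY: "\<And>v. v \<in> carrier_vec n \<Longrightarrow> A *\<^sub>v (Y *\<^sub>v v) = v"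
    and a: "a \<in> carrier_vec n" and x: "x \<in> carrier_vec n"
  shows "2 * (a \<bullet> x) \<le> qf A a + qf Y x"
proof -
  define y where "y = Y *\<^sub>v x"
  have y: "y \<in> carrier_vec n" and Ay: "A *\<^sub>v y = x" using Y x AY by (auto simp: y_def)
  have my: "- y \<in> carrier_vec n" using y by simp
  have "0 \<le> qf A (a + - y)" using a y by (intro pd_matD(3)[OF A(2,1)]) auto
  also have "\<dots> = qf A a + 2 * ((- y) \<bullet> (A *\<^sub>v a)) + qf A y"
    using qf_add[OF A(1) pd_matD(1)[OF A(2,1)] a my] qf_uminus[OF A(1) y] by simp
  also have "(- y) \<bullet> (A *\<^sub>v a) = - (a \<bullet> x)"
    using sym_scalar_prod[OF A(1) pd_matD(1)[OF A(2,1)] y a] Ay A a y by simp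
  also have "qf A y = qf Y x" using comm_scalar_prod[OF y x] Ay by (simp add: qf_def y_def)
  finally show ?thesis by simp
qed

lemma qf_four_block_one:
  assumes A: "A \<in> carrier_mat n n" and D: "D \<in> carrier_mat n n"
    and a: "a \<in> carrier_vec n" and v: "v \<in> carrier_vec n"
  shows "qf (four_block_mat A (1\<^sub>m n) (1\<^sub>m n) D) (a @\<^sub>v v) = qf A a + 2 * (a \<bullet> v) + qf D v"
proof -
  have c: "A *\<^sub>v a \<in> carrier_vec n" "D *\<^sub>v v \<in> carrier_vec n" using A D a v by auto
  have "qf (four_block_mat A (1\<^sub>m n) (1\<^sub>m n) D) (a @\<^sub>v v)
      = (a @\<^sub>v v) \<bullet> ((A *\<^sub>v a + v) @\<^sub>v (a + D *\<^sub>v v))"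
    unfolding qf_def four_block_mat_mult_vec[OF A one_carrier_mat one_carrier_mat D a v] using a v by simp
  also have "\<dots> = a \<bullet> (A *\<^sub>v a + v) + v \<bullet> (a + D *\<^sub>v v)"
    using a v c by (intro scalar_prod_append) auto
  also have "\<dots> = qf A a + 2 * (a \<bullet> v) + qf D v"
    using a v c comm_scalar_prod[OF v a] by (simp add: scalar_prod_add_distrib[of _ n] qf_def)
  finally show ?thesis .
qed

lemma transpose_hcat:
  assumes "A \<in> carrier_mat nr n1" "B \<in> carrier_mat nr n2"
  shows "transpose_mat (hcat A B) = vcat (transpose_mat A) (transpose_mat B)"
  using assms by (intro eq_matI) (auto simp: hcat_def vcat_def)

text \<open>The Fredholm alternative for \<open>1 - A D\<close>: a trivial kernel makes it
  invertible. Well-posedness of a feedback loop is thereby reduced to its homogeneous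
  equation.\<close>

lemma unique_affine_fixpoint:
  fixes A D :: "real mat"
  assumes A: "A \<in> carrier_mat m m" and D: "D \<in> carrier_mat m m"
    and inj: "\<And>v. v \<in> carrier_vec m \<Longrightarrow> v = A *\<^sub>v (D *\<^sub>v v) \<Longrightarrow> v = 0\<^sub>v m"
    and c: "c \<in> carrier_vec m"
  shows "\<exists>!v. v \<in> carrier_vec m \<and> v = A *\<^sub>v (D *\<^sub>v v) + c"
proof -
  have AD: "A * D \<in> carrier_mat m m" using A D by simp
  define E where "E = 1\<^sub>m m - A * D"
  have E: "E \<in> carrier_mat m m" using AD by (simp add: E_def minus_carrier_mat)
  have Ev: "E *\<^sub>v v = v - A *\<^sub>v (D *\<^sub>v v)" if "v \<in> carrier_vec m" for v
    unfolding E_def minus_mult_distrib_mat_vec[OF one_carrier_mat AD that] using A D that by simp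
  have ADv: "A *\<^sub>v (D *\<^sub>v v) \<in> carrier_vec m" if "v \<in> carrier_vec m" for v using A D that by auto
  have move: "v - w = c' \<longleftrightarrow> v = w + c'"
    if "v \<in> carrier_vec m" "w \<in> carrier_vec m" "c' \<in> carrier_vec m" for v w c' :: "real vec"
  proof
    assume "v - w = c'"
    then show "v = w + c'" using that by (intro eq_vecI) auto
  next
    assume "v = w + c'"
    then show "v - w = c'" using that by (intro eq_vecI) auto
  qed
  have Einj: "v = 0\<^sub>v m" if v: "v \<in> carrier_vec m" and 0: "E *\<^sub>v v = 0\<^sub>v m" for v
  proof (rule inj[OF v])
    have "v = A *\<^sub>v (D *\<^sub>v v) + 0\<^sub>v m" using move[OF v ADv[OF v] zero_carrier_vec] 0 Ev[OF v] by simp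
    then show "v = A *\<^sub>v (D *\<^sub>v v)" using right_zero_vec[OF ADv[OF v]] by simp
  qed
  obtain F where F: "F \<in> carrier_mat m m" "E * F = 1\<^sub>m m" "F * E = 1\<^sub>m m"
    using inverse_exists_if_injective[OF E Einj] by blast
  have Fc: "F *\<^sub>v c \<in> carrier_vec m" using F c by auto
  show ?thesis
  proof (rule ex1I[of _ "F *\<^sub>v c"])
    have "E *\<^sub>v (F *\<^sub>v c) = c" by (rule inverse_mult_vec[OF E F(1,2) c])
    then show "F *\<^sub>v c \<in> carrier_vec m \<and> F *\<^sub>v c = A *\<^sub>v (D *\<^sub>v (F *\<^sub>v c)) + c"
      using move[OF Fc ADv[OF Fc] c] Ev[OF Fc] Fc by simp
  next
    fix v assume v: "v \<in> carrier_vec m \<and> v = A *\<^sub>v (D *\<^sub>v v) + c"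
    then have "E *\<^sub>v v = c" using move[OF _ ADv c, of v v] Ev[of v] by simp
    then show "v = F *\<^sub>v c" using inverse_mult_vec[OF F(1) E F(3), of v] v by simp
  qed
qed

section \<open>The certificate of one step and its construction from the matrix inequalities\<close>

context lft_plant
begin

lemma out_no_state:
  assumes "th \<in> carrier_vec m" "d \<in> carrier_vec nd"
  shows "zout (0\<^sub>v N) th d (0\<^sub>v nu) = Asp G *\<^sub>v th + B1s G *\<^sub>v d"
    "pout (0\<^sub>v N) th d (0\<^sub>v nu) = App G *\<^sub>v th + B1p G *\<^sub>v d"
    "eout (0\<^sub>v N) th d (0\<^sub>v nu) = C1p G *\<^sub>v th + D11 G *\<^sub>v d"
  unfolding zout_def pout_def eout_def using assms by (auto intro!: eq_vecI)

lemma plant_H_carrier: "plant_H G \<in> carrier_mat (N + m + ne) (N + m + nd)"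
  unfolding plant_H_def by (rule block3_carrier) simp_all

lemma plant_W_carrier: "plant_W G \<in> carrier_mat nu (N + m + ne)"
  unfolding plant_W_def by (intro hcat_carrier) simp_all

lemma plant_H_W_mult:
  assumes c: "z \<in> carrier_vec N" "th \<in> carrier_vec m" "d \<in> carrier_vec nd" "u \<in> carrier_vec nu"
  shows "plant_H G *\<^sub>v ((z @\<^sub>v th) @\<^sub>v d) + transpose_mat (plant_W G) *\<^sub>v u
    = (zout z th d u @\<^sub>v pout z th d u) @\<^sub>v eout z th d u"
proof -
  have ts: "transpose_mat (B2s G) \<in> carrier_mat nu N" "transpose_mat (B2p G) \<in> carrier_mat nu m"
    "transpose_mat (D12 G) \<in> carrier_mat nu ne" by simp_all
  have W: "transpose_mat (plant_W G) *\<^sub>v u = ((B2s G *\<^sub>v u) @\<^sub>v (B2p G *\<^sub>v u)) @\<^sub>v (D12 G *\<^sub>v u)"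
    unfolding plant_W_def transpose_hcat[OF hcat_carrier[OF ts(1,2)] ts(3)] transpose_hcat[OF ts(1,2)] transpose_transpose
    using vcat_mult_vec[OF vcat_carrier[OF plant_carrier(4,8)] plant_carrier(12) c(4)]
      vcat_mult_vec[OF plant_carrier(4,8) c(4)] by simp
  have H: "plant_H G *\<^sub>v ((z @\<^sub>v th) @\<^sub>v d) =
    ((Ass G *\<^sub>v z + Asp G *\<^sub>v th + B1s G *\<^sub>v d) @\<^sub>v (Aps G *\<^sub>v z + App G *\<^sub>v th + B1p G *\<^sub>v d))
      @\<^sub>v (C1s G *\<^sub>v z + C1p G *\<^sub>v th + D11 G *\<^sub>v d)"
    unfolding plant_H_def by (rule block3_mult_vec[OF plant_carrier(1-3,5-7,9-11) c(1-3)])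
  have cc: "Ass G *\<^sub>v z + Asp G *\<^sub>v th + B1s G *\<^sub>v d \<in> carrier_vec N"
    "Aps G *\<^sub>v z + App G *\<^sub>v th + B1p G *\<^sub>v d \<in> carrier_vec m"
    "C1s G *\<^sub>v z + C1p G *\<^sub>v th + D11 G *\<^sub>v d \<in> carrier_vec ne"
    "B2s G *\<^sub>v u \<in> carrier_vec N" "B2p G *\<^sub>v u \<in> carrier_vec m" "D12 G *\<^sub>v u \<in> carrier_vec ne"
    by (rule carrier_vecI, simp)+
  show ?thesis unfolding W H zout_def pout_def eout_def
    using append_vec_add[OF append_carrier_vec[OF cc(1,2)] append_carrier_vec[OF cc(4,5)] cc(3,6)]
      append_vec_add[OF cc(1,4,2,5)] by simp
qed

text \<open>The game with the state and all controller variables set to zero. It expresses strict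
  concavity for the opponent and later serves to solve the algebraic loop of the plant.\<close>

definition open_loop_ineq :: "real mat \<Rightarrow> real \<Rightarrow> real \<Rightarrow> real mat \<Rightarrow> real mat \<Rightarrow> bool" where
  "open_loop_ineq X' \<beta> f T M \<longleftrightarrow> (
    \<forall>th \<in> carrier_vec m. \<forall>d \<in> carrier_vec nd. th \<noteq> 0\<^sub>v m \<or> d \<noteq> 0\<^sub>v nd \<longrightarrow>
      qf X' (zout (0\<^sub>v N) th d (0\<^sub>v nu)) + qf T (pout (0\<^sub>v N) th d (0\<^sub>v nu))
        + qf M (pout (0\<^sub>v N) th d (0\<^sub>v nu))
        + \<beta> * (eout (0\<^sub>v N) th d (0\<^sub>v nu) \<bullet> eout (0\<^sub>v N) th d (0\<^sub>v nu))
        < qf T th + qf M th + f * (d \<bullet> d))"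

text \<open>Besides the state \<open>z\<close>, the storage function weighs the plant signal \<open>th\<close> by \<open>T\<close> and its deviation
  from the controller signal \<open>et\<close> by \<open>M\<close>: the controller signal \<open>et\<close> acts as an estimate of \<open>th\<close>.\<close>
definition closed_loop_ineq :: "real mat \<Rightarrow> real mat \<Rightarrow> real \<Rightarrow> real \<Rightarrow> real \<Rightarrow> real mat \<Rightarrow> real mat
    \<Rightarrow> real mat \<Rightarrow> real mat \<Rightarrow> real mat \<Rightarrow> real mat \<Rightarrow> bool" where
  "closed_loop_ineq X X' \<kappa> \<beta> f T M Ac Bc Cc Dd \<longleftrightarrow> (
    \<forall>z \<in> carrier_vec N. \<forall>et \<in> carrier_vec m. \<forall>th \<in> carrier_vec m. \<forall>d \<in> carrier_vec nd.
      (z \<noteq> 0\<^sub>v N \<or> et \<noteq> 0\<^sub>v m \<or> th \<noteq> 0\<^sub>v m \<or> d \<noteq> 0\<^sub>v nd) \<longrightarrow>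
      qf X' (zout z th d (Cc *\<^sub>v et + Dd *\<^sub>v z)) + qf T (pout z th d (Cc *\<^sub>v et + Dd *\<^sub>v z))
        + qf M (pout z th d (Cc *\<^sub>v et + Dd *\<^sub>v z) - (Ac *\<^sub>v et + Bc *\<^sub>v z))
        + \<beta> * (eout z th d (Cc *\<^sub>v et + Dd *\<^sub>v z) \<bullet> eout z th d (Cc *\<^sub>v et + Dd *\<^sub>v z))
        < \<kappa> * qf X z + qf T th + qf M (th - et) + f * (d \<bullet> d))"

text \<open>The weights are families of blocks, not arbitrary matrices, because \<open>Delta\<close>
  contracts only forms with its own block structure. The open-loop inequality is kept beside the
  closed-loop one: the plant loop must be solvable for any given \<open>u\<close> before the
  controller loop can be treated.\<close>

definition step_cert :: "real mat \<Rightarrow> real mat \<Rightarrow> real \<Rightarrow> real \<Rightarrow> real \<Rightarrow> real mat \<Rightarrow> real mat \<Rightarrow> real mat \<Rightarrow> real mat \<Rightarrow> bool" where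
  "step_cert X X' \<kappa> \<beta> f Ac Bc Cc Dd \<longleftrightarrow>
    Ac \<in> carrier_mat m m \<and> Bc \<in> carrier_mat m N \<and> Cc \<in> carrier_mat nu m \<and> Dd \<in> carrier_mat nu N \<and>
    (\<exists>T M. (\<forall>i<length ms. T i \<in> carrier_mat (ms ! i) (ms ! i) \<and> pd_mat (T i)) \<and>
      (\<forall>i<length ms. M i \<in> carrier_mat (ms ! i) (ms ! i) \<and> pd_mat (M i)) \<and>
      open_loop_ineq X' \<beta> f (bdiag ms T) (bdiag ms M) \<and>
      closed_loop_ineq X X' \<kappa> \<beta> f (bdiag ms T) (bdiag ms M) Ac Bc Cc Dd)"

text \<open>Dual control for the stacked plant. The input matrix is the transpose of
  \<open>plant_W\<close>, so the constraint on the dual vector is membership in the kernel of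
  \<open>plant_W\<close>, that is, in the range of \<open>NR\<close>, where the
  \<open>R\<close>-inequality speaks. The inverse weights \<open>X'\<close>, \<open>T\<close> and
  \<open>1 / b\<close> appear on the outputs; \<open>X\<close>, \<open>T\<close> and
  \<open>f2\<close> on the inputs.\<close>

lemma full_information_control:
  assumes R0: "R0 \<in> carrier_mat N N" "pd_mat R0" and R0': "R0' \<in> carrier_mat N N"
    and X: "X \<in> carrier_mat N N" "R0 * X = 1\<^sub>m N"
    and X': "X' \<in> carrier_mat N N" "pd_mat X'" "R0' * X' = 1\<^sub>m N"
    and Rb: "Rb \<in> carrier_mat m m" "pd_mat Rb" and T: "T \<in> carrier_mat m m" "pd_mat T"
    and RT: "\<And>v. v \<in> carrier_vec m \<Longrightarrow> Rb *\<^sub>v (T *\<^sub>v v) = v"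
    and sc: "b > 0" "f2 > 0" "1 / f2 \<le> g"
    and NR: "NR \<in> carrier_mat (N + m + ne) r"
      "{NR *\<^sub>v x | x. x \<in> carrier_vec r} = {v \<in> carrier_vec (N + m + ne). plant_W G *\<^sub>v v = 0\<^sub>v nu}"
    and LMI: "nd_mat (transpose_mat NR *
      (plant_H G * diag_block_mat [R0, Rb, g \<cdot>\<^sub>m 1\<^sub>m nd] * transpose_mat (plant_H G)
        - diag_block_mat [R0', Rb, b \<cdot>\<^sub>m 1\<^sub>m ne]) * NR)"
  obtains \<tau> \<kappa> where "\<tau> > 0" "0 < \<kappa>" "\<kappa> < 1"
    "\<forall>z \<in> carrier_vec N. \<forall>th \<in> carrier_vec m. \<forall>d \<in> carrier_vec nd. \<exists>u \<in> carrier_vec nu.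
      qf X' (zout z th d u) + qf T (pout z th d u) + (1 / b) * (eout z th d u \<bullet> eout z th d u) + (u \<bullet> u) / \<tau>
        \<le> \<kappa> * (qf X z + qf T th + f2 * (d \<bullet> d))"
proof -
  let ?I = "\<lambda>c n. c \<cdot>\<^sub>m 1\<^sub>m n :: real mat"
  define Ri where "Ri = diag_block_mat [R0, Rb, ?I g nd]"
  define Ro where "Ro = diag_block_mat [R0', Rb, ?I b ne]"
  define Po where "Po = diag_block_mat [X', T, ?I (1 / b) ne]"
  define Xi where "Xi = diag_block_mat [X, T, ?I f2 nd]"
  have I: "?I c k \<in> carrier_mat k k" "transpose_mat (?I c k) = ?I c k" for c k by (auto intro!: eq_matI)
  have Iv: "?I c k *\<^sub>v v = c \<cdot>\<^sub>v v" if "v \<in> carrier_vec k" for c k v using that by (intro eq_vecI) auto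
  note H = plant_H_carrier and W = plant_W_carrier
  have Wt: "transpose_mat (plant_W G) \<in> carrier_mat (N + m + ne) nu" using W by simp
  have Ri: "Ri \<in> carrier_mat (N + m + nd) (N + m + nd)" unfolding Ri_def by (rule diag3_carrier[OF R0(1) Rb(1) I(1)])
  have Ro: "Ro \<in> carrier_mat (N + m + ne) (N + m + ne)" unfolding Ro_def by (rule diag3_carrier[OF R0' Rb(1) I(1)])
  have Po: "Po \<in> carrier_mat (N + m + ne) (N + m + ne)" unfolding Po_def by (rule diag3_carrier[OF X'(1) T(1) I(1)])
  have Pot: "transpose_mat Po = Po" unfolding Po_def
    by (rule diag3_transpose[OF X'(1) T(1) I(1) pd_matD(1)[OF X'(2,1)] pd_matD(1)[OF T(2,1)] I(2)])
  have qPo: "qf Po ((a @\<^sub>v c) @\<^sub>v e) = qf X' a + qf T c + (1 / b) * (e \<bullet> e)"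
    if "a \<in> carrier_vec N" "c \<in> carrier_vec m" "e \<in> carrier_vec ne" for a c e
    unfolding Po_def qf_diag3[OF X'(1) T(1) I(1) that] qf_smult_one[OF that(3)] by simp
  have qRi: "qf Ri ((a @\<^sub>v c) @\<^sub>v e) = qf R0 a + qf Rb c + g * (e \<bullet> e)"
    if "a \<in> carrier_vec N" "c \<in> carrier_vec m" "e \<in> carrier_vec nd" for a c e
    unfolding Ri_def qf_diag3[OF R0(1) Rb(1) I(1) that] qf_smult_one[OF that(3)] by simp
  have qXi: "qf Xi ((a @\<^sub>v c) @\<^sub>v e) = qf X a + qf T c + f2 * (e \<bullet> e)"
    if "a \<in> carrier_vec N" "c \<in> carrier_vec m" "e \<in> carrier_vec nd" for a c e
    unfolding Xi_def qf_diag3[OF X(1) T(1) I(1) that] qf_smult_one[OF that(3)] by simp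
  have cases3: "\<exists>a c e. a \<in> carrier_vec N \<and> c \<in> carrier_vec m \<and> e \<in> carrier_vec k \<and> v = (a @\<^sub>v c) @\<^sub>v e"
    if v: "v \<in> carrier_vec (N + m + k)" for k and v :: "real vec"
  proof -
    obtain w e where "w \<in> carrier_vec (N + m)" "e \<in> carrier_vec k" "v = w @\<^sub>v e" using v by (rule append_vec_cases)
    moreover from this(1) obtain a c where "a \<in> carrier_vec N" "c \<in> carrier_vec m" "w = a @\<^sub>v c" by (rule append_vec_cases)
    ultimately show ?thesis by blast
  qed
  obtain \<tau> \<kappa> where \<tau>: "\<tau> > 0" and \<kappa>: "0 < \<kappa>" "\<kappa> < 1"
    and ex: "\<forall>x \<in> carrier_vec (N + m + nd). \<exists>u \<in> carrier_vec nu.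
      qf Po (plant_H G *\<^sub>v x + transpose_mat (plant_W G) *\<^sub>v u) + (u \<bullet> u) / \<tau> \<le> \<kappa> * qf Xi x"
  proof (rule dual_control[OF H Wt Ro Ri Po Pot])
    fix v :: "real vec" assume "v \<in> carrier_vec (N + m + ne)"
    then obtain a c e where v: "a \<in> carrier_vec N" "c \<in> carrier_vec m" "e \<in> carrier_vec ne" "v = (a @\<^sub>v c) @\<^sub>v e"
      using cases3 by blast
    have "0 \<le> (1 / b) * (e \<bullet> e)" using sc(1) scalar_self_nonneg by simp
    then show "0 \<le> qf Po v"
      unfolding v(4) qPo[OF v(1-3)] using pd_matD(3)[OF X'(2,1) v(1)] pd_matD(3)[OF T(2,1) v(2)] by simp
    have c: "X' *\<^sub>v a \<in> carrier_vec N" "T *\<^sub>v c \<in> carrier_vec m" "?I (1 / b) ne *\<^sub>v e \<in> carrier_vec ne"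
      using X' T v mult_mat_vec_carrier[OF I(1) v(3)] by auto
    have "?I b ne *\<^sub>v (?I (1 / b) ne *\<^sub>v e) = e" using v(3) sc(1) by (simp add: Iv smult_smult_assoc)
    then show "Ro *\<^sub>v (Po *\<^sub>v v) = v"
      unfolding v(4) Po_def diag3_mult_vec[OF X'(1) T(1) I(1) v(1-3)] Ro_def
        diag3_mult_vec[OF R0' Rb(1) I(1) c] using RT[OF v(2)] inverse_mult_vec[OF R0' X'(1,3) v(1)] by simp
  next
    fix a x :: "real vec" assume "a \<in> carrier_vec (N + m + nd)" "x \<in> carrier_vec (N + m + nd)"
    then obtain a1 a2 a3 z th d where a: "a1 \<in> carrier_vec N" "a2 \<in> carrier_vec m" "a3 \<in> carrier_vec nd"
      "a = (a1 @\<^sub>v a2) @\<^sub>v a3" and x: "z \<in> carrier_vec N" "th \<in> carrier_vec m" "d \<in> carrier_vec nd"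
      "x = (z @\<^sub>v th) @\<^sub>v d" using cases3 by metis
    have "a \<bullet> x = a1 \<bullet> z + a2 \<bullet> th + a3 \<bullet> d"
      unfolding a(4) x(4) using a x by (simp add: scalar_prod_append[of _ "N + m" _ nd] scalar_prod_append[of _ N _ m])
    moreover have "2 * (a1 \<bullet> z) \<le> qf R0 a1 + qf X z"
      using inverse_mult_vec[OF R0(1) X] by (intro fenchel_pd[OF R0 X(1) _ a(1) x(1)]) auto
    moreover have "2 * (a2 \<bullet> th) \<le> qf Rb a2 + qf T th" by (rule fenchel_pd[OF Rb T(1) RT a(2) x(2)])
    \<comment> \<open>Here the two weights are not inverse to each other. Fenchel's inequality is
      used with \<open>1 / f2\<close>, which is at most \<open>g\<close>.\<close>
    moreover have "2 * (a3 \<bullet> d) \<le> g * (a3 \<bullet> a3) + f2 * (d \<bullet> d)"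
    proof -
      have "pd_mat (?I (1 / f2) nd)"
        using sc(2) by (intro pd_matI[OF I]) (auto simp: qf_smult_one scalar_self_pos)
      then have "2 * (a3 \<bullet> d) \<le> qf (?I (1 / f2) nd) a3 + qf (?I f2 nd) d"
        using sc(2) by (intro fenchel_pd[OF I(1) _ I(1) _ a(3) x(3)]) (auto simp: Iv smult_smult_assoc)
      then have "2 * (a3 \<bullet> d) \<le> (1 / f2) * (a3 \<bullet> a3) + f2 * (d \<bullet> d)"
        unfolding qf_smult_one[OF a(3)] qf_smult_one[OF x(3)] .
      moreover have "(1 / f2) * (a3 \<bullet> a3) \<le> g * (a3 \<bullet> a3)"
        using sc(3) scalar_self_nonneg by (intro mult_right_mono)
      ultimately show ?thesis by linarith
    qed
    ultimately show "2 * (a \<bullet> x) \<le> qf Ri a + qf Xi x"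
      unfolding a(4) x(4) qRi[OF a(1-3)] qXi[OF x(1-3)] by simp
  next
    fix l :: "real vec" assume l: "l \<in> carrier_vec (N + m + ne)" "l \<noteq> 0\<^sub>v (N + m + ne)"
      and "transpose_mat (transpose_mat (plant_W G)) *\<^sub>v l = 0\<^sub>v nu"
    then have "l \<in> {NR *\<^sub>v x | x. x \<in> carrier_vec r}" unfolding NR(2) by simp
    then obtain x where x: "x \<in> carrier_vec r" and l_eq: "l = NR *\<^sub>v x" by blast
    have x0: "x \<noteq> 0\<^sub>v r" using l(2) l_eq mult_mat_vec_zero[OF NR(1)] by auto
    let ?Ht = "transpose_mat (plant_H G)"
    have Ht: "?Ht \<in> carrier_mat (N + m + nd) (N + m + ne)" using H by simp
    define HH where "HH = plant_H G * Ri * ?Ht"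
    have HH: "HH \<in> carrier_mat (N + m + ne) (N + m + ne)" using H Ri Ht by (simp add: HH_def)
    define Q where "Q = HH - Ro"
    have Q: "Q \<in> carrier_mat (N + m + ne) (N + m + ne)" using Ro by (simp add: Q_def minus_carrier_mat)
    define NQ where "NQ = transpose_mat NR * Q * NR"
    have NQ: "NQ \<in> carrier_mat r r" using NR(1) Q by (simp add: NQ_def)
    have "pd_mat (- NQ)" using LMI by (simp add: nd_mat_def NQ_def Q_def HH_def Ri_def Ro_def)
    then have "0 < qf (- NQ) x" using pd_matD(2)[of "- NQ" r x] NQ x x0 by simp
    then have "qf NQ x < 0" using qf_mat_uminus[OF NQ x] by simp
    then have "qf Q l < 0" unfolding NQ_def qf_congruence[OF Q NR(1) x] l_eq .
    moreover have "qf HH l = qf Ri (?Ht *\<^sub>v l)"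
      using qf_congruence[OF Ri Ht l(1)] by (simp add: HH_def)
    ultimately show "qf Ri (?Ht *\<^sub>v l) < qf Ro l" using qf_mat_minus[OF HH Ro l(1)] by (simp add: Q_def)
  qed
  have "\<exists>u \<in> carrier_vec nu. qf X' (zout z th d u) + qf T (pout z th d u)
      + (1 / b) * (eout z th d u \<bullet> eout z th d u) + (u \<bullet> u) / \<tau> \<le> \<kappa> * (qf X z + qf T th + f2 * (d \<bullet> d))"
    if c: "z \<in> carrier_vec N" "th \<in> carrier_vec m" "d \<in> carrier_vec nd" for z th d
  proof -
    have "(z @\<^sub>v th) @\<^sub>v d \<in> carrier_vec (N + m + nd)" using c by simp
    with ex obtain u where u: "u \<in> carrier_vec nu"
      "qf Po (plant_H G *\<^sub>v ((z @\<^sub>v th) @\<^sub>v d) + transpose_mat (plant_W G) *\<^sub>v u) + (u \<bullet> u) / \<tau>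
        \<le> \<kappa> * qf Xi ((z @\<^sub>v th) @\<^sub>v d)" by blast
    from u(2)[unfolded plant_H_W_mult[OF c u(1)] qXi[OF c] qPo[OF out_carrier]] u(1) show ?thesis by blast
  qed
  then show ?thesis by (intro that[OF \<tau> \<kappa>]) blast
qed

text \<open>The Schur complement turns the block inequality into definiteness of a form
  \<open>A\<close>, the difference of input and output weights. Definiteness leaves room for
  \<open>EE / \<sigma>\<close> more on the output side, whose \<open>Sb\<close>-part raises the
  output weight to \<open>1 + 1 / \<sigma>\<close>. Raising the input weight by the same factor only
  helps, since \<open>Sb\<close> is nonnegative.\<close>

lemma open_loop_slack:
  assumes R0': "R0' \<in> carrier_mat N N" and X': "X' \<in> carrier_mat N N" "R0' * X' = 1\<^sub>m N"
    and Sb: "Sb \<in> carrier_mat m m" and t: "\<beta> \<le> t" "0 \<le> \<beta>"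
    and Sb_nonneg: "\<And>v. v \<in> carrier_vec m \<Longrightarrow> 0 \<le> qf Sb v"
    and LMI: "pd_mat (four_block_mat
      (diag_block_mat [Sb, f2 \<cdot>\<^sub>m 1\<^sub>m nd]
        - transpose_mat (plant_H22 G) * diag_block_mat [Sb, t \<cdot>\<^sub>m 1\<^sub>m ne] * plant_H22 G)
      (transpose_mat (plant_H12 G)) (plant_H12 G) R0')"
  obtains \<epsilon> where "\<epsilon> > 0"
    "\<forall>th \<in> carrier_vec m. \<forall>d \<in> carrier_vec nd. th \<noteq> 0\<^sub>v m \<or> d \<noteq> 0\<^sub>v nd \<longrightarrow>
      qf X' (zout (0\<^sub>v N) th d (0\<^sub>v nu)) + (1 + \<epsilon>) * qf Sb (pout (0\<^sub>v N) th d (0\<^sub>v nu))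
        + \<beta> * (eout (0\<^sub>v N) th d (0\<^sub>v nu) \<bullet> eout (0\<^sub>v N) th d (0\<^sub>v nu)) < (1 + \<epsilon>) * qf Sb th + f2 * (d \<bullet> d)"
proof -
  have I: "c \<cdot>\<^sub>m 1\<^sub>m k \<in> carrier_mat k k" for c :: real and k by simp
  let ?D = "diag_block_mat [Sb, f2 \<cdot>\<^sub>m 1\<^sub>m nd]" and ?E = "diag_block_mat [Sb, t \<cdot>\<^sub>m 1\<^sub>m ne]"
  define H22 where "H22 = plant_H22 G"
  define H12 where "H12 = plant_H12 G"
  have D: "?D \<in> carrier_mat (m + nd) (m + nd)" and E: "?E \<in> carrier_mat (m + ne) (m + ne)"
    by (intro diag2_carrier Sb I)+
  have H22: "H22 \<in> carrier_mat (m + ne) (m + nd)" unfolding H22_def plant_H22_def by simp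
  have H12: "H12 \<in> carrier_mat N (m + nd)" unfolding H12_def plant_H12_def by simp
  define EE where "EE = transpose_mat H22 * ?E * H22"
  define XX where "XX = transpose_mat H12 * X' * H12"
  have EE: "EE \<in> carrier_mat (m + nd) (m + nd)" using H22 E by (simp add: EE_def del: diag_block_mat.simps)
  have XX: "XX \<in> carrier_mat (m + nd) (m + nd)" using H12 X' by (simp add: XX_def)
  have DE: "?D - EE \<in> carrier_mat (m + nd) (m + nd)" using EE by (rule minus_carrier_mat)
  define A where "A = ?D - EE - XX"
  have A: "A \<in> carrier_mat (m + nd) (m + nd)" unfolding A_def using XX by (rule minus_carrier_mat)
  have qA: "qf A w = qf ?D w - qf EE w - qf X' (H12 *\<^sub>v w)" if "w \<in> carrier_vec (m + nd)" for w
    unfolding A_def qf_mat_minus[OF DE XX that] qf_mat_minus[OF D EE that]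
    using qf_congruence[OF X'(1) H12 that] by (simp add: XX_def)
  have pos: "0 < qf A w" if w: "w \<in> carrier_vec (m + nd)" "w \<noteq> 0\<^sub>v (m + nd)" for w
  proof -
    let ?y = "- (X' *\<^sub>v (H12 *\<^sub>v w))"
    have y: "?y \<in> carrier_vec N" using X' H12 w by simp
    have F: "four_block_mat (?D - EE) (transpose_mat H12) H12 R0' \<in> carrier_mat (m + nd + N) (m + nd + N)"
      using DE R0' by (intro four_block_carrier_mat)
    have "pd_mat (four_block_mat (?D - EE) (transpose_mat H12) H12 R0')"
      using LMI unfolding EE_def H22_def H12_def .
    moreover have "w @\<^sub>v ?y \<noteq> 0\<^sub>v (m + nd + N)" using append_vec_neq_zero[OF w(1) y] w(2) by blast
    ultimately have "0 < qf (four_block_mat (?D - EE) (transpose_mat H12) H12 R0') (w @\<^sub>v ?y)"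
      using w(1) y by (intro pd_matD(2)[OF _ F]) auto
    then show ?thesis unfolding schur_test[OF DE H12 R0' X' w(1)] qA[OF w(1)] qf_mat_minus[OF D EE w(1)] .
  qed
  obtain \<sigma> where \<sigma>: "\<sigma> > 0" and "\<forall>w \<in> carrier_vec (m + nd). qf EE w \<le> \<sigma> * qf A w"
    and less: "\<forall>w \<in> carrier_vec (m + nd). w \<noteq> 0\<^sub>v (m + nd) \<longrightarrow> qf EE w < \<sigma> * qf A w"
    by (rule pd_form_dominates[OF A EE pos])
  have "qf X' (zout (0\<^sub>v N) th d (0\<^sub>v nu)) + (1 + 1 / \<sigma>) * qf Sb (pout (0\<^sub>v N) th d (0\<^sub>v nu))
        + \<beta> * (eout (0\<^sub>v N) th d (0\<^sub>v nu) \<bullet> eout (0\<^sub>v N) th d (0\<^sub>v nu)) < (1 + 1 / \<sigma>) * qf Sb th + f2 * (d \<bullet> d)"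
    if c: "th \<in> carrier_vec m" "d \<in> carrier_vec nd" and nz: "th \<noteq> 0\<^sub>v m \<or> d \<noteq> 0\<^sub>v nd" for th d
  proof -
    let ?w = "th @\<^sub>v d"
    have w: "?w \<in> carrier_vec (m + nd)" "?w \<noteq> 0\<^sub>v (m + nd)" using c nz append_vec_neq_zero[OF c] by auto
    define z p e where "z = Asp G *\<^sub>v th + B1s G *\<^sub>v d" and "p = App G *\<^sub>v th + B1p G *\<^sub>v d"
      and "e = C1p G *\<^sub>v th + D11 G *\<^sub>v d"
    have pe: "p \<in> carrier_vec m" "e \<in> carrier_vec ne" by (auto simp: p_def e_def intro!: carrier_vecI)
    have "H22 *\<^sub>v ?w = p @\<^sub>v e" unfolding H22_def plant_H22_def p_def e_def
      by (rule four_block_mat_mult_vec[OF plant_carrier(6,7,10,11) c])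
    then have qEE: "qf EE ?w = qf Sb p + t * (e \<bullet> e)"
      unfolding EE_def qf_congruence[OF E H22 w(1)] using qf_diag2[OF Sb I pe] qf_smult_one[OF pe(2)] by simp
    have "H12 *\<^sub>v ?w = z" unfolding H12_def plant_H12_def z_def by (rule hcat_mult_vec[OF plant_carrier(2,3) c])
    moreover have "qf ?D ?w = qf Sb th + f2 * (d \<bullet> d)"
      unfolding qf_diag2[OF Sb I c] qf_smult_one[OF c(2)] ..
    moreover have "qf EE ?w < \<sigma> * qf A ?w" using less w by blast
    ultimately have "(qf Sb p + t * (e \<bullet> e)) / \<sigma> < qf Sb th + f2 * (d \<bullet> d) - (qf Sb p + t * (e \<bullet> e)) - qf X' z"
      using \<sigma> unfolding qA[OF w(1)] qEE by (simp add: field_simps)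
    moreover have "\<beta> * (e \<bullet> e) \<le> t * (e \<bullet> e)" "0 \<le> t * (e \<bullet> e) / \<sigma>"
      using t \<sigma> scalar_self_nonneg[of e] by (auto intro!: mult_right_mono)
    moreover have "0 \<le> qf Sb th / \<sigma>" using Sb_nonneg[OF c(1)] \<sigma> by simp
    ultimately show ?thesis
      unfolding out_no_state[OF c] z_def[symmetric] p_def[symmetric] e_def[symmetric]
      by (simp add: algebra_simps add_divide_distrib)
  qed
  then show ?thesis using \<sigma> by (intro that[of "1 / \<sigma>"]) auto
qed

text \<open>The common weights \<open>T\<close> and \<open>M\<close> have to serve both hypotheses
  of the estimating policy: their sum is a multiple of \<open>S\<close>, for the open-loop
  inequality, and \<open>T\<close> inverts \<open>R\<close>, for the full-information
  inequality.\<close>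

lemma step_synthesis:
  assumes R0: "R0 \<in> carrier_mat N N" "pd_mat R0" and R0': "R0' \<in> carrier_mat N N"
    and X: "X \<in> carrier_mat N N" "pd_mat X" "R0 * X = 1\<^sub>m N"
    and X': "X' \<in> carrier_mat N N" "pd_mat X'" "R0' * X' = 1\<^sub>m N"
    and RS: "\<forall>i<length ms. R i \<in> carrier_mat (ms ! i) (ms ! i) \<and> pd_mat (R i) \<and>
                  S i \<in> carrier_mat (ms ! i) (ms ! i) \<and> pd_mat (S i)"
    and sc: "b > 0" "f2 > 0" "1 / f2 \<le> g" "1 / b \<le> t"
    and NR: "NR \<in> carrier_mat (N + m + ne) r"
      "{NR *\<^sub>v x | x. x \<in> carrier_vec r} = {v \<in> carrier_vec (N + m + ne). plant_W G *\<^sub>v v = 0\<^sub>v nu}"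
    and LMI_R: "nd_mat (transpose_mat NR *
      (plant_H G * diag_block_mat [R0, bdiag ms R, g \<cdot>\<^sub>m 1\<^sub>m nd] * transpose_mat (plant_H G)
        - diag_block_mat [R0', bdiag ms R, b \<cdot>\<^sub>m 1\<^sub>m ne]) * NR)"
    and LMI_S: "pd_mat (four_block_mat
      (diag_block_mat [bdiag ms S, f2 \<cdot>\<^sub>m 1\<^sub>m nd]
        - transpose_mat (plant_H22 G) * diag_block_mat [bdiag ms S, t \<cdot>\<^sub>m 1\<^sub>m ne] * plant_H22 G)
      (transpose_mat (plant_H12 G)) (plant_H12 G) R0')"
    and LMI_RS: "\<forall>i<length ms. psd_mat (four_block_mat (R i) (1\<^sub>m (ms ! i)) (1\<^sub>m (ms ! i)) (S i))"
  shows "\<exists>\<kappa> Ac Bc Cc Dd. 0 < \<kappa> \<and> \<kappa> < 1 \<and> step_cert X X' \<kappa> (1 / b) f2 Ac Bc Cc Dd"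
proof -
  have "\<exists>T. i < length ms \<longrightarrow> T \<in> carrier_mat (ms ! i) (ms ! i) \<and> pd_mat T \<and> R i * T = 1\<^sub>m (ms ! i)" for i
    using RS pd_mat_inverse by metis
  then obtain T where T: "\<forall>i<length ms. T i \<in> carrier_mat (ms ! i) (ms ! i) \<and> pd_mat (T i) \<and> R i * T i = 1\<^sub>m (ms ! i)"
    by metis
  have Rc: "\<forall>i<length ms. R i \<in> carrier_mat (ms ! i) (ms ! i)" "\<forall>i<length ms. R i \<in> carrier_mat (ms ! i) (ms ! i) \<and> pd_mat (R i)"
    and Sc: "\<forall>i<length ms. S i \<in> carrier_mat (ms ! i) (ms ! i)" "\<forall>i<length ms. S i \<in> carrier_mat (ms ! i) (ms ! i) \<and> pd_mat (S i)"
    and Tc: "\<forall>i<length ms. T i \<in> carrier_mat (ms ! i) (ms ! i)" "\<forall>i<length ms. T i \<in> carrier_mat (ms ! i) (ms ! i) \<and> pd_mat (T i)"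
    and RTi: "\<forall>i<length ms. R i * T i = 1\<^sub>m (ms ! i)"
    using RS T by auto
  \<comment> \<open>Testing the coupling matrix with \<open>(- T v, v)\<close> gives
    \<open>T \<le> S\<close> as quadratic forms.\<close>
  have TS: "qf (T i) v \<le> qf (S i) v" if i: "i < length ms" and v: "v \<in> carrier_vec (ms ! i)" for i v
  proof -
    define a where "a = T i *\<^sub>v v"
    have a: "a \<in> carrier_vec (ms ! i)" using Tc(1) i v by (auto simp: a_def)
    have ma: "- a \<in> carrier_vec (ms ! i)" using a by simp
    have c: "R i \<in> carrier_mat (ms ! i) (ms ! i)" "S i \<in> carrier_mat (ms ! i) (ms ! i)" using Rc Sc i by auto
    have Ra: "R i *\<^sub>v a = v" unfolding a_def using Rc Tc RTi i v by (intro inverse_mult_vec) auto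
    have "0 \<le> qf (four_block_mat (R i) (1\<^sub>m (ms ! i)) (1\<^sub>m (ms ! i)) (S i)) (- a @\<^sub>v v)"
      using LMI_RS i four_block_carrier_mat[OF c] ma v by (intro psd_matD) auto
    also have "\<dots> = qf (R i) a - 2 * (a \<bullet> v) + qf (S i) v"
      unfolding qf_four_block_one[OF c ma v] qf_uminus[OF c(1) a] using a v by simp
    also have "qf (R i) a = a \<bullet> v" by (simp add: qf_def Ra)
    also have "a \<bullet> v = qf (T i) v" using comm_scalar_prod[OF a v] by (simp add: qf_def a_def)
    finally show ?thesis by simp
  qed
  have Sb: "bdiag ms S \<in> carrier_mat m m" and Tb: "bdiag ms T \<in> carrier_mat m m" "pd_mat (bdiag ms T)"
    and Rb: "bdiag ms R \<in> carrier_mat m m" "pd_mat (bdiag ms R)"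
    by (rule bdiag_carrier[OF Sc(1)] bdiag_carrier[OF Tc(1)] bdiag_pd[OF Tc(2)] bdiag_carrier[OF Rc(1)] bdiag_pd[OF Rc(2)])+
  obtain \<epsilon> where \<epsilon>: "\<epsilon> > 0"
    and ol: "\<forall>th \<in> carrier_vec m. \<forall>d \<in> carrier_vec nd. th \<noteq> 0\<^sub>v m \<or> d \<noteq> 0\<^sub>v nd \<longrightarrow>
      qf X' (zout (0\<^sub>v N) th d (0\<^sub>v nu)) + (1 + \<epsilon>) * qf (bdiag ms S) (pout (0\<^sub>v N) th d (0\<^sub>v nu))
        + (1 / b) * (eout (0\<^sub>v N) th d (0\<^sub>v nu) \<bullet> eout (0\<^sub>v N) th d (0\<^sub>v nu)) < (1 + \<epsilon>) * qf (bdiag ms S) th + f2 * (d \<bullet> d)"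
  proof (rule open_loop_slack[OF R0' X'(1,3) Sb sc(4) _ _ LMI_S])
    show "0 \<le> qf (bdiag ms S) v" if "v \<in> carrier_vec m" for v
      by (rule pd_matD(3)[OF bdiag_pd[OF Sc(2)] Sb that])
  qed (use sc in auto)
  \<comment> \<open>\<open>M = \<epsilon> S + (S - T)\<close> is definite because
    \<open>T \<le> S\<close>, and \<open>T + M\<close> is the weight that the open-loop inequality
    tolerates.\<close>
  define M where "M i = (1 + \<epsilon>) \<cdot>\<^sub>m S i - T i" for i
  have qM: "qf (M i) v = (1 + \<epsilon>) * qf (S i) v - qf (T i) v" if i: "i < length ms" and v: "v \<in> carrier_vec (ms ! i)" for i v
  proof -
    have c: "S i \<in> carrier_mat (ms ! i) (ms ! i)" "(1 + \<epsilon>) \<cdot>\<^sub>m S i \<in> carrier_mat (ms ! i) (ms ! i)"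
      "T i \<in> carrier_mat (ms ! i) (ms ! i)" using Sc Tc i by auto
    show ?thesis unfolding M_def qf_mat_minus[OF c(2,3) v] qf_mat_smult[OF c(1) v] ..
  qed
  have Mc: "\<forall>i<length ms. M i \<in> carrier_mat (ms ! i) (ms ! i)"
    using Tc by (auto simp: M_def minus_carrier_mat)
  have Mpd: "\<forall>i<length ms. M i \<in> carrier_mat (ms ! i) (ms ! i) \<and> pd_mat (M i)"
  proof (intro allI impI conjI)
    fix i assume i: "i < length ms"
    have c: "S i \<in> carrier_mat (ms ! i) (ms ! i)" "pd_mat (S i)" "T i \<in> carrier_mat (ms ! i) (ms ! i)" "pd_mat (T i)"
      using Sc Tc i by auto
    show Mi: "M i \<in> carrier_mat (ms ! i) (ms ! i)" using Mc i by blast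
    have "transpose_mat ((1 + \<epsilon>) \<cdot>\<^sub>m S i) = (1 + \<epsilon>) \<cdot>\<^sub>m transpose_mat (S i)" by (intro eq_matI) auto
    then have "transpose_mat (M i) = M i"
      unfolding M_def using transpose_minus[of "(1 + \<epsilon>) \<cdot>\<^sub>m S i" "ms ! i" "ms ! i" "T i"] c
        pd_matD(1)[OF c(2,1)] pd_matD(1)[OF c(4,3)] by simp
    moreover have "0 < qf (M i) v" if v: "v \<in> carrier_vec (ms ! i)" "v \<noteq> 0\<^sub>v (ms ! i)" for v
    proof -
      have "0 < \<epsilon> * qf (S i) v" using \<epsilon> pd_matD(2)[OF c(2,1) v] by simp
      then show ?thesis using qM[OF i v(1)] TS[OF i v(1)] by (simp add: algebra_simps)
    qed
    ultimately show "pd_mat (M i)" by (intro pd_matI[OF Mi])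
  qed
  have Mb: "bdiag ms M \<in> carrier_mat m m" "pd_mat (bdiag ms M)"
    by (rule bdiag_carrier[OF Mc] bdiag_pd[OF Mpd])+
  have TMS: "qf (bdiag ms T) v + qf (bdiag ms M) v = (1 + \<epsilon>) * qf (bdiag ms S) v" if "v \<in> carrier_vec m" for v
    unfolding qf_bdiag[OF Tc(1) that] qf_bdiag[OF Mc that] qf_bdiag[OF Sc(1) that]
    by (simp add: sum.distrib[symmetric] sum_distrib_left qM)
  obtain \<tau> \<kappa> where \<tau>: "\<tau> > 0" and \<kappa>: "0 < \<kappa>" "\<kappa> < 1"
    and fi: "\<forall>z \<in> carrier_vec N. \<forall>th \<in> carrier_vec m. \<forall>d \<in> carrier_vec nd. \<exists>u \<in> carrier_vec nu.
      qf X' (zout z th d u) + qf (bdiag ms T) (pout z th d u) + (1 / b) * (eout z th d u \<bullet> eout z th d u) + (u \<bullet> u) / \<tau>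
        \<le> \<kappa> * (qf X z + qf (bdiag ms T) th + f2 * (d \<bullet> d))"
  proof (rule full_information_control[OF R0 R0' X(1,3) X' Rb Tb _ sc(1-3) NR LMI_R])
    show "bdiag ms R *\<^sub>v (bdiag ms T *\<^sub>v v) = v" if "v \<in> carrier_vec m" for v
      by (rule bdiag_inverse[OF Rc(1) Tc(1) RTi that])
  qed
  \<comment> \<open>Strictly between \<open>\<kappa>\<close> and 1. Raising the state weight from
    \<open>\<kappa>\<close> to \<open>\<mu>\<close> and the other weights from
    \<open>\<kappa>\<close> to 1 makes the full-information inequality strict off the origin, and
    the state still decays. The weight of \<open>th\<close> must return to 1 so that it cancels
    against the outputs under \<open>Delta\<close>.\<close>
  define \<mu> where "\<mu> = (1 + \<kappa>) / 2"
  have \<mu>: "0 < \<mu>" "\<mu> < 1" "\<kappa> < \<mu>" using \<kappa> by (auto simp: \<mu>_def)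
  have mX: "\<mu> \<cdot>\<^sub>m X \<in> carrier_mat N N" "transpose_mat (\<mu> \<cdot>\<^sub>m X) = \<mu> \<cdot>\<^sub>m X"
  proof -
    show "\<mu> \<cdot>\<^sub>m X \<in> carrier_mat N N" using X by simp
    have "transpose_mat (\<mu> \<cdot>\<^sub>m X) = \<mu> \<cdot>\<^sub>m transpose_mat X" by (intro eq_matI) auto
    then show "transpose_mat (\<mu> \<cdot>\<^sub>m X) = \<mu> \<cdot>\<^sub>m X" using pd_matD(1)[OF X(2,1)] by simp
  qed
  have qmX: "qf (\<mu> \<cdot>\<^sub>m X) z = \<mu> * qf X z" if "z \<in> carrier_vec N" for z by (rule qf_mat_smult[OF X(1) that])
  have open_loop: "qf X' (zout (0\<^sub>v N) th d (0\<^sub>v nu)) + qf (bdiag ms T) (pout (0\<^sub>v N) th d (0\<^sub>v nu))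
          + qf (bdiag ms M) (pout (0\<^sub>v N) th d (0\<^sub>v nu))
          + (1 / b) * (eout (0\<^sub>v N) th d (0\<^sub>v nu) \<bullet> eout (0\<^sub>v N) th d (0\<^sub>v nu))
          < qf (bdiag ms T) th + qf (bdiag ms M) th + f2 * (d \<bullet> d)"
    if c: "th \<in> carrier_vec m" "d \<in> carrier_vec nd" "th \<noteq> 0\<^sub>v m \<or> d \<noteq> 0\<^sub>v nd" for th d
    using ol[rule_format, OF c] TMS[OF c(1)] TMS[OF out_carrier(2)[of "0\<^sub>v N" th d "0\<^sub>v nu"]] by linarith
  have full_info: "\<exists>u \<in> carrier_vec nu.
        qf X' (zout z th d u) + qf (bdiag ms T) (pout z th d u) + (1 / b) * (eout z th d u \<bullet> eout z th d u) + (u \<bullet> u) / \<tau>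
          < qf (\<mu> \<cdot>\<^sub>m X) z + qf (bdiag ms T) th + f2 * (d \<bullet> d)"
    if c: "z \<in> carrier_vec N" "th \<in> carrier_vec m" "d \<in> carrier_vec nd"
      and nz: "z \<noteq> 0\<^sub>v N \<or> th \<noteq> 0\<^sub>v m \<or> d \<noteq> 0\<^sub>v nd" for z th d
  proof -
    define p1 p2 p3 where "p1 = qf X z" and "p2 = qf (bdiag ms T) th" and "p3 = f2 * (d \<bullet> d)"
    have nn: "0 \<le> p1" "0 \<le> p2" "0 \<le> p3"
      using pd_matD(3)[OF X(2,1) c(1)] pd_matD(3)[OF Tb(2,1) c(2)] sc(2) scalar_self_nonneg[of d]
      by (auto simp: p1_def p2_def p3_def)
    have "p1 > 0 \<or> p2 > 0 \<or> p3 > 0"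
      using nz pd_matD(2)[OF X(2,1) c(1)] pd_matD(2)[OF Tb(2,1) c(2)] sc(2) scalar_self_pos[OF c(3)]
      by (auto simp: p1_def p2_def p3_def)
    then have "0 < (\<mu> - \<kappa>) * p1 \<or> 0 < (1 - \<kappa>) * p2 \<or> 0 < (1 - \<kappa>) * p3" using \<mu> \<kappa> by auto
    moreover have "0 \<le> (\<mu> - \<kappa>) * p1" "0 \<le> (1 - \<kappa>) * p2" "0 \<le> (1 - \<kappa>) * p3" using nn \<mu> \<kappa> by auto
    ultimately have "0 < (\<mu> - \<kappa>) * p1 + (1 - \<kappa>) * p2 + (1 - \<kappa>) * p3" by linarith
    then have "\<kappa> * (p1 + p2 + p3) < \<mu> * p1 + p2 + p3" by (simp add: algebra_simps)
    with fi c show ?thesis unfolding qmX[OF c(1)] p1_def p2_def p3_def by (meson le_less_trans)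
  qed
  obtain Ac Bc Cc Dd where K: "Ac \<in> carrier_mat m m" "Bc \<in> carrier_mat m N"
    "Cc \<in> carrier_mat nu m" "Dd \<in> carrier_mat nu N"
    "\<forall>z \<in> carrier_vec N. \<forall>et \<in> carrier_vec m. \<forall>th \<in> carrier_vec m. \<forall>d \<in> carrier_vec nd.
      (z \<noteq> 0\<^sub>v N \<or> et \<noteq> 0\<^sub>v m \<or> th \<noteq> 0\<^sub>v m \<or> d \<noteq> 0\<^sub>v nd) \<longrightarrow>
      qf X' (zout z th d (Cc *\<^sub>v et + Dd *\<^sub>v z)) + qf (bdiag ms T) (pout z th d (Cc *\<^sub>v et + Dd *\<^sub>v z))
        + qf (bdiag ms M) (pout z th d (Cc *\<^sub>v et + Dd *\<^sub>v z) - (Ac *\<^sub>v et + Bc *\<^sub>v z))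
        + (1 / b) * (eout z th d (Cc *\<^sub>v et + Dd *\<^sub>v z) \<bullet> eout z th d (Cc *\<^sub>v et + Dd *\<^sub>v z))
        < qf (\<mu> \<cdot>\<^sub>m X) z + qf (bdiag ms T) th + qf (bdiag ms M) (th - et) + f2 * (d \<bullet> d)"
  proof (rule estimating_policy[OF mX X'(1,2) Tb Mb _ \<tau> open_loop full_info])
    show "0 < 1 / b" using sc by simp
  qed
  have "step_cert X X' \<mu> (1 / b) f2 Ac Bc Cc Dd"
    unfolding step_cert_def open_loop_ineq_def closed_loop_ineq_def
    by (rule conjI[OF K(1) conjI[OF K(2) conjI[OF K(3) conjI[OF K(4)]]]], rule exI[of _ T], rule exI[of _ M],
        intro conjI Tc(2) Mpd ballI impI open_loop, assumption+, subst qmX[symmetric], assumption,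
        rule K(5)[rule_format]) assumption+
  with \<mu> show ?thesis by blast
qed

end

section \<open>The closed loop\<close>

context lft_plant
begin

lemma pout_split:
  assumes "th \<in> carrier_vec m"
  shows "pout z th d u = App G *\<^sub>v th + (Aps G *\<^sub>v z + B1p G *\<^sub>v d + B2p G *\<^sub>v u)"
  unfolding pout_def using assms by (intro eq_vecI) auto

lemma out_zero:
  "zout (0\<^sub>v N) (0\<^sub>v m) (0\<^sub>v nd) (0\<^sub>v nu) = 0\<^sub>v N" "eout (0\<^sub>v N) (0\<^sub>v m) (0\<^sub>v nd) (0\<^sub>v nu) = 0\<^sub>v ne"
  unfolding zout_def eout_def by simp_all

context
  fixes X X' :: "real mat" and \<kappa> \<beta> f :: real and Ac Bc Cc Dd :: "real mat"
    and K :: nslpv_ctrl and \<delta> :: "nat \<Rightarrow> nat \<Rightarrow> real" and k :: nat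
  assumes cert: "step_cert X X' \<kappa> \<beta> f Ac Bc Cc Dd"
    and X: "X \<in> carrier_mat N N" and X': "X' \<in> carrier_mat N N" "pd_mat X'"
    and \<beta>: "0 < \<beta>" and adm: "admissible (length ms) \<delta>"
    and meas: "C2s G = 1\<^sub>m N" "C2p G = 0\<^sub>m N m" "D21 G = 0\<^sub>m N nd"
    and K: "mcs K k = ms" "Acpp K k = Ac" "Bcp K k = Bc" "Ccp K k = Cc" "Dc K k = Dd"
begin

lemma cert_carrier:
  "Ac \<in> carrier_mat m m" "Bc \<in> carrier_mat m N" "Cc \<in> carrier_mat nu m" "Dd \<in> carrier_mat nu N"
  using cert by (auto simp: step_cert_def)

lemma Delta_vec: "v \<in> carrier_vec m \<Longrightarrow> Delta ms \<delta> k *\<^sub>v v \<in> carrier_vec m"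
  using mult_mat_vec_carrier[OF Delta_carrier] by blast

text \<open>Exact measurement makes the closed loop triangular: the loop for \<open>phc\<close>
  involves only \<open>z\<close>, then \<open>u\<close> is determined, then the loop for
  \<open>ph\<close>, then the outputs. Both loops are affine fixed-point equations.\<close>

lemma cl_step_iff:
  assumes z: "z \<in> carrier_vec N" and d: "d \<in> carrier_vec nd"
  shows "cl_step G ms K \<delta> k z d z' th ph e y u thc phc \<longleftrightarrow>
    phc \<in> carrier_vec m \<and> phc = Ac *\<^sub>v (Delta ms \<delta> k *\<^sub>v phc) + Bc *\<^sub>v z \<and> thc = Delta ms \<delta> k *\<^sub>v phc \<and>
    y = z \<and> u = Cc *\<^sub>v thc + Dd *\<^sub>v z \<and> ph \<in> carrier_vec m \<and> th = Delta ms \<delta> k *\<^sub>v ph \<and>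
    ph = App G *\<^sub>v (Delta ms \<delta> k *\<^sub>v ph) + (Aps G *\<^sub>v z + B1p G *\<^sub>v d + B2p G *\<^sub>v u) \<and>
    z' = zout z th d u \<and> e = eout z th d u" (is "?L \<longleftrightarrow> ?R")
proof -
  have meas_y: "C2s G *\<^sub>v z + C2p G *\<^sub>v th + D21 G *\<^sub>v d = z" if "th \<in> carrier_vec m"
  proof -
    have "0\<^sub>m N m *\<^sub>v th = 0\<^sub>v N" "0\<^sub>m N nd *\<^sub>v d = 0\<^sub>v N" using that d by (auto intro!: eq_vecI)
    then show ?thesis unfolding meas using z by simp
  qed
  have dimC2: "dim_row (C2s G) = N" by (simp add: meas)
  show ?thesis
  proof
    assume ?L
    note L = this[unfolded cl_step_def Let_def K]
    have th: "th \<in> carrier_vec m" and ph: "ph \<in> carrier_vec m" and phc: "phc \<in> carrier_vec m"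
      and ze: "z' = zout z th d u" "e = eout z th d u" and ph_eq: "ph = pout z th d u"
      and y: "y = C2s G *\<^sub>v z + C2p G *\<^sub>v th + D21 G *\<^sub>v d" and th_eq: "th = Delta ms \<delta> k *\<^sub>v ph"
      and phc_eq: "phc = Ac *\<^sub>v thc + Bc *\<^sub>v y" and u: "u = Cc *\<^sub>v thc + Dd *\<^sub>v y"
      and thc_eq: "thc = Delta ms \<delta> k *\<^sub>v phc"
      unfolding zout_def pout_def eout_def using L by blast+
    have y_z: "y = z" unfolding y by (rule meas_y[OF th])
    show ?R
    proof (intro conjI)
      show "phc = Ac *\<^sub>v (Delta ms \<delta> k *\<^sub>v phc) + Bc *\<^sub>v z" unfolding thc_eq[symmetric] using phc_eq unfolding y_z .
      show "u = Cc *\<^sub>v thc + Dd *\<^sub>v z" using u unfolding y_z .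
      show "ph = App G *\<^sub>v (Delta ms \<delta> k *\<^sub>v ph) + (Aps G *\<^sub>v z + B1p G *\<^sub>v d + B2p G *\<^sub>v u)"
        unfolding th_eq[symmetric] pout_split[OF th, symmetric] by (rule ph_eq)
    qed fact+
  next
    assume R: ?R
    have phv: "ph \<in> carrier_vec m" "phc \<in> carrier_vec m" and th_eq: "th = Delta ms \<delta> k *\<^sub>v ph"
      and thc_eq: "thc = Delta ms \<delta> k *\<^sub>v phc" and y: "y = z" and u_eq: "u = Cc *\<^sub>v thc + Dd *\<^sub>v z"
      and ze: "z' = zout z th d u" "e = eout z th d u"
      and phc_eq: "phc = Ac *\<^sub>v (Delta ms \<delta> k *\<^sub>v phc) + Bc *\<^sub>v z"
      and ph_eq: "ph = App G *\<^sub>v (Delta ms \<delta> k *\<^sub>v ph) + (Aps G *\<^sub>v z + B1p G *\<^sub>v d + B2p G *\<^sub>v u)"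
      using R by blast+
    have th: "th \<in> carrier_vec m" "thc \<in> carrier_vec m" unfolding th_eq thc_eq using Delta_vec phv by blast+
    have u: "u \<in> carrier_vec nu" unfolding u_eq using th z cert_carrier by auto
    have pout: "ph = pout z th d u" using ph_eq unfolding th_eq[symmetric] pout_split[OF th(1), symmetric] .
    have yv: "y \<in> carrier_vec N" using y z by simp
    show ?L unfolding cl_step_def Let_def K dimC2 plant_dim
    proof (intro conjI)
      show "phc = Ac *\<^sub>v thc + Bc *\<^sub>v y" using phc_eq unfolding thc_eq[symmetric] y .
      show "u = Cc *\<^sub>v thc + Dd *\<^sub>v y" using u_eq unfolding y .
      show "y = C2s G *\<^sub>v z + C2p G *\<^sub>v th + D21 G *\<^sub>v d" unfolding y meas_y[OF th(1)] ..
      show "z' \<in> carrier_vec N" "e \<in> carrier_vec ne" unfolding ze by simp_all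
    qed (fact ze[unfolded zout_def eout_def] pout[unfolded pout_def] phv th u yv th_eq thc_eq)+
  qed
qed

lemma certE:
  obtains T M where "\<forall>i<length ms. T i \<in> carrier_mat (ms ! i) (ms ! i) \<and> pd_mat (T i)"
    "\<forall>i<length ms. M i \<in> carrier_mat (ms ! i) (ms ! i) \<and> pd_mat (M i)"
    "open_loop_ineq X' \<beta> f (bdiag ms T) (bdiag ms M)"
    "closed_loop_ineq X X' \<kappa> \<beta> f (bdiag ms T) (bdiag ms M) Ac Bc Cc Dd"
  using cert unfolding step_cert_def by (elim conjE exE) (rule that)

lemma nonneg_terms: "0 \<le> qf X' (zout z th d u)" "0 \<le> \<beta> * (eout z th d u \<bullet> eout z th d u)"
  using pd_matD(3)[OF X'(2,1) out_carrier(1)] \<beta> scalar_self_nonneg[of "eout z th d u"] by auto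

text \<open>A solution is the plant output for \<open>th = Delta v\<close> with zero state,
  disturbance and control. For nonzero \<open>th\<close> the open-loop inequality makes the
  \<open>T + M\<close> weight of \<open>v\<close> smaller than that of \<open>Delta v\<close>,
  against the contraction.\<close>

lemma plant_loop_injective:
  assumes v: "v \<in> carrier_vec m" and fix_v: "v = App G *\<^sub>v (Delta ms \<delta> k *\<^sub>v v)"
  shows "v = 0\<^sub>v m"
proof -
  obtain T M where T: "\<forall>i<length ms. T i \<in> carrier_mat (ms ! i) (ms ! i) \<and> pd_mat (T i)"
    and M: "\<forall>i<length ms. M i \<in> carrier_mat (ms ! i) (ms ! i) \<and> pd_mat (M i)"
    and ol: "open_loop_ineq X' \<beta> f (bdiag ms T) (bdiag ms M)"
    by (rule certE)
  define th where "th = Delta ms \<delta> k *\<^sub>v v"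
  have th: "th \<in> carrier_vec m" unfolding th_def by (rule Delta_vec[OF v])
  have "th = 0\<^sub>v m"
  proof (rule ccontr)
    assume "th \<noteq> 0\<^sub>v m"
    have p: "pout (0\<^sub>v N) th (0\<^sub>v nd) (0\<^sub>v nu) = v"
      unfolding out_no_state(2)[OF th zero_carrier_vec] using fix_v v by (simp add: th_def[symmetric])
    have "qf (bdiag ms T) v + qf (bdiag ms M) v < qf (bdiag ms T) th + qf (bdiag ms M) th"
      using ol[unfolded open_loop_ineq_def, rule_format, OF th zero_carrier_vec disjI1[OF \<open>th \<noteq> 0\<^sub>v m\<close>]] p
        nonneg_terms[of "0\<^sub>v N" th "0\<^sub>v nd" "0\<^sub>v nu"] by simp
    then show False
      using Delta_contraction[OF adm v T, of k] Delta_contraction[OF adm v M, of k] by (simp add: th_def)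
  qed
  then show ?thesis using fix_v by (simp add: th_def)
qed

text \<open>The closed-loop inequality speaks of \<open>et\<close> only together with a plant
  signal. So the plant loop is solved for the \<open>u\<close> produced by \<open>et\<close>,
  completing \<open>v\<close> to a solution of the whole loop with zero state and disturbance. Then
  \<open>th = Delta ph\<close> and \<open>th - et = Delta (ph - v)\<close>, and contraction in both
  weights contradicts the strict inequality.\<close>

lemma controller_loop_injective:
  assumes v: "v \<in> carrier_vec m" and fix_v: "v = Ac *\<^sub>v (Delta ms \<delta> k *\<^sub>v v)"
  shows "v = 0\<^sub>v m"
proof -
  obtain T M where T: "\<forall>i<length ms. T i \<in> carrier_mat (ms ! i) (ms ! i) \<and> pd_mat (T i)"
    and M: "\<forall>i<length ms. M i \<in> carrier_mat (ms ! i) (ms ! i) \<and> pd_mat (M i)"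
    and "open_loop_ineq X' \<beta> f (bdiag ms T) (bdiag ms M)"
    and cl: "closed_loop_ineq X X' \<kappa> \<beta> f (bdiag ms T) (bdiag ms M) Ac Bc Cc Dd"
    by (rule certE)
  let ?D = "Delta ms \<delta> k"
  define et where "et = ?D *\<^sub>v v"
  have et: "et \<in> carrier_vec m" unfolding et_def by (rule Delta_vec[OF v])
  have "et = 0\<^sub>v m"
  proof (rule ccontr)
    assume nz: "et \<noteq> 0\<^sub>v m"
    define u where "u = Cc *\<^sub>v et + Dd *\<^sub>v 0\<^sub>v N"
    define c where "c = Aps G *\<^sub>v 0\<^sub>v N + B1p G *\<^sub>v 0\<^sub>v nd + B2p G *\<^sub>v u"
    have c: "c \<in> carrier_vec m" unfolding c_def by (rule carrier_vecI) simp
    obtain ph where "ph \<in> carrier_vec m \<and> ph = App G *\<^sub>v (?D *\<^sub>v ph) + c"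
      using unique_affine_fixpoint[OF plant_carrier(6) Delta_carrier plant_loop_injective c] by (rule ex1E)
    then have ph: "ph \<in> carrier_vec m" "ph = App G *\<^sub>v (?D *\<^sub>v ph) + c" by (rule conjunct1, rule conjunct2)
    define th where "th = ?D *\<^sub>v ph"
    have th: "th \<in> carrier_vec m" unfolding th_def by (rule Delta_vec[OF ph(1)])
    have p: "pout (0\<^sub>v N) th (0\<^sub>v nd) u = ph"
      using pout_split[OF th, of "0\<^sub>v N" "0\<^sub>v nd" u] ph(2) by (simp add: c_def th_def)
    have ps: "Ac *\<^sub>v et + Bc *\<^sub>v 0\<^sub>v N = v"
      using fix_v v mult_mat_vec_zero[OF cert_carrier(2)] by (simp add: et_def[symmetric])
    have X0: "qf X (0\<^sub>v N) = 0" using X by (simp add: qf_def)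
    have "qf (bdiag ms T) ph + qf (bdiag ms M) (ph - v) < qf (bdiag ms T) th + qf (bdiag ms M) (th - et)"
      using cl[unfolded closed_loop_ineq_def, rule_format, OF zero_carrier_vec et th zero_carrier_vec disjI2[OF disjI1[OF nz]]]
        nonneg_terms[of "0\<^sub>v N" th "0\<^sub>v nd" u] unfolding u_def[symmetric] p ps X0 by simp
    moreover have "th - et = ?D *\<^sub>v (ph - v)"
      unfolding th_def et_def by (rule mult_minus_distrib_mat_vec[OF Delta_carrier ph(1) v, symmetric])
    moreover have "ph - v \<in> carrier_vec m" using ph v by simp
    ultimately show False
      using Delta_contraction[OF adm ph(1) T, of k] Delta_contraction[OF adm _ M, of "ph - v" k] by (simp add: th_def)
  qed
  then show ?thesis using fix_v mult_mat_vec_zero[OF cert_carrier(1)] by (simp add: et_def)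
qed

lemma cert_well_posed:
  assumes z: "z \<in> carrier_vec N" and d: "d \<in> carrier_vec nd"
  shows "\<exists>!(z', th, ph, e, y, u, thc, phc). cl_step G ms K \<delta> k z d z' th ph e y u thc phc"
proof -
  let ?D = "Delta ms \<delta> k"
  have Bz: "Bc *\<^sub>v z \<in> carrier_vec m" using cert_carrier z by auto
  obtain phc where phc: "phc \<in> carrier_vec m \<and> phc = Ac *\<^sub>v (?D *\<^sub>v phc) + Bc *\<^sub>v z"
    and phc_uniq: "\<forall>v. v \<in> carrier_vec m \<and> v = Ac *\<^sub>v (?D *\<^sub>v v) + Bc *\<^sub>v z \<longrightarrow> v = phc"
    by (rule ex1E[OF unique_affine_fixpoint[OF cert_carrier(1) Delta_carrier controller_loop_injective Bz]])
  define thc where "thc = ?D *\<^sub>v phc"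
  define u where "u = Cc *\<^sub>v thc + Dd *\<^sub>v z"
  define c where "c = Aps G *\<^sub>v z + B1p G *\<^sub>v d + B2p G *\<^sub>v u"
  have c: "c \<in> carrier_vec m" unfolding c_def by (rule carrier_vecI) simp
  obtain ph where ph: "ph \<in> carrier_vec m \<and> ph = App G *\<^sub>v (?D *\<^sub>v ph) + c"
    and ph_uniq: "\<forall>v. v \<in> carrier_vec m \<and> v = App G *\<^sub>v (?D *\<^sub>v v) + c \<longrightarrow> v = ph"
    by (rule ex1E[OF unique_affine_fixpoint[OF plant_carrier(6) Delta_carrier plant_loop_injective c]])
  define th where "th = ?D *\<^sub>v ph"
  let ?s = "(zout z th d u, th, ph, eout z th d u, z, u, thc, phc)"
  show ?thesis
  proof (rule ex1I[of _ ?s])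
    show "case ?s of (z', th, ph, e, y, u, thc, phc) \<Rightarrow> cl_step G ms K \<delta> k z d z' th ph e y u thc phc"
      unfolding prod.case cl_step_iff[OF z d]
      by (intro conjI phc[THEN conjunct1] phc[THEN conjunct2] ph[THEN conjunct1]
          ph[THEN conjunct2, unfolded c_def] thc_def u_def th_def refl)
  next
    fix s assume s: "case s of (z', th, ph, e, y, u, thc, phc) \<Rightarrow> cl_step G ms K \<delta> k z d z' th ph e y u thc phc"
    obtain z1 th1 ph1 e1 y1 u1 thc1 phc1 where s_eq: "s = (z1, th1, ph1, e1, y1, u1, thc1, phc1)"
      by (metis surj_pair)
    from s have st: "cl_step G ms K \<delta> k z d z1 th1 ph1 e1 y1 u1 thc1 phc1" by (simp add: s_eq)
    note st = st[unfolded cl_step_iff[OF z d]]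
    have phc1: "phc1 \<in> carrier_vec m \<and> phc1 = Ac *\<^sub>v (?D *\<^sub>v phc1) + Bc *\<^sub>v z" and thc1: "thc1 = ?D *\<^sub>v phc1"
      and y1: "y1 = z" and u1: "u1 = Cc *\<^sub>v thc1 + Dd *\<^sub>v z" and th1: "th1 = ?D *\<^sub>v ph1"
      and ph1: "ph1 \<in> carrier_vec m \<and> ph1 = App G *\<^sub>v (?D *\<^sub>v ph1) + (Aps G *\<^sub>v z + B1p G *\<^sub>v d + B2p G *\<^sub>v u1)"
      and ze1: "z1 = zout z th1 d u1" "e1 = eout z th1 d u1" using st by blast+
    have 1: "phc1 = phc" by (rule phc_uniq[rule_format, OF phc1])
    have 2: "thc1 = thc" unfolding thc1 1 thc_def ..
    have 3: "u1 = u" unfolding u1 2 u_def ..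
    have 4: "ph1 = ph" by (rule ph_uniq[rule_format, OF ph1[unfolded 3 c_def[symmetric]]])
    have 5: "th1 = th" unfolding th1 4 th_def ..
    show "s = ?s" unfolding s_eq ze1 y1 1 2 3 4 5 ..
  qed
qed

text \<open>The scheduling terms carry the same weights on outputs and inputs, and the inputs are
  images of the outputs under \<open>Delta\<close>, so by contraction these terms drop out. The
  all-zero case is separate because the strict closed-loop inequality excludes it.\<close>

lemma cert_dissipation:
  assumes z: "z \<in> carrier_vec N" and d: "d \<in> carrier_vec nd"
    and step: "cl_step G ms K \<delta> k z d z' th ph e y u thc phc"
  shows "qf X' z' + \<beta> * (e \<bullet> e) \<le> \<kappa> * qf X z + f * (d \<bullet> d)"
proof -
  obtain T M where T: "\<forall>i<length ms. T i \<in> carrier_mat (ms ! i) (ms ! i) \<and> pd_mat (T i)"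
    and M: "\<forall>i<length ms. M i \<in> carrier_mat (ms ! i) (ms ! i) \<and> pd_mat (M i)"
    and "open_loop_ineq X' \<beta> f (bdiag ms T) (bdiag ms M)"
    and cl: "closed_loop_ineq X X' \<kappa> \<beta> f (bdiag ms T) (bdiag ms M) Ac Bc Cc Dd"
    by (rule certE)
  note st = step[unfolded cl_step_iff[OF z d]]
  have ph: "ph \<in> carrier_vec m" and phc: "phc \<in> carrier_vec m" and th: "th = Delta ms \<delta> k *\<^sub>v ph"
    and thc: "thc = Delta ms \<delta> k *\<^sub>v phc" and u: "u = Cc *\<^sub>v thc + Dd *\<^sub>v z"
    and phc_eq: "phc = Ac *\<^sub>v (Delta ms \<delta> k *\<^sub>v phc) + Bc *\<^sub>v z"
    and ph_eq: "ph = App G *\<^sub>v (Delta ms \<delta> k *\<^sub>v ph) + (Aps G *\<^sub>v z + B1p G *\<^sub>v d + B2p G *\<^sub>v u)"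
    and ze: "z' = zout z th d u" "e = eout z th d u" using st by blast+
  have thv: "th \<in> carrier_vec m" "thc \<in> carrier_vec m" unfolding th thc by (rule Delta_vec[OF ph] Delta_vec[OF phc])+
  have ps: "Ac *\<^sub>v thc + Bc *\<^sub>v z = phc" unfolding thc by (rule phc_eq[symmetric])
  have p: "pout z th d u = ph" unfolding pout_split[OF thv(1)] unfolding th by (rule ph_eq[symmetric])
  show ?thesis
  proof (cases "z \<noteq> 0\<^sub>v N \<or> thc \<noteq> 0\<^sub>v m \<or> th \<noteq> 0\<^sub>v m \<or> d \<noteq> 0\<^sub>v nd")
    case True
    have "qf X' z' + qf (bdiag ms T) ph + qf (bdiag ms M) (ph - phc) + \<beta> * (e \<bullet> e)
        < \<kappa> * qf X z + qf (bdiag ms T) th + qf (bdiag ms M) (th - thc) + f * (d \<bullet> d)"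
      using cl[unfolded closed_loop_ineq_def, rule_format, OF z thv(2,1) d True] unfolding u[symmetric] ps p ze .
    moreover have "qf (bdiag ms T) th \<le> qf (bdiag ms T) ph" unfolding th by (rule Delta_contraction[OF adm ph T])
    moreover have "qf (bdiag ms M) (th - thc) \<le> qf (bdiag ms M) (ph - phc)"
      unfolding th thc mult_minus_distrib_mat_vec[OF Delta_carrier ph phc, symmetric]
      using ph phc by (intro Delta_contraction[OF adm _ M]) simp
    ultimately show ?thesis by linarith
  next
    case False
    then have 0: "z = 0\<^sub>v N" "thc = 0\<^sub>v m" "th = 0\<^sub>v m" "d = 0\<^sub>v nd" by auto
    then have "u = 0\<^sub>v nu" using u mult_mat_vec_zero[OF cert_carrier(3)] mult_mat_vec_zero[OF cert_carrier(4)] by simp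
    then have "z' = 0\<^sub>v N" "e = 0\<^sub>v ne" using ze out_zero 0 by auto
    then show ?thesis using 0 X X' by (simp add: qf_def)
  qed
qed

end

lemma cl_step_next_carrier: "cl_step G ms K \<delta> k z d z' th ph e y u thc phc \<Longrightarrow> z' \<in> carrier_vec N"
  unfolding cl_step_def Let_def plant_dim by blast

lemma cl_traj_carrier:
  assumes "cl_traj G ms K \<delta> z d e"
  shows "z k \<in> carrier_vec N"
proof (cases k)
  case 0
  then show ?thesis using assms by (simp add: cl_traj_def)
next
  case (Suc j)
  from assms obtain th ph y u thc phc where
    "\<forall>k. cl_step G ms K \<delta> k (z k) (d k) (z (Suc k)) (th k) (ph k) (e k) (y k) (u k) (thc k) (phc k)"
    by (auto simp: cl_traj_def)
  then show ?thesis using cl_step_next_carrier Suc by blast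
qed

end

section \<open>Bounds on the initial storage, and the certificates of all instants combined\<close>

lemma uniform_bound_upto:
  fixes P :: "nat \<Rightarrow> real \<Rightarrow> bool"
  assumes ex: "\<And>j. j \<le> h \<Longrightarrow> \<exists>c. P j c" and mono: "\<And>j c c'. P j c \<Longrightarrow> c \<le> c' \<Longrightarrow> P j c'"
  shows "\<exists>c. \<forall>j\<le>h. P j c"
proof -
  have "\<exists>c. j \<le> h \<longrightarrow> P j c" for j using ex by blast
  then obtain c where c: "\<And>j. j \<le> h \<Longrightarrow> P j (c j)" by metis
  have "P j (Max (c ` {..h}))" if "j \<le> h" for j
    using that by (intro mono[OF c[OF that]] Max_ge) auto
  then show ?thesis by blast
qed

text \<open>The ellipsoid is the image of the unit ball under the inverse square root
  \<open>S\<close> of \<open>P\<close>. The preimage is \<open>w = S P z\<close>, with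
  \<open>w \<bullet> w = z \<bullet> P z\<close> by symmetry of \<open>S\<close>.\<close>

lemma ellipsoid_preimage:
  assumes P: "P \<in> carrier_mat n n" and pd: "pd_mat P" and z: "z \<in> carrier_vec n"
    and le: "z \<bullet> (P *\<^sub>v z) \<le> 1"
  obtains w where "w \<in> carrier_vec n" "mat_inv_sqrt P *\<^sub>v w = z" "w \<bullet> w \<le> 1"
proof -
  note S = mat_inv_sqrt[OF P pd]
  let ?S = "mat_inv_sqrt P"
  define y where "y = P *\<^sub>v z"
  define w where "w = ?S *\<^sub>v y"
  have y: "y \<in> carrier_vec n" and w: "w \<in> carrier_vec n" using P z S by (auto simp: y_def w_def)
  have Sw: "?S *\<^sub>v w = z"
  proof -
    have "?S * ?S * P *\<^sub>v z = ?S *\<^sub>v (?S *\<^sub>v (P *\<^sub>v z))"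
      using assoc_mult_mat_vec[OF mult_carrier_mat[OF S(1) S(1)] P z] assoc_mult_mat_vec[OF S(1) S(1) y]
      by (simp add: y_def)
    then show ?thesis using S(2) z by (simp add: w_def y_def)
  qed
  have "w \<bullet> w = w \<bullet> (?S *\<^sub>v y)" by (simp add: w_def)
  also have "\<dots> = y \<bullet> (?S *\<^sub>v w)" by (rule sym_scalar_prod[OF S(1,3) w y])
  also have "\<dots> = z \<bullet> (P *\<^sub>v z)" using Sw comm_scalar_prod[OF y z] by (simp add: y_def)
  finally show ?thesis using that[OF w Sw] le by simp
qed

text \<open>Both components of the initial state are images of unit-ball vectors \<open>w1\<close>
  and \<open>w2\<close>. The Schur complement of the initial inequality, tested at these, bounds the
  storage by \<open>f11 * (w1 \<bullet> w1) + f12 * (w2 \<bullet> w2)\<close>.\<close>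

lemma initial_storage_bound:
  assumes PQ: "P \<in> carrier_mat n n" "pd_mat P" "Q \<in> carrier_mat Nbar Nbar" "pd_mat Q"
    and R: "R \<in> carrier_mat (n + Nbar) (n + Nbar)" and X: "X \<in> carrier_mat (n + Nbar) (n + Nbar)" "R * X = 1\<^sub>m (n + Nbar)"
    and f: "0 \<le> f11" "0 \<le> f12"
    and LMI: "pd_mat (four_block_mat
                     (diag_block_mat [f11 \<cdot>\<^sub>m 1\<^sub>m n, f12 \<cdot>\<^sub>m 1\<^sub>m Nbar])
                     (transpose_mat (diag_block_mat [mat_inv_sqrt P, mat_inv_sqrt Q]))
                     (diag_block_mat [mat_inv_sqrt P, mat_inv_sqrt Q])
                     R)"
    and z: "z \<in> init_set n Nbar P Q"
  shows "qf X z \<le> f11 + f12"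
proof -
  define z1 z2 where "z1 = vec_first z n" and "z2 = vec_last z Nbar"
  have zc: "z1 \<in> carrier_vec n" "z2 \<in> carrier_vec Nbar" and z_eq: "z = z1 @\<^sub>v z2"
    and le: "z1 \<bullet> (P *\<^sub>v z1) \<le> 1" "z2 \<bullet> (Q *\<^sub>v z2) \<le> 1"
    using z by (auto simp: init_set_def z1_def z2_def)
  obtain w1 where w1: "w1 \<in> carrier_vec n" "mat_inv_sqrt P *\<^sub>v w1 = z1" "w1 \<bullet> w1 \<le> 1"
    by (rule ellipsoid_preimage[OF PQ(1,2) zc(1) le(1)])
  obtain w2 where w2: "w2 \<in> carrier_vec Nbar" "mat_inv_sqrt Q *\<^sub>v w2 = z2" "w2 \<bullet> w2 \<le> 1"
    by (rule ellipsoid_preimage[OF PQ(3,4) zc(2) le(2)])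
  let ?F = "diag_block_mat [f11 \<cdot>\<^sub>m 1\<^sub>m n, f12 \<cdot>\<^sub>m 1\<^sub>m Nbar]" and ?C = "diag_block_mat [mat_inv_sqrt P, mat_inv_sqrt Q]"
  have I: "c \<cdot>\<^sub>m 1\<^sub>m k \<in> carrier_mat k k" for c :: real and k by simp
  note S = mat_inv_sqrt(1)[OF PQ(1,2)] mat_inv_sqrt(1)[OF PQ(3,4)]
  have F: "?F \<in> carrier_mat (n + Nbar) (n + Nbar)" by (rule diag2_carrier[OF I I])
  have C: "?C \<in> carrier_mat (n + Nbar) (n + Nbar)" by (rule diag2_carrier[OF S])
  have w: "w1 @\<^sub>v w2 \<in> carrier_vec (n + Nbar)" using w1 w2 by simp
  have Cw: "?C *\<^sub>v (w1 @\<^sub>v w2) = z" unfolding diag2_mult_vec[OF S w1(1) w2(1)] w1 w2 z_eq ..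
  have y: "- (X *\<^sub>v z) \<in> carrier_vec (n + Nbar)" using X zc z_eq by simp
  have "0 \<le> qf (four_block_mat ?F (transpose_mat ?C) ?C R) ((w1 @\<^sub>v w2) @\<^sub>v - (X *\<^sub>v z))"
    by (rule pd_matD(3)[OF LMI four_block_carrier_mat[OF F R]]) (use w y in simp)
  also have "\<dots> = qf ?F (w1 @\<^sub>v w2) - qf X z"
    using schur_test[OF F C R X w] unfolding Cw .
  also have "qf ?F (w1 @\<^sub>v w2) = f11 * (w1 \<bullet> w1) + f12 * (w2 \<bullet> w2)"
    unfolding qf_diag2[OF I I w1(1) w2(1)] qf_smult_one[OF w1(1)] qf_smult_one[OF w2(1)] ..
  finally have "qf X z \<le> f11 * (w1 \<bullet> w1) + f12 * (w2 \<bullet> w2)" by simp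
  also have "\<dots> \<le> f11 * 1 + f12 * 1" using f w1 w2 by (intro add_mono mult_left_mono)
  finally show ?thesis by simp
qed

text \<open>The test vector is \<open>(1, - 1 / c)\<close>, so the value is the scalar Schur
  complement \<open>a - 1 / c\<close>.\<close>

lemma psd_scalar_block:
  assumes "psd_mat (four_block_mat (sc a) (sc 1) (sc 1) (sc c))" "c > 0"
  shows "1 / c \<le> a"
proof -
  have s: "sc x \<in> carrier_mat 1 1" for x by (simp add: sc_def)
  have s_eq: "sc x = x \<cdot>\<^sub>m 1\<^sub>m 1" for x by (intro eq_matI) (auto simp: sc_def)
  have s1: "sc 1 = 1\<^sub>m 1" by (intro eq_matI) (auto simp: sc_def)
  define v where "v = vec 1 (\<lambda>_. 1 :: real)"
  define w where "w = vec 1 (\<lambda>_. - 1 / c)"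
  have v: "v \<in> carrier_vec 1" and w: "w \<in> carrier_vec 1" by (auto simp: v_def w_def)
  have "0 \<le> qf (four_block_mat (sc a) (sc 1) (sc 1) (sc c)) (v @\<^sub>v w)"
    by (rule psd_matD[OF assms(1) four_block_carrier_mat[OF s s] append_carrier_vec[OF v w]])
  also have "\<dots> = a - 2 / c + c * (1 / c)\<^sup>2"
    unfolding s1 qf_four_block_one[OF s s v w] unfolding s_eq qf_smult_one[OF v] qf_smult_one[OF w]
    by (simp add: v_def w_def scalar_prod_def power2_eq_square)
  finally show ?thesis using assms(2) by (simp add: power2_eq_square field_simps)
qed

theorem theorem1:
  fixes G :: lpv_plant and n Nbar nd ne nu hbar r :: nat and ms :: "nat list"
    and P Q NR :: "real mat" and \<gamma> :: real
    and R0 :: "nat \<Rightarrow> real mat" and R S :: "nat \<Rightarrow> nat \<Rightarrow> real mat"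
    and b f11 f12 f2 g t :: real
  assumes dims: "plant_dims G (n + Nbar) ms nd ne nu (n + Nbar)"
    and meas: "C2s G = 1\<^sub>m (n + Nbar)" "C2p G = 0\<^sub>m (n + Nbar) (sum_list ms)"
              "D21 G = 0\<^sub>m (n + Nbar) nd"
    and PQ: "P \<in> carrier_mat n n" "pd_mat P" "Q \<in> carrier_mat Nbar Nbar" "pd_mat Q"
    and NR: "NR \<in> carrier_mat (n + Nbar + sum_list ms + ne) r"
            "transpose_mat NR * NR = 1\<^sub>m r"
            "{NR *\<^sub>v x | x. x \<in> carrier_vec r} =
             {v \<in> carrier_vec (n + Nbar + sum_list ms + ne). plant_W G *\<^sub>v v = 0\<^sub>v nu}"
    and R0_pd: "\<And>k. k \<le> hbar \<Longrightarrow> R0 k \<in> carrier_mat (n + Nbar) (n + Nbar) \<and> pd_mat (R0 k)"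
    and R0_end: "R0 (Suc hbar) = R0 hbar"
    and RS_pd: "\<And>i k. i < length ms \<Longrightarrow> k \<le> hbar \<Longrightarrow>
                  R i k \<in> carrier_mat (ms ! i) (ms ! i) \<and> pd_mat (R i k) \<and>
                  S i k \<in> carrier_mat (ms ! i) (ms ! i) \<and> pd_mat (S i k)"
    and scal_pos: "b > 0" "f11 > 0" "f12 > 0" "f2 > 0" "g > 0" "t > 0"
    and sum_lt: "b + f11 + f12 + f2 < 2 * \<gamma>"
    and LMI_init: "pd_mat (four_block_mat
                     (diag_block_mat [f11 \<cdot>\<^sub>m 1\<^sub>m n, f12 \<cdot>\<^sub>m 1\<^sub>m Nbar])
                     (transpose_mat (diag_block_mat [mat_inv_sqrt P, mat_inv_sqrt Q]))
                     (diag_block_mat [mat_inv_sqrt P, mat_inv_sqrt Q])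
                     (R0 0))"
    and LMI_R: "\<And>k. k \<le> hbar \<Longrightarrow> nd_mat (transpose_mat NR *
                  (plant_H G * diag_block_mat [R0 k, diag_block_mat (map (\<lambda>i. R i k) [0..<length ms]), g \<cdot>\<^sub>m 1\<^sub>m nd]
                     * transpose_mat (plant_H G)
                   - diag_block_mat [R0 (Suc k), diag_block_mat (map (\<lambda>i. R i k) [0..<length ms]), b \<cdot>\<^sub>m 1\<^sub>m ne])
                  * NR)"
    and LMI_S: "\<And>k. k \<le> hbar \<Longrightarrow> pd_mat (four_block_mat
                  (diag_block_mat [diag_block_mat (map (\<lambda>i. S i k) [0..<length ms]), f2 \<cdot>\<^sub>m 1\<^sub>m nd]
                   - transpose_mat (plant_H22 G) *
                       diag_block_mat [diag_block_mat (map (\<lambda>i. S i k) [0..<length ms]), t \<cdot>\<^sub>m 1\<^sub>m ne]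
                     * plant_H22 G)
                  (transpose_mat (plant_H12 G))
                  (plant_H12 G)
                  (R0 (Suc k)))"
    and LMI_RS: "\<And>i k. i < length ms \<Longrightarrow> k \<le> hbar \<Longrightarrow>
                  psd_mat (four_block_mat (R i k) (1\<^sub>m (ms ! i)) (1\<^sub>m (ms ! i)) (S i k))"
    and LMI_gf: "psd_mat (four_block_mat (sc g) (sc 1) (sc 1) (sc f2))"
    and LMI_tb: "psd_mat (four_block_mat (sc t) (sc 1) (sc 1) (sc b))"
  shows "\<exists>K :: nslpv_ctrl. ctrl_dims K (length ms) (n + Nbar) nu \<and> ctrl_ev_periodic hbar 1 K \<and>
           cl_robustly_stable G ms K \<and> cl_perf G ms K n Nbar P Q < ereal \<gamma>"
proof -
  let ?N = "n + Nbar"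
  interpret lft_plant G ?N nd ne nu ms by unfold_locales (rule dims)
  have "\<exists>X. k \<le> hbar \<longrightarrow> X \<in> carrier_mat ?N ?N \<and> pd_mat X \<and> R0 k * X = 1\<^sub>m ?N" for k
    using R0_pd[of k] pd_mat_inverse[of "R0 k" ?N] by metis
  then obtain Y where Y: "\<And>k. k \<le> hbar \<Longrightarrow> Y k \<in> carrier_mat ?N ?N \<and> pd_mat (Y k) \<and> R0 k * Y k = 1\<^sub>m ?N"
    by metis
  \<comment> \<open>Clamping the index at \<open>hbar\<close> expresses the terminal condition, so
    that inverses are needed only up to \<open>hbar\<close>.\<close>
  have R0_Suc: "R0 (Suc k) = R0 (min (Suc k) hbar)" if "k \<le> hbar" for k
    using R0_end that by (cases "k = hbar") auto
  have gf: "1 / f2 \<le> g" by (rule psd_scalar_block[OF LMI_gf scal_pos(4)])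
  have tb: "1 / b \<le> t" by (rule psd_scalar_block[OF LMI_tb scal_pos(1)])
  have "\<exists>\<kappa> Ac Bc Cc Dd. k \<le> hbar \<longrightarrow> 0 < \<kappa> \<and> \<kappa> < 1 \<and>
      step_cert (Y k) (Y (min (Suc k) hbar)) \<kappa> (1 / b) f2 Ac Bc Cc Dd" for k
  proof (cases "k \<le> hbar")
    case True
    have R0': "R0 (Suc k) \<in> carrier_mat ?N ?N" using R0_pd[of "min (Suc k) hbar"] R0_Suc[OF True] by simp
    have Y': "Y (min (Suc k) hbar) \<in> carrier_mat ?N ?N" "pd_mat (Y (min (Suc k) hbar))"
      "R0 (Suc k) * Y (min (Suc k) hbar) = 1\<^sub>m ?N"
      using Y[of "min (Suc k) hbar"] R0_Suc[OF True] by auto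
    have "\<exists>\<kappa> Ac Bc Cc Dd. 0 < \<kappa> \<and> \<kappa> < 1 \<and> step_cert (Y k) (Y (min (Suc k) hbar)) \<kappa> (1 / b) f2 Ac Bc Cc Dd"
    proof (rule step_synthesis[OF _ _ R0' _ _ _ Y' _ scal_pos(1,4) gf tb NR(1,3)])
      show "\<forall>i<length ms. R i k \<in> carrier_mat (ms ! i) (ms ! i) \<and> pd_mat (R i k) \<and>
          S i k \<in> carrier_mat (ms ! i) (ms ! i) \<and> pd_mat (S i k)" using RS_pd True by blast
      show "\<forall>i<length ms. psd_mat (four_block_mat (R i k) (1\<^sub>m (ms ! i)) (1\<^sub>m (ms ! i)) (S i k))"
        using LMI_RS True by blast
    qed (use R0_pd[OF True] Y[OF True] LMI_R[OF True] LMI_S[OF True] in \<open>simp_all only: bdiag_def\<close>)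
    then show ?thesis by blast
  qed simp
  then obtain \<kappa> Ac Bc Cc Dd where cert0: "\<And>k. k \<le> hbar \<Longrightarrow> 0 < \<kappa> k \<and> \<kappa> k < 1 \<and>
      step_cert (Y k) (Y (min (Suc k) hbar)) (\<kappa> k) (1 / b) f2 (Ac k) (Bc k) (Cc k) (Dd k)" by metis
  \<comment> \<open>Storage matrices for all times. From \<open>hbar\<close> on they are constant,
    and the certificate of instant \<open>hbar\<close>, which leads from \<open>Y hbar\<close> back
    to \<open>Y hbar\<close>, covers every later step.\<close>
  define V where "V k = Y (min k hbar)" for k
  have V: "V k \<in> carrier_mat ?N ?N" "pd_mat (V k)" for k using Y[of "min k hbar"] by (auto simp: V_def)
  define K where "K = \<lparr>Acpp = (\<lambda>k. Ac (min k hbar)), Bcp = (\<lambda>k. Bc (min k hbar)),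
    Ccp = (\<lambda>k. Cc (min k hbar)), Dc = (\<lambda>k. Dd (min k hbar)), mcs = (\<lambda>_. ms)\<rparr>"
  have K: "mcs K k = ms" "Acpp K k = Ac (min k hbar)" "Bcp K k = Bc (min k hbar)" "Ccp K k = Cc (min k hbar)"
    "Dc K k = Dd (min k hbar)" for k by (simp_all add: K_def)
  have cert: "step_cert (V k) (V (Suc k)) (\<kappa> (min k hbar)) (1 / b) f2
      (Ac (min k hbar)) (Bc (min k hbar)) (Cc (min k hbar)) (Dd (min k hbar))" for k
    using cert0[of "min k hbar"] by (cases "k \<le> hbar") (auto simp: V_def min_def split: if_splits)
  \<comment> \<open>Only \<open>hbar + 1\<close> different decay factors occur, so their maximum is
    a uniform factor below 1.\<close>
  define \<mu> where "\<mu> = Max (\<kappa> ` {..hbar})"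
  have \<mu>: "0 < \<mu>" "\<mu> < 1" "\<And>k. \<kappa> (min k hbar) \<le> \<mu>"
  proof -
    show \<kappa>_le: "\<kappa> (min k hbar) \<le> \<mu>" for k unfolding \<mu>_def by (intro Max_ge) auto
    show "0 < \<mu>" using cert0[of 0] \<kappa>_le[of 0] by auto
    show "\<mu> < 1" unfolding \<mu>_def using cert0 by (subst Max_less_iff) auto
  qed
  have b_pos: "0 < 1 / b" using scal_pos by simp
  have V_nonneg: "0 \<le> qf (V k) v" if "v \<in> carrier_vec ?N" for k v by (rule pd_matD(3)[OF V(2,1) that])
  have dissipation: "qf (V (Suc k)) (z (Suc k)) + (1 / b) * (e k \<bullet> e k) \<le> \<mu> * qf (V k) (z k) + f2 * (d k \<bullet> d k)"
    if adm: "admissible (length ms) \<delta>" and traj: "cl_traj G ms K \<delta> z d e" and d: "\<forall>k. d k \<in> carrier_vec nd"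
    for \<delta> z d e k
  proof -
    obtain th ph y u thc phc where
      "cl_step G ms K \<delta> k (z k) (d k) (z (Suc k)) (th k) (ph k) (e k) (y k) (u k) (thc k) (phc k)"
      using traj unfolding cl_traj_def by blast
    from cert_dissipation[OF cert V(1) V(1) V(2) b_pos adm meas K cl_traj_carrier[OF traj] d[rule_format] this]
    have "qf (V (Suc k)) (z (Suc k)) + (1 / b) * (e k \<bullet> e k)
        \<le> \<kappa> (min k hbar) * qf (V k) (z k) + f2 * (d k \<bullet> d k)" .
    moreover have "\<kappa> (min k hbar) * qf (V k) (z k) \<le> \<mu> * qf (V k) (z k)"
      by (intro mult_right_mono \<mu>(3) V_nonneg cl_traj_carrier[OF traj])
    ultimately show ?thesis by linarith
  qed
  have well_posed: "cl_well_posed G ms K"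
    unfolding cl_well_posed_def
    using cert_well_posed[OF cert V(1) V(1) V(2) b_pos _ meas K] by simp
  have stable: "cl_robustly_stable G ms K"
  proof -
    \<comment> \<open>The storage must bound the squared norm from above uniformly in time, which
      concerns finitely many matrices. The converse bound is needed only at time 0.\<close>
    have "\<exists>c. \<forall>j\<le>hbar. 0 < c \<and> (\<forall>v \<in> carrier_vec ?N. v \<bullet> v \<le> c * qf (Y j) v)"
    proof (rule uniform_bound_upto)
      fix j assume j: "j \<le> hbar"
      obtain c where "c > 0" "\<forall>v \<in> carrier_vec ?N. qf (1\<^sub>m ?N) v \<le> c * qf (Y j) v"
        "\<forall>v \<in> carrier_vec ?N. v \<noteq> 0\<^sub>v ?N \<longrightarrow> qf (1\<^sub>m ?N) v < c * qf (Y j) v"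
      proof (rule pd_form_dominates[of "Y j" ?N "1\<^sub>m ?N"])
        show "0 < qf (Y j) v" if "v \<in> carrier_vec ?N" "v \<noteq> 0\<^sub>v ?N" for v
          using Y[OF j] that by (intro pd_matD(2)) auto
      qed (use Y[OF j] in auto)
      then show "\<exists>c. 0 < c \<and> (\<forall>v \<in> carrier_vec ?N. v \<bullet> v \<le> c * qf (Y j) v)"
        by (intro exI[of _ c]) (auto simp: qf_one)
    next
      fix j c c' assume *: "0 < c \<and> (\<forall>v \<in> carrier_vec ?N. v \<bullet> v \<le> c * qf (Y j) v)" "c \<le> (c' :: real)"
      have "v \<bullet> v \<le> c' * qf (Y j) v" if v: "v \<in> carrier_vec ?N" for v
      proof -
        have le: "v \<bullet> v \<le> c * qf (Y j) v" using * v by blast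
        then have "0 \<le> c * qf (Y j) v" using scalar_self_nonneg[of v] by linarith
        then have "0 \<le> qf (Y j) v" using * by (simp add: zero_le_mult_iff)
        then have "c * qf (Y j) v \<le> c' * qf (Y j) v" using * by (intro mult_right_mono) auto
        with le show ?thesis by linarith
      qed
      then show "0 < c' \<and> (\<forall>v \<in> carrier_vec ?N. v \<bullet> v \<le> c' * qf (Y j) v)" using * by auto
    qed
    then obtain c1 where c1_bound: "\<forall>j\<le>hbar. 0 < c1 \<and> (\<forall>v \<in> carrier_vec ?N. v \<bullet> v \<le> c1 * qf (Y j) v)" by blast
    have c1: "0 < c1" "\<And>k v. v \<in> carrier_vec ?N \<Longrightarrow> v \<bullet> v \<le> c1 * qf (V k) v"
      using c1_bound by (auto simp: V_def)
    have one_pos: "0 < qf (1\<^sub>m ?N) v" if "v \<in> carrier_vec ?N" "v \<noteq> 0\<^sub>v ?N" for v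
      using scalar_self_pos[OF that] that by (simp add: qf_one)
    obtain c2 where c2: "c2 > 0" "\<forall>v \<in> carrier_vec ?N. qf (V 0) v \<le> c2 * qf (1\<^sub>m ?N) v"
      and "\<forall>v \<in> carrier_vec ?N. v \<noteq> 0\<^sub>v ?N \<longrightarrow> qf (V 0) v < c2 * qf (1\<^sub>m ?N) v"
      by (rule pd_form_dominates[OF one_carrier_mat V(1) one_pos])
    \<comment> \<open>Storage is quadratic in the state, so the norm decays with the square root of
      the factor \<open>\<mu>\<close>.\<close>
    have "vnorm (z k) \<le> sqrt (c1 * c2) * sqrt \<mu> ^ k * vnorm (z 0)"
      if adm: "admissible (length ms) \<delta>" and traj: "cl_traj G ms K \<delta> z (\<lambda>_. 0\<^sub>v nd) e" for \<delta> z e k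
    proof -
      note zc = cl_traj_carrier[OF traj]
      have "qf (V k) (z k) \<le> \<mu> ^ k * qf (V 0) (z 0)"
      proof (induction k)
        case (Suc k)
        have "0 \<le> (1 / b) * (e k \<bullet> e k)" using b_pos scalar_self_nonneg by simp
        then have "qf (V (Suc k)) (z (Suc k)) \<le> \<mu> * qf (V k) (z k)"
          using dissipation[OF adm traj, of k] by simp
        also have "\<dots> \<le> \<mu> * (\<mu> ^ k * qf (V 0) (z 0))" using Suc \<mu> by (intro mult_left_mono) auto
        finally show ?case by (simp add: mult.assoc)
      qed simp
      moreover have "qf (V 0) (z 0) \<le> c2 * (z 0 \<bullet> z 0)" using c2(2) zc[of 0] by (auto simp: qf_one)
      ultimately have "qf (V k) (z k) \<le> \<mu> ^ k * (c2 * (z 0 \<bullet> z 0))"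
        using \<mu>(1) by (meson mult_left_mono order_trans zero_le_power less_imp_le)
      then have "z k \<bullet> z k \<le> c1 * (\<mu> ^ k * (c2 * (z 0 \<bullet> z 0)))"
        using c1(2)[OF zc[of k], of k] c1(1) by (meson mult_left_mono order_trans less_imp_le)
      then have "sqrt (z k \<bullet> z k) \<le> sqrt ((c1 * c2) * \<mu> ^ k * (z 0 \<bullet> z 0))"
        by (intro real_sqrt_le_mono) (simp add: algebra_simps)
      then show ?thesis by (simp add: vnorm_def real_sqrt_mult real_sqrt_power)
    qed
    moreover have "0 \<le> sqrt \<mu>" "sqrt \<mu> < 1" using \<mu> by auto
    ultimately show ?thesis unfolding cl_robustly_stable_def plant_dim using well_posed by blast
  qed
  define F where "F = f11 + f12 + f2"
  have perf_bound: "l2norm e \<le> ereal (sqrt (b * F))"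
    if adm: "admissible (length ms) \<delta>" and d: "\<forall>k. d k \<in> carrier_vec nd" and d1: "l2norm d \<le> 1"
      and z0: "z 0 \<in> init_set n Nbar P Q" and traj: "cl_traj G ms K \<delta> z d e" for \<delta> z d e
  proof -
    have sd: "summable (\<lambda>k. d k \<bullet> d k)" using d1 by (auto simp: l2norm_def split: if_splits)
    then have sd1: "(\<Sum>k. d k \<bullet> d k) \<le> 1" using d1 by (simp add: l2norm_def)
    have d_sum: "(\<Sum>k<j. d k \<bullet> d k) \<le> 1" for j
      using sum_le_suminf[OF sd, of "{..<j}"] scalar_self_nonneg sd1 by force
    have V0: "qf (V 0) (z 0) \<le> f11 + f12"
      using initial_storage_bound[OF PQ _ _ _ _ _ LMI_init z0, of "V 0"] R0_pd[of 0] Y[of 0] scal_pos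
      by (simp add: V_def)
    \<comment> \<open>Summed dissipation. For the gain the decay factor is simply bounded by 1, so
      that the storage terms telescope.\<close>
    have storage: "(1 / b) * (\<Sum>k<j. e k \<bullet> e k) + qf (V j) (z j) \<le> qf (V 0) (z 0) + f2 * (\<Sum>k<j. d k \<bullet> d k)" for j
    proof (induction j)
      case (Suc j)
      have "\<mu> * qf (V j) (z j) \<le> qf (V j) (z j)"
        using \<mu> V_nonneg[OF cl_traj_carrier[OF traj]] by (simp add: mult_left_le_one_le)
      with dissipation[OF adm traj d, of j] Suc show ?case by (simp add: algebra_simps)
    qed simp
    have "(1 / b) * (\<Sum>k<j. e k \<bullet> e k) \<le> F" for j
    proof -
      have "f2 * (\<Sum>k<j. d k \<bullet> d k) \<le> f2 * 1" using d_sum[of j] scal_pos(4) by (intro mult_left_mono) auto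
      with storage[of j] V0 V_nonneg[OF cl_traj_carrier[OF traj, of j], of j] show ?thesis
        by (simp add: F_def)
    qed
    then have bd: "(\<Sum>k<j. e k \<bullet> e k) \<le> b * F" for j using scal_pos(1) by (simp add: field_simps)
    then have se: "summable (\<lambda>k. e k \<bullet> e k)"
      by (intro summableI_nonneg_bounded[where x = "b * F"] scalar_self_nonneg)
    have "(\<Sum>k. e k \<bullet> e k) \<le> b * F" by (rule suminf_le_const[OF se bd])
    with se show ?thesis by (simp add: l2norm_def)
  qed
  have "cl_perf G ms K n Nbar P Q \<le> ereal (sqrt (b * F))"
    unfolding cl_perf_def by (rule Sup_least) (use perf_bound in auto)
  moreover have "sqrt (b * F) \<le> (b + F) / 2" using scal_pos by (intro arith_geo_mean_sqrt) (auto simp: F_def)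
  moreover have "(b + F) / 2 < \<gamma>" using sum_lt by (simp add: F_def)
  ultimately have perf: "cl_perf G ms K n Nbar P Q < ereal \<gamma>"
    by (meson ereal_less_eq(3) le_less_trans less_ereal.simps(1) order_trans)
  have "ctrl_dims K (length ms) ?N nu"
    unfolding ctrl_dims_def Let_def K using cert by (auto simp: step_cert_def)
  moreover have "ctrl_ev_periodic hbar 1 K"
    by (auto simp: ctrl_ev_periodic_def ev_periodic_def K)
  ultimately show ?thesis using stable perf by blast
qed

end
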